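(* The decision version of \textsc{Best Red Response} is NP-complete. This holds even for the special question: given an Escape Sensing Game and a target ordering $\sigma$, decide whether there is a sensing plan $\psi$ that is valid with respect to $\sigma$ and senses all targets, i.e. $\bigcup_{s\in S}\psi(s)=T$.
   Context: An Escape Sensing Game (ESG) consists of: a finite set of targets $T=\{t_1,\dots,t_n\}$, each $t_i$ with a value $v_i\in\mathbb{R}^+$ (rational when part of a computational input); a finite set of sensors $S=\{s_1,\dots,s_k\}$; a recharging time $\tau\in\mathbb{N}\cup\{\infty\}$ common to all sensors; and a sensing matrix $D\in\{0,1\}^{n\times k}$, where $D_{i,j}=1$ means that sensor $s_j$ is capable of sensing target $t_i$. A target ordering (strategy of the blue player) is a bijection $\sigma:T\to[n]$. A sensing plan (strategy of the red player) is a map $\psi:S\to 2^T$ with $\psi(s)\cap\psi(s')=\emptyset$ for all $s\neq s'\in S$. The plan $\psi$ is valid with respect to $\sigma$ if (i) for each $s_j\in S$ and $t_i\in\psi(s_j)$ we have $D_{i,j}=1$, and (ii) for each $s\in S$ and all distinct $t,t'\in\psi(s)$ we have $|\sigma(t)-\sigma(t')|>\tau$ (so if $\tau=\infty$ each sensor senses at most one target). The value of not-sensed targets is $v(\psi)=\sum_{t_i\in T\setminus\bigcup_{s\in S}\psi(s)}v_i$. \textsc{Best Red Response}: given an ESG and a target ordering $\sigma$, find a sensing plan $\psi$ that is valid with respect to $\sigma$ and minimizes $v(\psi)$ among all such plans. Decision version: given additionally a threshold $q\geq 0$, decide whether there is a plan $\psi$ valid with respect to $\sigma$ with $v(\psi)\leq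 q$. *)

theory Defs
  imports Complex_Main "HOL-Library.Extended_Nat" "HOL-Computational_Algebra.Polynomial"
begin

section \<open>Turing machines and NP-completeness\<close>

text \<open>
  Nondeterministic multi-tape Turing machines. States and tape symbols are natural numbers;
  since the transition relation is finite, only finitely many of them are in use. The symbol 0
  is the blank, and the input bits False and True are written as 1 and 2. Tapes are infinite in
  both directions. A transition \<open>(q, r, q', w, m)\<close> applies in state \<open>q\<close> when the heads read
  \<open>r\<close>; it enters \<open>q'\<close>, writes \<open>w\<close> and then moves the heads by \<open>m\<close>. A configuration to which no
  transition applies is halting.
\<close>

datatype move = Go_Left | Stay | Go_Right

record tm =
  num_tapes :: nat
  start_state :: nat
  accept_state :: nat
  delta :: "(nat \<times> nat list \<times> nat \<times> nat list \<times> move list) set"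

definition wf_tm :: "tm \<Rightarrow> bool" where
  "wf_tm M \<longleftrightarrow> num_tapes M \<ge> 1 \<and> finite (delta M) \<and>
     (\<forall>(q, r, q', w, m) \<in> delta M.
        length r = num_tapes M \<and> length w = num_tapes M \<and> length m = num_tapes M)"

definition deterministic :: "tm \<Rightarrow> bool" where
  "deterministic M \<longleftrightarrow>
     (\<forall>q r a b. (q, r, a) \<in> delta M \<longrightarrow> (q, r, b) \<in> delta M \<longrightarrow> a = b)"

text \<open>A tape consists of its contents and the position of its head.\<close>

type_synonym tape = "(int \<Rightarrow> nat) \<times> int"
type_synonym config = "nat \<times> tape list"

fun shift :: "move \<Rightarrow> int" where
  "shift Go_Left = -1"
| "shift Stay = 0"
| "shift Go_Right = 1"

fun read_tape :: "tape \<Rightarrow> nat" where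
  "read_tape (f, h) = f h"

fun act :: "nat \<times> move \<Rightarrow> tape \<Rightarrow> tape" where
  "act (a, d) (f, h) = (f(h := a), h + shift d)"

inductive tm_step :: "tm \<Rightarrow> config \<Rightarrow> config \<Rightarrow> bool" for M :: tm where
  "(q, map read_tape ts, q', w, m) \<in> delta M \<Longrightarrow>
     tm_step M (q, ts) (q', map2 act (zip w m) ts)"

definition halting :: "tm \<Rightarrow> config \<Rightarrow> bool" where
  "halting M c \<longleftrightarrow> \<not> (\<exists>c'. tm_step M c c')"

definition tape_of :: "bool list \<Rightarrow> int \<Rightarrow> nat" where
  "tape_of x i =
     (if 0 \<le> i \<and> i < int (length x) then (if x ! nat i then 2 else 1) else 0)"

definition initial :: "tm \<Rightarrow> bool list \<Rightarrow> config" where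
  "initial M x =
     (start_state M, (tape_of x, 0) # replicate (num_tapes M - 1) (\<lambda>_. 0, 0))"

definition accepts :: "tm \<Rightarrow> bool list \<Rightarrow> bool" where
  "accepts M x \<longleftrightarrow>
     (\<exists>c. (tm_step M)\<^sup>*\<^sup>* (initial M x) c \<and> halting M c \<and> fst c = accept_state M)"

definition NP :: "bool list set set" where
  "NP = {L. \<exists>M (p :: nat poly). wf_tm M \<and>
          (\<forall>x n c. (tm_step M ^^ n) (initial M x) c \<longrightarrow> n \<le> poly p (length x)) \<and>
          (\<forall>x. x \<in> L \<longleftrightarrow> accepts M x)}"

text \<open>The output of a function-computing machine is the contents of its last tape.\<close>

definition polytime_computable :: "(bool list \<Rightarrow> bool list) \<Rightarrow> bool" where
  "polytime_computable f \<longleftrightarrow> (\<exists>M (p :: nat poly). wf_tm M \<and> deterministic M \<and>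
     (\<forall>x. \<exists>n c. n \<le> poly p (length x) \<and> (tm_step M ^^ n) (initial M x) c \<and>
            halting M c \<and> fst (last (snd c)) = tape_of (f x)))"

definition polytime_reducible :: "bool list set \<Rightarrow> bool list set \<Rightarrow> bool" where
  "polytime_reducible A B \<longleftrightarrow> (\<exists>f. polytime_computable f \<and> (\<forall>x. x \<in> A \<longleftrightarrow> f x \<in> B))"

definition NP_hard :: "bool list set \<Rightarrow> bool" where
  "NP_hard L \<longleftrightarrow> (\<forall>A \<in> NP. polytime_reducible A L)"

definition NP_complete :: "bool list set \<Rightarrow> bool" where
  "NP_complete L \<longleftrightarrow> L \<in> NP \<and> NP_hard L"


section \<open>Escape sensing games\<close>

record ('t, 's) esg =
  targets :: "'t set"
  sensors :: "'s set"
  target_value :: "'t \<Rightarrow> real"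
  recharge :: enat
  can_sense :: "'s \<Rightarrow> 't \<Rightarrow> bool"

definition wf_esg :: "('t, 's) esg \<Rightarrow> bool" where
  "wf_esg G \<longleftrightarrow> finite (targets G) \<and> finite (sensors G) \<and> (\<forall>t \<in> targets G. target_value G t > 0)"

definition target_ordering :: "('t, 's) esg \<Rightarrow> ('t \<Rightarrow> nat) \<Rightarrow> bool" where
  "target_ordering G \<sigma> \<longleftrightarrow> bij_betw \<sigma> (targets G) {1..card (targets G)}"

definition sensing_plan :: "('t, 's) esg \<Rightarrow> ('s \<Rightarrow> 't set) \<Rightarrow> bool" where
  "sensing_plan G \<psi> \<longleftrightarrow> (\<forall>s \<in> sensors G. \<psi> s \<subseteq> targets G) \<and>
     (\<forall>s \<in> sensors G. \<forall>s' \<in> sensors G. s \<noteq> s' \<longrightarrow> \<psi> s \<inter> \<psi> s' = {})"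

definition valid_plan :: "('t, 's) esg \<Rightarrow> ('t \<Rightarrow> nat) \<Rightarrow> ('s \<Rightarrow> 't set) \<Rightarrow> bool" where
  "valid_plan G \<sigma> \<psi> \<longleftrightarrow>
     (\<forall>s \<in> sensors G. \<forall>t \<in> \<psi> s. can_sense G s t) \<and>
     (\<forall>s \<in> sensors G. \<forall>t \<in> \<psi> s. \<forall>t' \<in> \<psi> s. t \<noteq> t' \<longrightarrow>
        enat (nat \<bar>int (\<sigma> t) - int (\<sigma> t')\<bar>) > recharge G)"

definition sensed :: "('t, 's) esg \<Rightarrow> ('s \<Rightarrow> 't set) \<Rightarrow> 't set" where
  "sensed G \<psi> = (\<Union>s \<in> sensors G. \<psi> s)"

definition unsensed_value :: "('t, 's) esg \<Rightarrow> ('s \<Rightarrow> 't set) \<Rightarrow> real" where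
  "unsensed_value G \<psi> = (\<Sum>t \<in> targets G - sensed G \<psi>. target_value G t)"


section \<open>Computational instances and their encoding\<close>

text \<open>
  An instance is a game together with a target ordering. The targets and sensors are the indices
  into the lists of values and of matrix columns. A rational number is a pair of numerator and
  denominator, not necessarily in lowest terms. The matrix is stored by columns, that is, one
  list of bits (indexed by the targets) for each sensor.
\<close>

type_synonym ratio = "nat \<times> nat"

fun ratio_val :: "ratio \<Rightarrow> real" where
  "ratio_val (a, b) = real a / real b"

record esg_inst =
  inst_values :: "ratio list"
  inst_recharge :: enat
  inst_columns :: "bool list list"
  inst_order :: "nat list"

definition game_of :: "esg_inst \<Rightarrow> (nat, nat) esg" where
  "game_of I =
     \<lparr> targets = {..<length (inst_values I)},
       sensors = {..<length (inst_columns I)},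
       target_value = (\<lambda>t. ratio_val (inst_values I ! t)),
       recharge = inst_recharge I,
       can_sense = (\<lambda>s t. inst_columns I ! s ! t) \<rparr>"

definition order_of :: "esg_inst \<Rightarrow> nat \<Rightarrow> nat" where
  "order_of I t = inst_order I ! t"

definition wf_inst :: "esg_inst \<Rightarrow> bool" where
  "wf_inst I \<longleftrightarrow>
     (\<forall>r \<in> set (inst_values I). snd r > 0) \<and>
     (\<forall>c \<in> set (inst_columns I). length c = length (inst_values I)) \<and>
     length (inst_order I) = length (inst_values I) \<and>
     wf_esg (game_of I) \<and> target_ordering (game_of I) (order_of I)"

text \<open>
  An instance is written as a word over four symbols, and each symbol as two bits.
  Numbers are in binary, least significant bit first and without leading zeros.
  The recharging time \<open>\<infinity>\<close> is the absence of a number.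
\<close>

datatype sym = Bit bool | Comma | Semi

fun sym_bits :: "sym \<Rightarrow> bool list" where
  "sym_bits (Bit b) = [False, b]"
| "sym_bits Comma = [True, False]"
| "sym_bits Semi = [True, True]"

definition to_bits :: "sym list \<Rightarrow> bool list" where
  "to_bits w = concat (map sym_bits w)"

fun binary :: "nat \<Rightarrow> bool list" where
  "binary n = (if n = 0 then [] else odd n # binary (n div 2))"

declare binary.simps [simp del]

definition enc_bools :: "bool list \<Rightarrow> sym list" where
  "enc_bools bs = map Bit bs @ [Comma]"

definition enc_nat :: "nat \<Rightarrow> sym list" where
  "enc_nat n = enc_bools (binary n)"

fun enc_ratio :: "ratio \<Rightarrow> sym list" where
  "enc_ratio (a, b) = enc_nat a @ enc_nat b"

definition enc_list :: "('a \<Rightarrow> sym list) \<Rightarrow> 'a list \<Rightarrow> sym list" where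
  "enc_list e xs = concat (map e xs) @ [Semi]"

definition enc_enat :: "enat \<Rightarrow> sym list" where
  "enc_enat \<tau> = (case \<tau> of enat n \<Rightarrow> enc_nat n | \<infinity> \<Rightarrow> []) @ [Semi]"

definition enc_inst :: "esg_inst \<Rightarrow> sym list" where
  "enc_inst I =
     enc_list enc_ratio (inst_values I) @
     enc_enat (inst_recharge I) @
     enc_list enc_bools (inst_columns I) @
     enc_list enc_nat (inst_order I)"

definition best_red_response :: "bool list set" where
  "best_red_response =
     {to_bits (enc_inst I @ enc_ratio q) | I q.
        wf_inst I \<and> snd q > 0 \<and>
        (\<exists>\<psi>. sensing_plan (game_of I) \<psi> \<and> valid_plan (game_of I) (order_of I) \<psi> \<and>
             unsensed_value (game_of I) \<psi> \<le> ratio_val q)}"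

definition sense_all_targets :: "bool list set" where
  "sense_all_targets =
     {to_bits (enc_inst I) | I.
        wf_inst I \<and>
        (\<exists>\<psi>. sensing_plan (game_of I) \<psi> \<and> valid_plan (game_of I) (order_of I) \<psi> \<and>
             sensed (game_of I) \<psi> = targets (game_of I))}"


subsection \<open>The encodings are injective\<close>

lemma to_bits_inject: "to_bits u = to_bits w \<longleftrightarrow> u = w"
proof
  show "to_bits u = to_bits w \<Longrightarrow> u = w"
  proof (induction u arbitrary: w)
    case Nil
    then show ?case by (cases w; cases "hd w") (auto simp: to_bits_def)
  next
    case (Cons a u)
    then obtain b v where w: "w = b # v"
      by (cases w; cases a) (auto simp: to_bits_def)
    with Cons.prems have "a = b \<and> to_bits u = to_bits v"
      by (cases a; cases b) (auto simp: to_bits_def)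
    with Cons.IH w show ?case by simp
  qed
qed simp

lemma binary_inject: "binary m = binary n \<longleftrightarrow> m = n"
proof
  show "binary m = binary n \<Longrightarrow> m = n"
  proof (induction m arbitrary: n rule: less_induct)
    case (less m)
    show ?case
    proof (cases "m = 0 \<or> n = 0")
      case True
      with less.prems show ?thesis
        by (auto simp: binary.simps[of m] binary.simps[of n] split: if_splits)
    next
      case False
      with less.prems have "odd m = odd n" "binary (m div 2) = binary (n div 2)"
        by (auto simp: binary.simps[of m] binary.simps[of n])
      moreover from this False have "m div 2 = n div 2"
        using less.IH[of "m div 2" "n div 2"] by simp
      ultimately show ?thesis
        by (metis even_two_times_div_two odd_two_times_div_two_succ)
    qed
  qed
qed simp

lemma enc_bools_append_inject: "enc_bools u @ xs = enc_bools w @ ys \<longleftrightarrow> u = w \<and> xs = ys"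
proof (induction u arbitrary: w)
  case Nil
  show ?case by (cases w) (auto simp: enc_bools_def)
next
  case (Cons a u)
  then show ?case by (cases w) (auto simp: enc_bools_def)
qed

lemma enc_nat_append_inject: "enc_nat m @ xs = enc_nat n @ ys \<longleftrightarrow> m = n \<and> xs = ys"
  by (simp add: enc_nat_def enc_bools_append_inject binary_inject)

lemma enc_ratio_append_inject: "enc_ratio r @ xs = enc_ratio s @ ys \<longleftrightarrow> r = s \<and> xs = ys"
  by (cases r; cases s) (auto simp: enc_nat_append_inject)

lemma enc_bools_neq_Semi: "enc_bools u @ xs \<noteq> Semi # ys"
  by (cases u) (auto simp: enc_bools_def)

lemma enc_nat_neq_Semi: "enc_nat n @ xs \<noteq> Semi # ys"
  by (simp add: enc_nat_def enc_bools_neq_Semi)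

lemma enc_ratio_neq_Semi: "enc_ratio r @ xs \<noteq> Semi # ys"
  by (cases r) (simp add: enc_nat_neq_Semi)

lemma enc_list_append_inject:
  assumes "\<And>a b xs ys. e a @ xs = e b @ ys \<longleftrightarrow> a = b \<and> xs = ys"
    and "\<And>a xs ys. e a @ xs \<noteq> Semi # ys"
  shows "enc_list e u @ xs = enc_list e w @ ys \<longleftrightarrow> u = w \<and> xs = ys"
proof (induction u arbitrary: w)
  case Nil
  show ?case using assms(2)[symmetric] by (cases w) (auto simp: enc_list_def)
next
  case (Cons a u)
  then show ?case using assms by (cases w) (auto simp: enc_list_def)
qed

lemma enc_enat_append_inject: "enc_enat s @ xs = enc_enat t @ ys \<longleftrightarrow> s = t \<and> xs = ys"
  by (auto simp: enc_enat_def enc_nat_append_inject enc_nat_neq_Semi enc_nat_neq_Semi[symmetric]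
      split: enat.splits)

lemma enc_inst_append_inject: "enc_inst I @ xs = enc_inst J @ ys \<longleftrightarrow> I = J \<and> xs = ys"
  unfolding enc_inst_def append_assoc
    enc_list_append_inject[of enc_ratio, OF enc_ratio_append_inject enc_ratio_neq_Semi]
    enc_list_append_inject[of enc_bools, OF enc_bools_append_inject enc_bools_neq_Semi]
    enc_list_append_inject[of enc_nat, OF enc_nat_append_inject enc_nat_neq_Semi]
    enc_enat_append_inject
  by (cases I; cases J) auto

lemma encoding_inject:
  "to_bits (enc_inst I) = to_bits (enc_inst J) \<longleftrightarrow> I = J"
  "to_bits (enc_inst I @ enc_ratio q) = to_bits (enc_inst J @ enc_ratio r) \<longleftrightarrow> I = J \<and> q = r"
  using enc_inst_append_inject[of I "[]" J "[]"] enc_ratio_append_inject[of q "[]" r "[]"]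
  by (simp_all add: to_bits_inject enc_inst_append_inject)

end

theory Submission
  imports Defs
begin

text \<open>
  Hardness is shown by a reduction from an arbitrary machine that decides a language in NP. Its runs
  of polynomial length are described by a propositional formula as by Cook and Levin. Sensing
  all targets means to colour a power of a path with sensors, because positions within the
  recharging time of each other need different sensors, and satisfiability of a formula is expressed
  as such a list-colouring problem: the two literals of a variable are colours that occur in every
  window of that length, so that an assignment is propagated from one clause to the next.

  For membership, one bit is guessed for each bit of the input. This is enough, as the sensing matrix
  in the input has one bit for each pair of a sensor and a target.

  Neither the reduction nor the check of the guess is programmed as a Turing machine. Instead, a class
  of functions on tree-encoded data, which is closed under composition, pairing, case distinction and
  folds with polynomially bounded accumulators, is shown to consist of functions computable by
  polynomial-time machines. A function belongs to this class already by the form of its definition,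
  up to bounds on the accumulators.
\<close>


section \<open>A structured language compiled to Turing machines\<close>

text \<open>A colour can return only a full window later, so from row to row its column may stay or
  move right, never left. A literal lent to a clause therefore cannot come back to the block it was
  taken from. Each row offers it a new block further right, and this is why a row has one block more
  than there are clauses and the recharging time is about the product of the numbers of clauses and
  variables. If both literals of a variable moved along in this way, nothing would prevent them from
  being exchanged; so one of them stays in a fixed block. The bound on accumulators is a real
  restriction: a body that is polynomial in its own input could double the accumulator in every
  round. As numbers are written in binary and loops run along lists, a polynomial number of rounds
  must be supplied as a list of that length. Decoding never has to recognise malformed words: the
  check encodes the decoded data again and compares the result with the input.\<close>

datatype cmd =
    Skip
  | Op nat "nat \<Rightarrow> nat \<times> move"
  | Seq cmd cmd (infixr \<open>;;\<close> 60)
  | Cond nat "nat set" cmd cmd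
  | While nat "nat set" cmd

type_synonym instr = "nat list \<Rightarrow> nat \<times> nat list \<times> move list"

text \<open>A jump, possibly conditional: the tapes stay as they are, while the target state may
  depend on the symbols read.\<close>

definition goto :: "(nat list \<Rightarrow> nat) \<Rightarrow> instr" where
  "goto g r = (g r, r, replicate 7 Stay)"

text \<open>The two extra instructions of a conditional are its test and the jump over the second
  branch, those of a loop its test and the jump back.\<close>

primrec csize :: "cmd \<Rightarrow> nat" where
  "csize Skip = 0"
| "csize (Op j f) = 1"
| "csize (c ;; d) = csize c + csize d"
| "csize (Cond j A c d) = csize c + csize d + 2"
| "csize (While j A c) = csize c + 2"

text \<open>States serve as addresses: the code is entered in state \<open>s\<close> and left in
  state \<open>s + csize c\<close>. All targets are relative to \<open>s\<close>, so code can be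
  placed anywhere in a machine.\<close>

primrec assemble :: "cmd \<Rightarrow> nat \<Rightarrow> instr list" where
  "assemble Skip s = []"
| "assemble (Op j f) s =
     [\<lambda>r. (Suc s, r[j := fst (f (r ! j))], (replicate 7 Stay)[j := snd (f (r ! j))])]"
| "assemble (c ;; d) s = assemble c s @ assemble d (s + csize c)"
| "assemble (Cond j A c d) s =
     goto (\<lambda>r. if r ! j \<in> A then Suc s else s + 2 + csize c) # assemble c (Suc s) @
     goto (\<lambda>_. s + 2 + csize c + csize d) # assemble d (s + 2 + csize c)"
| "assemble (While j A c) s =
     goto (\<lambda>r. if r ! j \<in> A then Suc s else s + 2 + csize c) # assemble c (Suc s) @
     [goto (\<lambda>_. s)]"

lemma length_assemble [simp]: "length (assemble c s) = csize c"
  by (induction c arbitrary: s) auto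

text \<open>Five symbols are in use: the blank, the two bits, and the two bits marked with a guessed
  1. With seven tapes over this alphabet the transition table is finite.\<close>

primrec wf_cmd :: "cmd \<Rightarrow> bool" where
  "wf_cmd Skip \<longleftrightarrow> True"
| "wf_cmd (Op j f) \<longleftrightarrow> j < 7 \<and> (\<forall>a<5. fst (f a) < 5)"
| "wf_cmd (c ;; d) \<longleftrightarrow> wf_cmd c \<and> wf_cmd d"
| "wf_cmd (Cond j A c d) \<longleftrightarrow> j < 7 \<and> wf_cmd c \<and> wf_cmd d"
| "wf_cmd (While j A c) \<longleftrightarrow> j < 7 \<and> wf_cmd c"

text \<open>The number counts the machine steps of the assembled code exactly: a first branch pays
  for the test and for the jump over the second branch, a second branch for the test alone.\<close>

inductive exec :: "cmd \<Rightarrow> (nat \<Rightarrow> tape) \<Rightarrow> nat \<Rightarrow> (nat \<Rightarrow> tape) \<Rightarrow> bool" where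
  exec_Skip: "exec Skip st 0 st"
| exec_Op: "exec (Op j f) st 1 (st(j := act (f (read_tape (st j))) (st j)))"
| exec_Seq: "exec c st m st' \<Longrightarrow> exec d st' n st'' \<Longrightarrow> exec (c ;; d) st (m + n) st''"
| exec_Cond_True: "read_tape (st j) \<in> A \<Longrightarrow> exec c st n st' \<Longrightarrow> exec (Cond j A c d) st (n + 2) st'"
| exec_Cond_False: "read_tape (st j) \<notin> A \<Longrightarrow> exec d st n st' \<Longrightarrow> exec (Cond j A c d) st (n + 1) st'"
| exec_While_True: "read_tape (st j) \<in> A \<Longrightarrow> exec c st m st' \<Longrightarrow> exec (While j A c) st' n st'' \<Longrightarrow>
     exec (While j A c) st (m + n + 2) st''"
| exec_While_False: "read_tape (st j) \<notin> A \<Longrightarrow> exec (While j A c) st 1 st"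

definition valid_word :: "nat list \<Rightarrow> bool" where
  "valid_word r \<longleftrightarrow> length r = 7 \<and> set r \<subseteq> {..<5}"

text \<open>The equivalence says that the instruction is present and that no other transition starts
  from this state and word. Thus even a nondeterministic machine can host deterministic
  code.\<close>

definition hosts :: "tm \<Rightarrow> nat \<Rightarrow> instr list \<Rightarrow> bool" where
  "hosts M s fs \<longleftrightarrow> (\<forall>i<length fs. \<forall>r a. valid_word r \<longrightarrow> (s + i, r, a) \<in> delta M \<longleftrightarrow> a = (fs ! i) r)"

lemma hosts_append: "hosts M s (xs @ ys) \<longleftrightarrow> hosts M s xs \<and> hosts M (s + length xs) ys"
proof
  assume h: "hosts M s (xs @ ys)"
  have "hosts M s xs"
    unfolding hosts_def
  proof (intro allI impI)
    fix i r a assume "i < length xs" "valid_word r"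
    then show "((s + i, r, a) \<in> delta M) = (a = (xs ! i) r)"
      using h[unfolded hosts_def, rule_format, of i r a] by (simp add: nth_append)
  qed
  moreover have "hosts M (s + length xs) ys"
    unfolding hosts_def
  proof (intro allI impI)
    fix i r a assume "i < length ys" "valid_word r"
    then show "((s + length xs + i, r, a) \<in> delta M) = (a = (ys ! i) r)"
      using h[unfolded hosts_def, rule_format, of "length xs + i" r a] by (simp add: add.assoc)
  qed
  ultimately show "hosts M s xs \<and> hosts M (s + length xs) ys" ..
next
  assume h: "hosts M s xs \<and> hosts M (s + length xs) ys"
  show "hosts M s (xs @ ys)"
    unfolding hosts_def
  proof (intro allI impI)
    fix i r a assume i: "i < length (xs @ ys)" "valid_word r"
    show "((s + i, r, a) \<in> delta M) = (a = ((xs @ ys) ! i) r)"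
    proof (cases "i < length xs")
      case True
      then show ?thesis using h i by (simp add: hosts_def nth_append del: split_paired_All)
    next
      case False
      then obtain k where k: "i = length xs + k" using le_Suc_ex not_less by blast
      then show ?thesis using h i by (simp add: hosts_def nth_append add.assoc del: split_paired_All)
    qed
  qed
qed

lemma hosts_Cons: "hosts M s (x # ys) \<longleftrightarrow> hosts M s [x] \<and> hosts M (Suc s) ys"
  using hosts_append[of M s "[x]" ys] by simp

text \<open>A step without alternative. The guessing machine branches only while it scans the input;
  afterwards such steps fix both the length and the outcome of every continuation.\<close>

definition dstep :: "tm \<Rightarrow> config \<Rightarrow> config \<Rightarrow> bool" where
  "dstep M c c' \<longleftrightarrow> tm_step M c c' \<and> (\<forall>d. tm_step M c d \<longrightarrow> d = c')"

declare upt_rec_numeral [simp del]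

definition conf :: "nat \<Rightarrow> (nat \<Rightarrow> tape) \<Rightarrow> config" where
  "conf q st = (q, map st [0..<7])"

definition tapes_ok :: "(nat \<Rightarrow> tape) \<Rightarrow> bool" where
  "tapes_ok st \<longleftrightarrow> (\<forall>j<7. \<forall>i. fst (st j) i < 5)"

lemma read_tape_eq: "read_tape t = fst t (snd t)"
  by (cases t) simp

lemma act_eq: "act (a, d) t = ((fst t)(snd t := a), snd t + shift d)"
  by (cases t) simp

lemma act_read_Stay [simp]: "act (read_tape t, Stay) t = t"
  by (cases t) simp

lemma valid_word_read: "tapes_ok st \<Longrightarrow> valid_word (map read_tape (map st [0..<7]))"
  by (auto simp: valid_word_def tapes_ok_def read_tape_eq)

lemma tm_stepD:
  "tm_step M (q, ts) d \<Longrightarrow>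
     \<exists>q' w m. (q, map read_tape ts, q', w, m) \<in> delta M \<and> d = (q', map2 act (zip w m) ts)"
  by (blast elim: tm_step.cases)

lemma dstep_host:
  assumes "hosts M s [F]" "tapes_ok st"
    and F: "F (map read_tape (map st [0..<7])) = (q, w, m)"
  shows "dstep M (conf s st) (q, map2 act (zip w m) (map st [0..<7]))"
proof -
  let ?r = "map read_tape (map st [0..<7])"
  have iff: "(s, ?r, a) \<in> delta M \<longleftrightarrow> a = F ?r" for a
    using assms(1) valid_word_read[OF assms(2)] by (simp add: hosts_def del: split_paired_All map_map)
  have "tm_step M (conf s st) (q, map2 act (zip w m) (map st [0..<7]))"
    unfolding conf_def by (rule tm_step.intros) (simp only: iff F)
  moreover have "d = (q, map2 act (zip w m) (map st [0..<7]))" if d: "tm_step M (conf s st) d" for d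
  proof -
    obtain q' w' m' where "(s, ?r, q', w', m') \<in> delta M" and d: "d = (q', map2 act (zip w' m') (map st [0..<7]))"
      using tm_stepD[OF d[unfolded conf_def]] by blast
    then have "(q', w', m') = (q, w, m)" unfolding iff F by blast
    then show ?thesis unfolding d by blast
  qed
  ultimately show ?thesis unfolding dstep_def by blast
qed

lemma map2_act_upd:
  assumes "j < 7"
  shows "map2 act (zip ((map read_tape (map st [0..<7]))[j := a]) ((replicate 7 Stay)[j := d])) (map st [0..<7])
    = map (st(j := act (a, d) (st j))) [0..<7]"
proof (rule nth_equalityI, goal_cases)
  case (2 i)
  then have "i < 7" by simp
  then show ?case by (cases "i = j") (auto simp del: act.simps simp: nth_list_update)
qed simp

lemma map2_act_Stay:
  "map2 act (zip (map read_tape (map st [0..<7])) (replicate 7 Stay)) (map st [0..<7]) = map st [0..<7]"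
  by (rule nth_equalityI) (auto simp del: act.simps)

lemma dstep_goto:
  assumes "hosts M s [goto g]" "tapes_ok st"
  shows "dstep M (conf s st) (conf (g (map read_tape (map st [0..<7]))) st)"
  using dstep_host[OF assms goto_def] unfolding map2_act_Stay by (simp only: conf_def)

lemma tapes_ok_act: "tapes_ok st \<Longrightarrow> a < 5 \<Longrightarrow> tapes_ok (st(j := act (a, d) (st j)))"
  by (auto simp: tapes_ok_def act_eq simp del: act.simps)

lemma read_lt: "tapes_ok st \<Longrightarrow> j < 7 \<Longrightarrow> read_tape (st j) < 5"
  by (simp add: tapes_ok_def read_tape_eq)

text \<open>Induction over the execution with an arbitrary address, as the parts of a compound
  command sit at shifted addresses. The invariant \<open>tapes_ok\<close> is carried along because
  \<open>hosts\<close> speaks only of words over the five symbols.\<close>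

lemma exec_sound:
  assumes "exec c st n st'" "wf_cmd c" "tapes_ok st" "hosts M s (assemble c s)"
  shows "(dstep M ^^ n) (conf s st) (conf (s + csize c) st') \<and> tapes_ok st'"
  using assms
proof (induction arbitrary: s rule: exec.induct)
  case (exec_Skip st)
  then show ?case by simp
next
  case (exec_Op j f st)
  let ?p = "f (read_tape (st j))"
  have "j < 7" using exec_Op by simp
  have "dstep M (conf s st) (Suc s, map2 act (zip ((map read_tape (map st [0..<7]))[j := fst ?p]) ((replicate 7 Stay)[j := snd ?p])) (map st [0..<7]))"
    by (rule dstep_host[OF exec_Op(3)[unfolded assemble.simps] exec_Op(2)]) (use \<open>j < 7\<close> in simp)
  then show ?case
    using exec_Op map2_act_upd[OF \<open>j < 7\<close>, of st "fst ?p" "snd ?p"] read_lt[OF exec_Op(2) \<open>j < 7\<close>]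
      tapes_ok_act[OF exec_Op(2), of "fst ?p" j "snd ?p"]
    by (simp add: conf_def OO_def del: act.simps fun_upd_apply)
next
  case (exec_Seq c st m st' d n st'')
  then have h: "hosts M s (assemble c s)" "hosts M (s + csize c) (assemble d (s + csize c))"
    by (auto simp: hosts_append)
  from exec_Seq(3)[OF _ _ h(1)] exec_Seq(4)[OF _ _ h(2)] exec_Seq.prems
  show ?case by (auto simp: relpowp_add add.assoc)
next
  case (exec_Cond_True st j A c n st' d)
  then have h: "hosts M s [goto (\<lambda>r. if r ! j \<in> A then Suc s else s + 2 + csize c)]"
    "hosts M (Suc s) (assemble c (Suc s))" "hosts M (Suc s + csize c) [goto (\<lambda>_. s + 2 + csize c + csize d)]"
    by (auto simp: hosts_append hosts_Cons[of _ _ _ "_ @ _"] hosts_Cons[of _ _ _ "assemble _ _"])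
  have j: "j < 7" using exec_Cond_True by simp
  note ih = exec_Cond_True(3)[OF _ exec_Cond_True(5) h(2)]
  have "(dstep M ^^ 1) (conf s st) (conf (Suc s) st)"
    using dstep_goto[OF h(1) exec_Cond_True(5)] exec_Cond_True(1) j by (simp add: OO_def add.assoc)
  moreover have "(dstep M ^^ n) (conf (Suc s) st) (conf (Suc s + csize c) st')" "tapes_ok st'"
    using ih exec_Cond_True by auto
  moreover from this have "(dstep M ^^ 1) (conf (Suc s + csize c) st') (conf (s + csize (Cond j A c d)) st')"
    using dstep_goto[OF h(3)] by (simp add: OO_def add.assoc)
  ultimately have "(dstep M ^^ (1 + n + 1)) (conf s st) (conf (s + csize (Cond j A c d)) st')"
    unfolding relpowp_add by blast
  then show ?case using \<open>tapes_ok st'\<close> by (simp add: add.commute)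
next
  case (exec_Cond_False st j A d n st' c)
  then have h: "hosts M s [goto (\<lambda>r. if r ! j \<in> A then Suc s else s + 2 + csize c)]"
    "hosts M (s + 2 + csize c) (assemble d (s + 2 + csize c))"
    by (auto simp: hosts_append hosts_Cons[of _ _ _ "_ @ _"] hosts_Cons[of _ _ _ "assemble _ _"])
  have j: "j < 7" using exec_Cond_False by simp
  note ih = exec_Cond_False(3)[OF _ exec_Cond_False(5) h(2)]
  have "(dstep M ^^ 1) (conf s st) (conf (s + 2 + csize c) st)"
    using dstep_goto[OF h(1) exec_Cond_False(5)] exec_Cond_False(1) j by (simp add: OO_def add.assoc)
  moreover have "(dstep M ^^ n) (conf (s + 2 + csize c) st) (conf (s + csize (Cond j A c d)) st')" "tapes_ok st'"
    using ih exec_Cond_False by (auto simp: ac_simps)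
  ultimately have "(dstep M ^^ (1 + n)) (conf s st) (conf (s + csize (Cond j A c d)) st')"
    unfolding relpowp_add by blast
  then show ?case using \<open>tapes_ok st'\<close> by (simp add: add.commute)
next
  case (exec_While_True st j A c m st' n st'')
  then have h: "hosts M s [goto (\<lambda>r. if r ! j \<in> A then Suc s else s + 2 + csize c)]"
    "hosts M (Suc s) (assemble c (Suc s))" "hosts M (Suc s + csize c) [goto (\<lambda>_. s)]"
    by (auto simp: hosts_append hosts_Cons[of _ _ _ "_ @ _"])
  have j: "j < 7" using exec_While_True by simp
  note ih = exec_While_True(4)[OF _ exec_While_True(7) h(2)] exec_While_True(5)[OF exec_While_True(6) _ exec_While_True(8)]
  have "(dstep M ^^ 1) (conf s st) (conf (Suc s) st)"
    using dstep_goto[OF h(1) exec_While_True(7)] exec_While_True(1) j by (simp add: OO_def add.assoc)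
  moreover have "(dstep M ^^ m) (conf (Suc s) st) (conf (Suc s + csize c) st')" and ok: "tapes_ok st'"
    using ih exec_While_True by auto
  moreover from ok have "(dstep M ^^ 1) (conf (Suc s + csize c) st') (conf s st')"
    using dstep_goto[OF h(3)] by (simp add: OO_def add.assoc)
  moreover have "(dstep M ^^ n) (conf s st') (conf (s + csize (While j A c)) st'')" "tapes_ok st''"
    using ih(2)[OF ok] by auto
  ultimately have "(dstep M ^^ (1 + m + 1 + n)) (conf s st) (conf (s + csize (While j A c)) st'')"
    unfolding relpowp_add by blast
  then show ?case using \<open>tapes_ok st''\<close> by (simp add: ac_simps numeral_2_eq_2)
next
  case (exec_While_False st j A c)
  then have h: "hosts M s [goto (\<lambda>r. if r ! j \<in> A then Suc s else s + 2 + csize c)]" and j: "j < 7"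
    by (auto simp: hosts_Cons[of _ _ _ "_ @ _"])
  have "(dstep M ^^ 1) (conf s st) (conf (s + 2 + csize c) st)"
    using dstep_goto[OF h exec_While_False(3)] exec_While_False(1) j by (simp add: OO_def add.assoc)
  then show ?case using exec_While_False by (simp add: ac_simps)
qed

text \<open>An upper bound instead of an exact count, so that estimates can be rounded and the two
  branches of a conditional can share one bound.\<close>

definition runs :: "cmd \<Rightarrow> (nat \<Rightarrow> tape) \<Rightarrow> nat \<Rightarrow> (nat \<Rightarrow> tape) \<Rightarrow> bool" where
  "runs c st T st' \<longleftrightarrow> (\<exists>n\<le>T. exec c st n st')"

lemma runs_mono: "runs c st T st' \<Longrightarrow> T \<le> T' \<Longrightarrow> runs c st T' st'"
  unfolding runs_def by (meson le_trans)

lemma runs_Skip: "runs Skip st 0 st"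
  using exec_Skip runs_def by blast

lemma runs_Op: "runs (Op j f) st 1 (st(j := act (f (read_tape (st j))) (st j)))"
  using exec_Op runs_def by blast

lemma runs_Seq: "runs c st S st' \<Longrightarrow> runs d st' T st'' \<Longrightarrow> runs (c ;; d) st (S + T) st''"
  unfolding runs_def by (meson add_mono exec_Seq)

lemma runs_Cond:
  assumes "read_tape (st j) \<in> A \<Longrightarrow> runs c st T st'" "read_tape (st j) \<notin> A \<Longrightarrow> runs d st T st'"
  shows "runs (Cond j A c d) st (T + 2) st'"
proof (cases "read_tape (st j) \<in> A")
  case True
  with assms obtain n where "n \<le> T" "exec c st n st'" by (auto simp: runs_def)
  with True exec_Cond_True show ?thesis unfolding runs_def by (meson add_le_mono1)
next
  case False
  with assms obtain n where "n \<le> T" "exec d st n st'" by (auto simp: runs_def)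
  then have "n + 1 \<le> T + 2" "exec (Cond j A c d) st (n + 1) st'"
    using False exec_Cond_False by auto
  then show ?thesis unfolding runs_def by blast
qed

lemma runs_While_True:
  assumes "read_tape (st j) \<in> A" "runs c st S st'" "runs (While j A c) st' T st''"
  shows "runs (While j A c) st (S + T + 2) st''"
proof -
  from assms obtain m n where "m \<le> S" "n \<le> T" "exec c st m st'" "exec (While j A c) st' n st''"
    by (auto simp: runs_def)
  then have "m + n + 2 \<le> S + T + 2" "exec (While j A c) st (m + n + 2) st''"
    using exec_While_True[of st j A c m st' n st''] assms(1) by auto
  then show ?thesis unfolding runs_def by blast
qed

lemma runs_While_False: "read_tape (st j) \<notin> A \<Longrightarrow> runs (While j A c) st 1 st"
  using exec_While_False[of st j A c] by (auto simp: runs_def)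


subsection \<open>Stacks\<close>

text \<open>The top of a stack is under the head and its bottom just left of cell 0.\<close>

definition stk :: "nat list \<Rightarrow> tape" where
  "stk xs = (\<lambda>i. if - int (length xs) \<le> i \<and> i < 0 then xs ! nat (i + int (length xs)) else 0,
     - int (length xs))"

lemma read_stk [simp]: "read_tape (stk []) = 0" "read_tape (stk (x # xs)) = x"
  by (simp_all add: stk_def)

text \<open>A transition writes before it moves, so a push takes two steps: the first rewrites the
  old top and moves left, the second fills the new cell.\<close>

lemma act_push: "act (a, Stay) (act (read_tape (stk xs), Go_Left) (stk xs)) = stk (a # xs)"
proof -
  have "nat (i + (1 + int (length xs))) = Suc (nat (i + int (length xs)))" if "- int (length xs) \<le> i" for i
    using that by simp
  then show ?thesis
    by (auto simp: act_eq read_tape_eq stk_def fun_eq_iff nth_Cons' simp del: act.simps)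
qed

lemma act_pop: "act (0, Go_Right) (stk (x # xs)) = stk xs"
proof -
  have "nat (i + (1 + int (length xs))) = Suc (nat (i + int (length xs)))" if "- int (length xs) \<le> i" for i
    using that by simp
  then show ?thesis
    by (auto simp: act_eq read_tape_eq stk_def fun_eq_iff nth_Cons' simp del: act.simps)
qed

text \<open>
  Tape 0 is the input and tape 6 the output. Tapes 2 to 5 are stacks: the main stack, two scratch
  stacks and a counter. Tape 1 is not used, as the simplifier would rewrite its number to \<open>Suc 0\<close>.
\<close>

definition stacks :: "(nat \<Rightarrow> tape) \<Rightarrow> (nat \<Rightarrow> nat list) \<Rightarrow> nat \<Rightarrow> tape" where
  "stacks e S j = (if j \<in> {2..5} then stk (S j) else e j)"

lemma stacks_upd: "j \<in> {2..5} \<Longrightarrow> (stacks e S)(j := stk xs) = stacks e (S(j := xs))"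
  by (auto simp: stacks_def)

definition Push :: "nat \<Rightarrow> nat \<Rightarrow> cmd" where
  "Push j a = (Op j (\<lambda>r. (r, Go_Left)) ;; Op j (\<lambda>_. (a, Stay)))"

definition Pop :: "nat \<Rightarrow> cmd" where
  "Pop j = Op j (\<lambda>_. (0, Go_Right))"

lemma wf_Push [simp]: "wf_cmd (Push j a) \<longleftrightarrow> j < 7 \<and> a < 5"
  by (auto simp: Push_def intro: exI[of _ 0])

lemma wf_Pop [simp]: "wf_cmd (Pop j) \<longleftrightarrow> j < 7"
  by (simp add: Pop_def)

lemma runs_Push:
  assumes "j \<in> {2..5}"
  shows "runs (Push j a) (stacks e S) 2 (stacks e (S(j := a # S j)))"
proof -
  let ?t = "(stacks e S)(j := act (read_tape (stacks e S j), Go_Left) (stacks e S j))"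
  have "runs (Push j a) (stacks e S) (1 + 1) (?t(j := act (a, Stay) (?t j)))"
    unfolding Push_def by (rule runs_Seq[OF runs_Op runs_Op])
  moreover have "?t(j := act (a, Stay) (?t j)) = stacks e (S(j := a # S j))"
    using assms act_push[of a "S j"] by (simp add: stacks_def[of e S j] stacks_upd del: act.simps)
  ultimately show ?thesis by (simp only: one_add_one)
qed

lemma runs_Pop:
  assumes "j \<in> {2..5}" "S j = x # xs"
  shows "runs (Pop j) (stacks e S) 1 (stacks e (S(j := xs)))"
  using runs_Op[of j "\<lambda>_. (0, Go_Right)" "stacks e S"] assms
  by (simp add: Pop_def stacks_def[of e S j] act_pop stacks_upd del: act.simps)


section \<open>Polynomial-time functions on tree-encoded data\<close>

datatype tree = Leaf | Node tree tree

text \<open>Preorder notation, self-delimiting and free of the blank 0: both the end of a value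
  inside a stack and the end of the stack can be recognised.\<close>

primrec code :: "tree \<Rightarrow> nat list" where
  "code Leaf = [1]"
| "code (Node a b) = 2 # code a @ code b"

lemma code_append_inject: "code s @ xs = code t @ ys \<longleftrightarrow> s = t \<and> xs = ys"
proof (induction s arbitrary: t xs ys)
  case Leaf
  show ?case by (cases t) auto
next
  case (Node a b)
  then show ?case by (cases t) auto
qed

lemma code_inject: "code s = code t \<longleftrightarrow> s = t"
  using code_append_inject[of s "[]" t "[]"] by simp

lemma set_code: "set (code t) \<subseteq> {1, 2}"
  by (induction t) auto

lemma code_neq_Nil [simp]: "code t \<noteq> []"
  by (cases t) auto

text \<open>Injectivity is required only within one type. Types may share codes:
  \<open>False\<close> and the empty list are both a leaf, and a nonempty list has the code of the
  pair of its head and its tail.\<close>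

class enc =
  fixes enc :: "'a \<Rightarrow> tree"
  assumes enc_inject [simp]: "enc x = enc y \<longleftrightarrow> x = y"

definition sz :: "'a::enc \<Rightarrow> nat" where
  "sz x = length (code (enc x))"

instantiation bool :: enc
begin
definition "enc b = (if b then Node Leaf Leaf else Leaf)"
instance by standard (auto simp: enc_bool_def)
end

instantiation prod :: (enc, enc) enc
begin
definition "enc p = Node (enc (fst p)) (enc (snd p))"
instance by standard (auto simp: enc_prod_def prod_eq_iff)
end

instantiation list :: (enc) enc
begin
primrec enc_list :: "'a list \<Rightarrow> tree" where
  "enc_list [] = Leaf"
| "enc_list (x # xs) = Node (enc x) (enc_list xs)"
instance
proof
  fix x y :: "'a list"
  show "enc x = enc y \<longleftrightarrow> x = y"
  proof (induction x arbitrary: y)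
    case Nil
    show ?case by (cases y) auto
  next
    case (Cons a x)
    then show ?case by (cases y) auto
  qed
qed
end

lemma sz_bool: "sz b = (if b then 3 else 1)"
  by (simp add: sz_def enc_bool_def)

lemma sz_Pair [simp]: "sz (x, y) = sz x + sz y + 1"
  by (simp add: sz_def enc_prod_def)

lemma sz_list [simp]: "sz [] = 1" "sz (x # xs) = sz x + sz xs + 1"
  by (simp_all add: sz_def)


subsection \<open>Moving trees between stacks\<close>

lemma read_stacks: "j \<in> {2..5} \<Longrightarrow> read_tape (stacks e S j) = (if S j = [] then 0 else hd (S j))"
  by (cases "S j") (simp_all add: stacks_def)

lemma runs_Push_eq:
  "j \<in> {2..5} \<Longrightarrow> S' = S(j := a # S j) \<Longrightarrow> runs (Push j a) (stacks e S) 2 (stacks e S')"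
  using runs_Push by simp

lemma runs_Pop_eq:
  "j \<in> {2..5} \<Longrightarrow> S j = x # xs \<Longrightarrow> S' = S(j := xs) \<Longrightarrow> runs (Pop j) (stacks e S) 1 (stacks e S')"
  using runs_Pop by simp

text \<open>Stack 5 counts in unary the subtrees still to be read: a leaf completes one, an inner
  node replaces one by two. It becomes empty exactly when one whole tree has been moved.\<close>

definition Scan :: "nat \<Rightarrow> nat \<Rightarrow> cmd" where
  "Scan i j = (Push 5 1 ;; While 5 {1}
     (Cond i {1} (Pop i ;; Push j 1 ;; Pop 5) (Pop i ;; Push j 2 ;; Push 5 1)))"

text \<open>Stated for a forest \<open>vs\<close>, because an inner node leaves two subtrees
  pending; the counter has the length of the forest. A symbol costs at most 9 steps: five for pops
  and pushes, two for the case distinction, two for the loop.\<close>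

lemma runs_Scan_loop:
  assumes "i \<in> {2, 3, 4}" "j \<in> {2, 3, 4}" "i \<noteq> j"
    and "S i = concat (map code vs) @ xs" "S 5 = replicate (length vs) 1"
  shows "runs (While 5 {1} (Cond i {1} (Pop i ;; Push j 1 ;; Pop 5) (Pop i ;; Push j 2 ;; Push 5 1)))
    (stacks e S) (9 * length (concat (map code vs)) + 1)
    (stacks e (S(i := xs, j := rev (concat (map code vs)) @ S j, 5 := [])))"
  using assms(4,5)
proof (induction "length (concat (map code vs))" arbitrary: vs S rule: less_induct)
  case less
  let ?body = "Cond i {1} (Pop i ;; Push j 1 ;; Pop 5) (Pop i ;; Push j 2 ;; Push 5 1)"
  have ij: "i \<in> {2..5}" "j \<in> {2..5}" "i \<noteq> 5" "j \<noteq> 5" using assms by auto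
  show ?case
  proof (cases vs)
    case Nil
    then have "S(i := xs, j := rev (concat (map code vs)) @ S j, 5 := []) = S"
      using less.prems by (simp add: fun_eq_iff)
    then show ?thesis using Nil less.prems
      by (auto intro!: runs_mono[OF runs_While_False] simp: read_stacks)
  next
    case (Cons v vs')
    then have top: "read_tape (stacks e S 5) \<in> {1}" using less.prems by (simp add: read_stacks)
    show ?thesis
    proof (cases v)
      case Leaf
      let ?S1 = "S(i := concat (map code vs') @ xs, j := 1 # S j, 5 := replicate (length vs') 1)"
      have "runs (Pop i) (stacks e S) 1 (stacks e (S(i := concat (map code vs') @ xs)))"
        "runs (Push j 1) (stacks e (S(i := concat (map code vs') @ xs))) 2
          (stacks e (S(i := concat (map code vs') @ xs, j := 1 # S j)))"
        "runs (Pop 5) (stacks e (S(i := concat (map code vs') @ xs, j := 1 # S j))) 1 (stacks e ?S1)"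
        using less.prems Cons Leaf ij assms(3)
        by (intro runs_Push_eq runs_Pop_eq; simp add: fun_eq_iff)+
      then have "runs (Pop i ;; Push j 1 ;; Pop 5) (stacks e S) (1 + (2 + 1)) (stacks e ?S1)"
        by (intro runs_Seq)
      moreover have "read_tape (stacks e S i) \<in> {1}" using less.prems Cons Leaf ij by (simp add: read_stacks)
      ultimately have b: "runs ?body (stacks e S) (1 + (2 + 1) + 2) (stacks e ?S1)"
        by (intro runs_Cond) auto
      have "runs (While 5 {1} ?body) (stacks e ?S1) (9 * length (concat (map code vs')) + 1)
        (stacks e (?S1(i := xs, j := rev (concat (map code vs')) @ ?S1 j, 5 := [])))"
        using Cons Leaf ij assms(3) by (intro less.hyps) auto
      moreover have "?S1(i := xs, j := rev (concat (map code vs')) @ ?S1 j, 5 := []) =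
        S(i := xs, j := rev (concat (map code vs)) @ S j, 5 := [])"
        using Cons Leaf ij by (simp add: fun_eq_iff)
      ultimately have "runs (While 5 {1} ?body) (stacks e ?S1) (9 * length (concat (map code vs')) + 1)
        (stacks e (S(i := xs, j := rev (concat (map code vs)) @ S j, 5 := [])))" by (simp only:)
      from runs_While_True[OF top b this] show ?thesis
        by (rule runs_mono) (simp add: Cons Leaf)
    next
      case (Node a b)
      let ?S1 = "S(i := concat (map code (a # b # vs')) @ xs, j := 2 # S j, 5 := 1 # S 5)"
      have "runs (Pop i) (stacks e S) 1 (stacks e (S(i := concat (map code (a # b # vs')) @ xs)))"
        "runs (Push j 2) (stacks e (S(i := concat (map code (a # b # vs')) @ xs))) 2
          (stacks e (S(i := concat (map code (a # b # vs')) @ xs, j := 2 # S j)))"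
        "runs (Push 5 1) (stacks e (S(i := concat (map code (a # b # vs')) @ xs, j := 2 # S j))) 2 (stacks e ?S1)"
        using less.prems Cons Node ij assms(3)
        by (intro runs_Push_eq runs_Pop_eq; simp add: fun_eq_iff)+
      then have "runs (Pop i ;; Push j 2 ;; Push 5 1) (stacks e S) (1 + (2 + 2)) (stacks e ?S1)"
        by (intro runs_Seq)
      moreover have "read_tape (stacks e S i) \<notin> {1}" using less.prems Cons Node ij by (simp add: read_stacks)
      ultimately have b: "runs ?body (stacks e S) (1 + (2 + 2) + 2) (stacks e ?S1)"
        by (intro runs_Cond) auto
      have "runs (While 5 {1} ?body) (stacks e ?S1) (9 * length (concat (map code (a # b # vs'))) + 1)
        (stacks e (?S1(i := xs, j := rev (concat (map code (a # b # vs'))) @ ?S1 j, 5 := [])))"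
        using Cons Node ij assms(3) less.prems by (intro less.hyps) auto
      moreover have "?S1(i := xs, j := rev (concat (map code (a # b # vs'))) @ ?S1 j, 5 := []) =
        S(i := xs, j := rev (concat (map code vs)) @ S j, 5 := [])"
        using Cons Node ij by (simp add: fun_eq_iff)
      ultimately have "runs (While 5 {1} ?body) (stacks e ?S1) (9 * length (concat (map code (a # b # vs'))) + 1)
        (stacks e (S(i := xs, j := rev (concat (map code vs)) @ S j, 5 := [])))" by (simp only:)
      from runs_While_True[OF top b this] show ?thesis
        by (rule runs_mono) (simp add: Cons Node)
    qed
  qed
qed

definition S4 :: "nat list \<Rightarrow> nat list \<Rightarrow> nat list \<Rightarrow> nat list \<Rightarrow> nat \<Rightarrow> nat list" where
  "S4 a b c d j = (if j = 2 then a else if j = 3 then b else if j = 4 then c else if j = 5 then d else [])"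

lemma S4_simps [simp]:
  "S4 a b c d 2 = a" "S4 a b c d 3 = b" "S4 a b c d 4 = c" "S4 a b c d 5 = d"
  "(S4 a b c d)(2 := x) = S4 x b c d" "(S4 a b c d)(3 := x) = S4 a x c d"
  "(S4 a b c d)(4 := x) = S4 a b x d" "(S4 a b c d)(5 := x) = S4 a b c x"
  by (auto simp: S4_def fun_eq_iff)

abbreviation main :: "(nat \<Rightarrow> tape) \<Rightarrow> nat list \<Rightarrow> nat \<Rightarrow> tape" where
  "main e xs \<equiv> stacks e (S4 xs [] [] [])"

lemma runs_Scan:
  assumes "i \<in> {2, 3, 4}" "j \<in> {2, 3, 4}" "i \<noteq> j" "S i = code v @ xs" "S 5 = []"
  shows "runs (Scan i j) (stacks e S) (9 * length (code v) + 3) (stacks e (S(i := xs, j := rev (code v) @ S j)))"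
proof -
  let ?S = "S(5 := 1 # S 5)"
  have "runs (Push 5 1) (stacks e S) 2 (stacks e ?S)" by (rule runs_Push) simp
  moreover have "runs (While 5 {1} (Cond i {1} (Pop i ;; Push j 1 ;; Pop 5) (Pop i ;; Push j 2 ;; Push 5 1)))
    (stacks e ?S) (9 * length (concat (map code [v])) + 1)
    (stacks e (?S(i := xs, j := rev (concat (map code [v])) @ ?S j, 5 := [])))"
    using assms by (intro runs_Scan_loop) auto
  moreover have "?S(i := xs, j := rev (concat (map code [v])) @ ?S j, 5 := []) = S(i := xs, j := rev (code v) @ S j)"
    using assms by (auto simp: fun_eq_iff)
  ultimately have "runs (Scan i j) (stacks e S) (2 + (9 * length (concat (map code [v])) + 1))
    (stacks e (S(i := xs, j := rev (code v) @ S j)))"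
    unfolding Scan_def by (metis runs_Seq)
  then show ?thesis by (rule runs_mono) simp
qed

text \<open>A scanned tree lies reversed on its scratch stack; emptying that stack onto another one
  restores the order.\<close>

definition Flush :: "nat \<Rightarrow> nat \<Rightarrow> cmd" where
  "Flush i j = While i {1, 2} (Cond i {1} (Pop i ;; Push j 1) (Pop i ;; Push j 2))"

lemma runs_Flush:
  assumes "i \<in> {2..5}" "j \<in> {2..5}" "i \<noteq> j" "S i = xs" "set xs \<subseteq> {1, 2}"
  shows "runs (Flush i j) (stacks e S) (7 * length xs + 1) (stacks e (S(i := [], j := rev xs @ S j)))"
  using assms(4,5)
proof (induction xs arbitrary: S)
  case Nil
  then have eq: "S(i := [], j := rev [] @ S j) = S" by (simp add: fun_eq_iff)
  show ?case unfolding Flush_def eq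
    by (rule runs_mono[OF runs_While_False]) (use Nil assms in \<open>auto simp: read_stacks\<close>)
next
  case (Cons a xs)
  let ?S1 = "S(i := xs, j := a # (S(i := xs)) j)"
  have b: "runs (Cond i {1} (Pop i ;; Push j 1) (Pop i ;; Push j 2)) (stacks e S) (1 + 2 + 2) (stacks e ?S1)"
  proof (intro runs_Cond runs_Seq)
    show "runs (Pop i) (stacks e S) 1 (stacks e (S(i := xs)))" if "read_tape (stacks e S i) \<in> {1}"
      using assms Cons by (intro runs_Pop) auto
    show "runs (Pop i) (stacks e S) 1 (stacks e (S(i := xs)))" if "read_tape (stacks e S i) \<notin> {1}"
      using assms Cons by (intro runs_Pop) auto
    show "runs (Push j 1) (stacks e (S(i := xs))) 2 (stacks e ?S1)" if "read_tape (stacks e S i) \<in> {1}"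
      using that runs_Push[of j 1 e "S(i := xs)"] assms Cons by (simp add: read_stacks)
    show "runs (Push j 2) (stacks e (S(i := xs))) 2 (stacks e ?S1)" if "read_tape (stacks e S i) \<notin> {1}"
      using that runs_Push[of j 2 e "S(i := xs)"] assms Cons by (auto simp: read_stacks)
  qed
  have "runs (Flush i j) (stacks e ?S1) (7 * length xs + 1) (stacks e (?S1(i := [], j := rev xs @ ?S1 j)))"
    using assms Cons by (intro Cons.IH) auto
  moreover have "?S1(i := [], j := rev xs @ ?S1 j) = S(i := [], j := rev (a # xs) @ S j)"
    using assms by (simp add: fun_eq_iff)
  ultimately have "runs (Flush i j) (stacks e ?S1) (7 * length xs + 1) (stacks e (S(i := [], j := rev (a # xs) @ S j)))"
    by (simp only:)
  moreover have "read_tape (stacks e S i) \<in> {1, 2}" using assms Cons by (auto simp: read_stacks)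
  ultimately have "runs (Flush i j) (stacks e S) (1 + 2 + 2 + (7 * length xs + 1) + 2) (stacks e (S(i := [], j := rev (a # xs) @ S j)))"
    using b unfolding Flush_def by (intro runs_While_True)
  then show ?case by (rule runs_mono) simp
qed

definition Flush_Dup :: cmd where
  "Flush_Dup = While 3 {1, 2} (Cond 3 {1} (Pop 3 ;; Push 2 1 ;; Push 4 1) (Pop 3 ;; Push 2 2 ;; Push 4 2))"

lemma runs_Flush_Dup:
  assumes "set xs \<subseteq> {1, 2}"
  shows "runs Flush_Dup (stacks e (S4 a xs c d)) (9 * length xs + 1) (stacks e (S4 (rev xs @ a) [] (rev xs @ c) d))"
  using assms
proof (induction xs arbitrary: a c)
  case Nil
  then show ?case unfolding Flush_Dup_def
    by (auto intro!: runs_mono[OF runs_While_False] simp: read_stacks)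
next
  case (Cons x xs)
  have *: "runs (Pop 3 ;; Push 2 y ;; Push 4 y) (stacks e (S4 a (x # xs) c d)) (1 + (2 + 2))
    (stacks e (S4 (y # a) xs (y # c) d))" for y
    by (intro runs_Seq[OF runs_Pop_eq[of 3 _ x xs]] runs_Seq[OF runs_Push_eq runs_Push_eq]) auto
  have "runs (Cond 3 {1} (Pop 3 ;; Push 2 1 ;; Push 4 1) (Pop 3 ;; Push 2 2 ;; Push 4 2))
      (stacks e (S4 a (x # xs) c d)) (1 + (2 + 2) + 2) (stacks e (S4 (x # a) xs (x # c) d))"
    using *[of 1] *[of 2] Cons.prems by (intro runs_Cond) (auto simp: read_stacks)
  moreover have "runs Flush_Dup (stacks e (S4 (x # a) xs (x # c) d)) (9 * length xs + 1)
      (stacks e (S4 (rev (x # xs) @ a) [] (rev (x # xs) @ c) d))"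
    using Cons by simp
  moreover have "read_tape (stacks e (S4 a (x # xs) c d) 3) \<in> {1, 2}"
    using Cons.prems by (auto simp: read_stacks)
  ultimately have "runs Flush_Dup (stacks e (S4 a (x # xs) c d)) (1 + (2 + 2) + 2 + (9 * length xs + 1) + 2)
      (stacks e (S4 (rev (x # xs) @ a) [] (rev (x # xs) @ c) d))"
    unfolding Flush_Dup_def by (intro runs_While_True)
  then show ?case by (rule runs_mono) simp
qed

text \<open>\<open>Flush_Dup\<close> leaves one copy on the main stack and one on stack 4, both in
  the right order. Moving the second copy over directly would reverse it, hence the detour through
  stack 3.\<close>

definition Dup :: cmd where
  "Dup = (Scan 2 3 ;; Flush_Dup ;; Flush 4 3 ;; Flush 3 2)"

lemma runs_Dup: "runs Dup (main e (code v @ r)) (32 * length (code v) + 6) (main e (code v @ code v @ r))"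
proof -
  have "runs (Scan 2 3) (main e (code v @ r)) (9 * length (code v) + 3) (stacks e (S4 r (rev (code v)) [] []))"
    using runs_Scan[of 2 3 "S4 (code v @ r) [] [] []" v r e] by simp
  moreover have "runs Flush_Dup (stacks e (S4 r (rev (code v)) [] [])) (9 * length (code v) + 1)
      (stacks e (S4 (code v @ r) [] (code v) []))"
    using runs_Flush_Dup[of "rev (code v)" e r "[]" "[]"] set_code[of v] by simp
  moreover have "runs (Flush 4 3) (stacks e (S4 (code v @ r) [] (code v) [])) (7 * length (code v) + 1)
      (stacks e (S4 (code v @ r) (rev (code v)) [] []))"
    using runs_Flush[of 4 3 "S4 (code v @ r) [] (code v) []" "code v" e] set_code[of v] by simp
  moreover have "runs (Flush 3 2) (stacks e (S4 (code v @ r) (rev (code v)) [] [])) (7 * length (code v) + 1)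
      (main e (code v @ code v @ r))"
    using runs_Flush[of 3 2 "S4 (code v @ r) (rev (code v)) [] []" "rev (code v)" e] set_code[of v] by simp
  ultimately have "runs Dup (main e (code v @ r)) (9 * length (code v) + 3 + (9 * length (code v) + 1 + (7 * length (code v) + 1 + (7 * length (code v) + 1))))
      (main e (code v @ code v @ r))"
    unfolding Dup_def by (intro runs_Seq)
  then show ?thesis by (rule runs_mono) simp
qed

definition Swap :: cmd where
  "Swap = (Scan 2 3 ;; Scan 2 4 ;; Flush 3 2 ;; Flush 4 2)"

lemma runs_Swap:
  "runs Swap (main e (code u @ code v @ r)) (16 * (length (code u) + length (code v)) + 8) (main e (code v @ code u @ r))"
proof -
  have "runs (Scan 2 3) (main e (code u @ code v @ r)) (9 * length (code u) + 3) (stacks e (S4 (code v @ r) (rev (code u)) [] []))"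
    using runs_Scan[of 2 3 "S4 (code u @ code v @ r) [] [] []" u "code v @ r" e] by simp
  moreover have "runs (Scan 2 4) (stacks e (S4 (code v @ r) (rev (code u)) [] [])) (9 * length (code v) + 3)
      (stacks e (S4 r (rev (code u)) (rev (code v)) []))"
    using runs_Scan[of 2 4 "S4 (code v @ r) (rev (code u)) [] []" v r e] by simp
  moreover have "runs (Flush 3 2) (stacks e (S4 r (rev (code u)) (rev (code v)) [])) (7 * length (code u) + 1)
      (stacks e (S4 (code u @ r) [] (rev (code v)) []))"
    using runs_Flush[of 3 2 "S4 r (rev (code u)) (rev (code v)) []" "rev (code u)" e] set_code[of u] by simp
  moreover have "runs (Flush 4 2) (stacks e (S4 (code u @ r) [] (rev (code v)) [])) (7 * length (code v) + 1)
      (main e (code v @ code u @ r))"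
    using runs_Flush[of 4 2 "S4 (code u @ r) [] (rev (code v)) []" "rev (code v)" e] set_code[of v] by simp
  ultimately have "runs Swap (main e (code u @ code v @ r)) (9 * length (code u) + 3 + (9 * length (code v) + 3 +
      (7 * length (code u) + 1 + (7 * length (code v) + 1)))) (main e (code v @ code u @ r))"
    unfolding Swap_def by (intro runs_Seq)
  then show ?thesis by (rule runs_mono) simp
qed

definition Clear :: "nat \<Rightarrow> cmd" where
  "Clear j = While j {1, 2} (Pop j)"

lemma runs_Clear:
  assumes "j \<in> {2..5}" "set (S j) \<subseteq> {1, 2}"
  shows "runs (Clear j) (stacks e S) (3 * length (S j) + 1) (stacks e (S(j := [])))"
proof -
  have "runs (Clear j) (stacks e S) (3 * length xs + 1) (stacks e (S(j := [])))"
    if "S j = xs" "set xs \<subseteq> {1, 2}" for xs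
    using that
  proof (induction xs arbitrary: S)
    case Nil
    then have "S(j := []) = S" by auto
    then show ?case unfolding Clear_def using Nil assms
      by (auto intro!: runs_mono[OF runs_While_False] simp: read_stacks)
  next
    case (Cons x xs)
    have "runs (Clear j) (stacks e (S(j := xs))) (3 * length xs + 1) (stacks e ((S(j := xs))(j := [])))"
      using Cons by (intro Cons.IH) auto
    moreover have "runs (Pop j) (stacks e S) 1 (stacks e (S(j := xs)))"
      using assms Cons by (intro runs_Pop) auto
    moreover have "read_tape (stacks e S j) \<in> {1, 2}"
      using assms Cons by (auto simp: read_stacks)
    ultimately have "runs (Clear j) (stacks e S) (1 + (3 * length xs + 1) + 2) (stacks e (S(j := [])))"
      unfolding Clear_def fun_upd_upd by (intro runs_While_True)
    then show ?case by (rule runs_mono) simp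
  qed
  from this[OF refl assms(2)] show ?thesis .
qed

definition Drop :: cmd where
  "Drop = (Scan 2 3 ;; Clear 3)"

lemma runs_Drop: "runs Drop (main e (code v @ r)) (12 * length (code v) + 4) (main e r)"
proof -
  have "runs (Scan 2 3) (main e (code v @ r)) (9 * length (code v) + 3) (stacks e (S4 r (rev (code v)) [] []))"
    using runs_Scan[of 2 3 "S4 (code v @ r) [] [] []" v r e] by simp
  moreover have "runs (Clear 3) (stacks e (S4 r (rev (code v)) [] [])) (3 * length (code v) + 1) (main e r)"
    using runs_Clear[of 3 "S4 r (rev (code v)) [] []" e] set_code[of v] by simp
  ultimately have "runs Drop (main e (code v @ r)) (9 * length (code v) + 3 + (3 * length (code v) + 1)) (main e r)"
    unfolding Drop_def by (intro runs_Seq)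
  then show ?thesis by (rule runs_mono) simp
qed

primrec Pushes :: "nat list \<Rightarrow> cmd" where
  "Pushes [] = Skip"
| "Pushes (a # xs) = (Pushes xs ;; Push 2 a)"

lemma runs_Push_main: "runs (Push 2 a) (main e r) 2 (main e (a # r))"
  using runs_Push[of 2 a e "S4 r [] [] []"] by simp

lemma runs_Pop_main: "runs (Pop 2) (main e (a # r)) 1 (main e r)"
  using runs_Pop[of 2 "S4 (a # r) [] [] []" a r e] by simp

lemma runs_Pushes: "runs (Pushes xs) (main e r) (2 * length xs) (main e (xs @ r))"
proof (induction xs)
  case (Cons a xs)
  from runs_Seq[OF Cons runs_Push_main] show ?case by (auto elim: runs_mono)
qed (use runs_Skip in auto)

lemma wf_Pushes: "set xs \<subseteq> {1, 2} \<Longrightarrow> wf_cmd (Pushes xs)"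
  by (induction xs) auto

lemma wf_tree_cmds [simp]: "wf_cmd Dup" "wf_cmd Swap" "wf_cmd Drop" "wf_cmd (Pushes (code v))"
  using wf_Pushes[OF set_code]
  by (auto simp: Dup_def Swap_def Drop_def Scan_def Flush_def Flush_Dup_def Clear_def)

text \<open>Mismatches are counted in unary on stack 5; an exhausted stack 4 reads as 0 and so
  counts as a mismatch. There is no early exit, so stack 3 always ends up empty.\<close>

definition Compare :: cmd where
  "Compare = While 3 {1, 2}
     (Cond 3 {1} (Cond 4 {1} Skip (Push 5 1)) (Cond 4 {2} Skip (Push 5 1)) ;;
      Pop 3 ;; Cond 4 {1, 2} (Pop 4) Skip)"

text \<open>The words are equal precisely if nothing is left on stack 4 and nothing was counted on
  stack 5. The bounds on \<open>w'\<close> and \<open>m\<close> serve to estimate the time for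
  clearing these stacks.\<close>

lemma runs_Compare:
  assumes "set u \<subseteq> {1, 2}" "set w \<subseteq> {1, 2}"
  shows "\<exists>w' m. runs Compare (stacks e (S4 r u w (replicate n 1))) (12 * length u + 1)
      (stacks e (S4 r [] w' (replicate m 1))) \<and> length w' \<le> length w \<and> m \<le> n + length u \<and>
      set w' \<subseteq> {1, 2} \<and> (m = 0 \<and> w' = [] \<longleftrightarrow> n = 0 \<and> u = w)"
  using assms
proof (induction u arbitrary: w n)
  case Nil
  have "runs Compare (stacks e (S4 r [] w (replicate n 1))) 1 (stacks e (S4 r [] w (replicate n 1)))"
    unfolding Compare_def by (rule runs_While_False) (simp add: read_stacks)
  then show ?case using Nil by (intro exI[of _ w] exI[of _ n]) auto
next
  case (Cons a u)
  define n' where "n' = (if w \<noteq> [] \<and> hd w = a then n else Suc n)"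
  have a: "a = 1 \<or> a = 2" using Cons.prems by auto
  have w: "w = [] \<or> hd w = 1 \<or> hd w = 2" using Cons.prems by (cases w) auto
  have push: "runs (Push 5 1) (stacks e (S4 r (a # u) w (replicate n 1))) 2
      (stacks e (S4 r (a # u) w (replicate (Suc n) 1)))"
    using runs_Push[of 5 1 e "S4 r (a # u) w (replicate n 1)"] by simp
  note skip = runs_mono[OF runs_Skip, of 2]
  have 1: "runs (Cond 3 {1} (Cond 4 {1} Skip (Push 5 1)) (Cond 4 {2} Skip (Push 5 1)))
      (stacks e (S4 r (a # u) w (replicate n 1))) (2 + 2 + 2) (stacks e (S4 r (a # u) w (replicate n' 1)))"
    using a w push skip by (intro runs_Cond) (auto simp: read_stacks n'_def split: if_splits)
  have 2: "runs (Pop 3) (stacks e (S4 r (a # u) w (replicate n' 1))) 1 (stacks e (S4 r u w (replicate n' 1)))"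
    using runs_Pop[of 3 "S4 r (a # u) w (replicate n' 1)" a u e] by simp
  have 3: "runs (Cond 4 {1, 2} (Pop 4) Skip) (stacks e (S4 r u w (replicate n' 1))) (1 + 2)
      (stacks e (S4 r u (tl w) (replicate n' 1)))"
  proof (cases w)
    case Nil
    then show ?thesis by (intro runs_Cond) (auto simp: read_stacks intro!: runs_mono[OF runs_Skip])
  next
    case (Cons b w')
    then show ?thesis using w runs_Pop[of 4 "S4 r u w (replicate n' 1)" b w' e]
      by (intro runs_Cond) (auto simp: read_stacks)
  qed
  have "set (tl w) \<subseteq> {1, 2}" using Cons.prems by (cases w) auto
  moreover have "set u \<subseteq> {1, 2}" using Cons.prems by simp
  ultimately obtain w' m where *:
    "runs Compare (stacks e (S4 r u (tl w) (replicate n' 1))) (12 * length u + 1) (stacks e (S4 r [] w' (replicate m 1)))"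
    "length w' \<le> length (tl w)" "m \<le> n' + length u" "set w' \<subseteq> {1, 2}" "m = 0 \<and> w' = [] \<longleftrightarrow> n' = 0 \<and> u = tl w"
    using Cons.IH[of "tl w" n'] by blast
  have "read_tape (stacks e (S4 r (a # u) w (replicate n 1)) 3) \<in> {1, 2}" using a by (auto simp: read_stacks)
  from runs_While_True[OF this runs_Seq[OF 1 runs_Seq[OF 2 3]] *(1)[unfolded Compare_def]]
  have "runs Compare (stacks e (S4 r (a # u) w (replicate n 1))) (12 * length (a # u) + 1) (stacks e (S4 r [] w' (replicate m 1)))"
    unfolding Compare_def by (rule runs_mono) simp
  moreover have "length w' \<le> length w" "m \<le> n + length (a # u)" using *(2,3) by (auto simp: n'_def split: if_splits)
  moreover have "m = 0 \<and> w' = [] \<longleftrightarrow> n = 0 \<and> a # u = w" using *(5) by (cases w) (auto simp: n'_def)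
  ultimately show ?case using *(4) by blast
qed

definition Equal :: cmd where
  "Equal = (Scan 2 3 ;; Scan 2 4 ;; Compare ;; While 4 {1, 2} (Push 5 1 ;; Pop 4) ;;
     Cond 5 {1} (Clear 5 ;; Pushes (code (enc False))) (Pushes (code (enc True))))"

lemma runs_Equal:
  "runs Equal (main e (code u @ code v @ r)) (100 * (length (code u) + length (code v)) + 100) (main e (code (enc (u = v)) @ r))"
proof -
  let ?u = "length (code u)" and ?v = "length (code v)"
  have 1: "runs (Scan 2 3) (main e (code u @ code v @ r)) (9 * ?u + 3) (stacks e (S4 (code v @ r) (rev (code u)) [] []))"
    using runs_Scan[of 2 3 "S4 (code u @ code v @ r) [] [] []" u "code v @ r" e] by simp
  have 2: "runs (Scan 2 4) (stacks e (S4 (code v @ r) (rev (code u)) [] [])) (9 * ?v + 3)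
      (stacks e (S4 r (rev (code u)) (rev (code v)) []))"
    using runs_Scan[of 2 4 "S4 (code v @ r) (rev (code u)) [] []" v r e] by simp
  obtain w m where 3: "runs Compare (stacks e (S4 r (rev (code u)) (rev (code v)) [])) (12 * ?u + 1)
      (stacks e (S4 r [] w (replicate m 1)))" and wm: "length w \<le> ?v" "m \<le> ?u" "set w \<subseteq> {1, 2}"
      "m = 0 \<and> w = [] \<longleftrightarrow> u = v"
  proof -
    have "set (rev (code u)) \<subseteq> {1, 2}" "set (rev (code v)) \<subseteq> {1, 2}" using set_code by simp_all
    from runs_Compare[OF this, of e r 0] show thesis
      using that by (simp only: length_rev add_0 replicate_0 rev_is_rev_conv code_inject) blast
  qed
  \<comment> \<open>What remains of a longer second word is turned into further mismatches, so that
    stack 5 alone decides.\<close>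
  have 4: "runs (While 4 {1, 2} (Push 5 1 ;; Pop 4)) (stacks e (S4 r [] w (replicate m 1))) (5 * length w + 1)
      (stacks e (S4 r [] [] (replicate (m + length w) 1)))" for m
    using wm(3)
  proof (induction w arbitrary: m)
    case Nil
    then show ?case by (auto intro!: runs_mono[OF runs_While_False] simp: read_stacks)
  next
    case (Cons x w)
    have "runs (Push 5 1 ;; Pop 4) (stacks e (S4 r [] (x # w) (replicate m 1))) (2 + 1) (stacks e (S4 r [] w (replicate (Suc m) 1)))"
      by (rule runs_Seq[OF runs_Push_eq[of 5 "S4 r [] (x # w) (1 # replicate m 1)"] runs_Pop_eq[of 4 _ x w]]) auto
    moreover have "read_tape (stacks e (S4 r [] (x # w) (replicate m 1)) 4) \<in> {1, 2}" using Cons.prems by (simp add: read_stacks)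
    moreover have "runs (While 4 {1, 2} (Push 5 1 ;; Pop 4)) (stacks e (S4 r [] w (replicate (Suc m) 1))) (5 * length w + 1)
      (stacks e (S4 r [] [] (replicate (m + length (x # w)) 1)))" using Cons.IH[of "Suc m"] Cons.prems by simp
    ultimately have "runs (While 4 {1, 2} (Push 5 1 ;; Pop 4)) (stacks e (S4 r [] (x # w) (replicate m 1))) (2 + 1 + (5 * length w + 1) + 2)
      (stacks e (S4 r [] [] (replicate (m + length (x # w)) 1)))" by (intro runs_While_True)
    then show ?case by (rule runs_mono) simp
  qed
  let ?k = "m + length w"
  have k: "?k = 0 \<longleftrightarrow> u = v" using wm by auto
  have 5: "runs (Cond 5 {1} (Clear 5 ;; Pushes (code (enc False))) (Pushes (code (enc True))))
     (stacks e (S4 r [] [] (replicate ?k 1))) (3 * ?k + 1 + 8 + 2) (main e (code (enc (u = v)) @ r))"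
  proof (intro runs_Cond)
    assume "read_tape (stacks e (S4 r [] [] (replicate ?k 1)) 5) \<in> {1}"
    then have "u \<noteq> v" using k by (auto simp: read_stacks)
    have "runs (Clear 5) (stacks e (S4 r [] [] (replicate ?k 1))) (3 * ?k + 1) (main e r)"
      using runs_Clear[of 5 "S4 r [] [] (replicate ?k 1)" e] by (simp add: set_replicate_conv_if)
    from runs_Seq[OF this runs_Pushes[of "code (enc False)"]] \<open>u \<noteq> v\<close>
    show "runs (Clear 5 ;; Pushes (code (enc False))) (stacks e (S4 r [] [] (replicate ?k 1))) (3 * ?k + 1 + 8)
      (main e (code (enc (u = v)) @ r))" by (auto elim!: runs_mono simp: enc_bool_def)
  next
    assume "read_tape (stacks e (S4 r [] [] (replicate ?k 1)) 5) \<notin> {1}"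
    then have "?k = 0" by (auto simp: read_stacks split: if_splits)
    with k runs_Pushes[of "code (enc True)" e r]
    show "runs (Pushes (code (enc True))) (stacks e (S4 r [] [] (replicate ?k 1))) (3 * ?k + 1 + 8)
      (main e (code (enc (u = v)) @ r))" by (auto elim!: runs_mono simp: enc_bool_def)
  qed
  have "runs Equal (main e (code u @ code v @ r)) (9 * ?u + 3 + (9 * ?v + 3 + (12 * ?u + 1 + (5 * length w + 1 + (3 * ?k + 1 + 8 + 2)))))
    (main e (code (enc (u = v)) @ r))"
    unfolding Equal_def by (intro runs_Seq[OF 1] runs_Seq[OF 2] runs_Seq[OF 3] runs_Seq[OF 4] 5)
  then show ?thesis by (rule runs_mono) (use wm in simp)
qed

lemma wf_Equal [simp]: "wf_cmd Equal"
  by (simp add: Equal_def Scan_def Compare_def Clear_def)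


subsection \<open>Polynomially bounded and polynomial-time functions\<close>

text \<open>
  A function is polynomial-time computable (\<open>ptc\<close>) if a command replaces the code of its argument on
  the main stack by that of its value in polynomially bounded (\<open>pb\<close>) time. What lies below on the
  stack is arbitrary, so that it can hold intermediate results and such commands compose.
\<close>

definition pb :: "('a::enc \<Rightarrow> nat) \<Rightarrow> bool" where
  "pb B \<longleftrightarrow> (\<exists>p :: nat poly. \<forall>x. B x \<le> poly p (sz x))"

definition ptc :: "('a::enc \<Rightarrow> 'b::enc) \<Rightarrow> bool" where
  "ptc f \<longleftrightarrow> (\<exists>c B. wf_cmd c \<and> pb B \<and> pb (\<lambda>x. sz (f x)) \<and>
     (\<forall>x e r. runs c (main e (code (enc x) @ r)) (B x) (main e (code (enc (f x)) @ r))))"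

named_theorems pb_intros
named_theorems ptc_intros

text \<open>Natural coefficients are nonnegative. This monotonicity is what allows size bounds to be
  substituted into time bounds.\<close>

lemma poly_nat_mono: "m \<le> n \<Longrightarrow> poly (p :: nat poly) m \<le> poly p n"
  by (induction p) (auto intro!: mult_le_mono)

lemma pb_mono: "pb B \<Longrightarrow> (\<And>x. A x \<le> B x) \<Longrightarrow> pb A"
  unfolding pb_def by (meson le_trans)

lemma pb_const [pb_intros]: "pb (\<lambda>x. k)"
  unfolding pb_def by (rule exI[of _ "[:k:]"]) simp

lemma pb_size [pb_intros]: "pb sz"
  unfolding pb_def by (rule exI[of _ "[:0, 1:]"]) simp

lemma pb_add [pb_intros]: "pb A \<Longrightarrow> pb B \<Longrightarrow> pb (\<lambda>x. A x + B x)"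
  unfolding pb_def by (metis poly_add add_mono)

lemma pb_Suc [pb_intros]: "pb A \<Longrightarrow> pb (\<lambda>x. Suc (A x))"
  using pb_add[OF _ pb_const[of 1]] by simp

lemma pb_mult [pb_intros]: "pb A \<Longrightarrow> pb B \<Longrightarrow> pb (\<lambda>x. A x * B x)"
  unfolding pb_def by (metis poly_mult mult_le_mono)

lemma pb_poly [pb_intros]: "pb B \<Longrightarrow> pb (\<lambda>x. poly p (B x))"
  unfolding pb_def by (metis poly_nat_mono poly_pcompose)

lemma pb_comp: "pb B \<Longrightarrow> pb (\<lambda>x. sz (f x)) \<Longrightarrow> pb (\<lambda>x. B (f x))"
proof -
  assume "pb B" and f: "pb (\<lambda>x. sz (f x))"
  then obtain p where "\<And>x. B x \<le> poly p (sz x)" by (auto simp: pb_def)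
  then show ?thesis by (intro pb_mono[OF pb_poly[OF f, of p]])
qed

lemma pb_ptc [pb_intros]: "ptc f \<Longrightarrow> pb (\<lambda>x. sz (f x))"
  by (auto simp: ptc_def)

lemma ptcI:
  assumes "\<And>x e r. runs c (main e (code (enc x) @ r)) (B x) (main e (code (enc (f x)) @ r))"
    and "wf_cmd c" "pb B" "pb (\<lambda>x. sz (f x))"
  shows "ptc f"
  using assms unfolding ptc_def by blast

lemma ptcE:
  assumes "ptc f"
  obtains c B where "wf_cmd c" "pb B" "pb (\<lambda>x. sz (f x))"
    "\<And>x e r. runs c (main e (code (enc x) @ r)) (B x) (main e (code (enc (f x)) @ r))"
  using assms unfolding ptc_def by blast

text \<open>A program sees only codes, so the results of \<open>f\<close> and \<open>g\<close> may
  have different types. The constructors of lists, numbers and symbols are obtained in this way from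
  pairs and bit lists.\<close>

lemma ptc_recode: "(\<And>x. enc (f x) = enc (g x)) \<Longrightarrow> ptc f \<Longrightarrow> ptc g"
  unfolding ptc_def sz_def by simp

section \<open>Closure under composition, pairing, case distinction and equality\<close>

lemma ptc_id [ptc_intros]: "ptc (\<lambda>x. x)"
  by (rule ptcI[where c = Skip and B = "\<lambda>_. 0"]) (auto simp: runs_Skip pb_const pb_size)

lemma ptc_comp:
  assumes "ptc f" "ptc g"
  shows "ptc (\<lambda>x. g (f x))"
proof -
  from assms(1) obtain c A where c: "wf_cmd c" "pb A" "pb (\<lambda>x. sz (f x))"
    "\<And>x e r. runs c (main e (code (enc x) @ r)) (A x) (main e (code (enc (f x)) @ r))" by (rule ptcE) blast
  from assms(2) obtain d B where d: "wf_cmd d" "pb B" "pb (\<lambda>x. sz (g x))"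
    "\<And>x e r. runs d (main e (code (enc x) @ r)) (B x) (main e (code (enc (g x)) @ r))" by (rule ptcE) blast
  show ?thesis
    by (rule ptcI[where c = "c ;; d" and B = "\<lambda>x. A x + B (f x)", OF runs_Seq[OF c(4) d(4)]])
      (use c(1) d(1) pb_add[OF c(2) pb_comp[OF d(2) c(3)]] pb_comp[OF d(3) c(3)] in auto)
qed

text \<open>The constant is written into the program. Any fixed datum, such as the transitions of a
  given machine, can be built in like this.\<close>

lemma ptc_const [ptc_intros]: "ptc (\<lambda>x. k)"
proof (rule ptcI)
  show "runs (Drop ;; Pushes (code (enc k))) (main e (code (enc x) @ r)) (12 * sz x + 4 + 2 * sz k) (main e (code (enc k) @ r))"
    for x :: 'a and e r unfolding sz_def by (rule runs_Seq[OF runs_Drop runs_Pushes])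
qed (auto intro!: pb_intros)

lemma ptc_fst0: "ptc fst"
proof (rule ptcI)
  fix x :: "'a \<times> 'b" and e r
  have "runs (Pop 2 ;; Swap ;; Drop) (main e (code (enc x) @ r))
    (1 + (16 * (length (code (enc (fst x))) + length (code (enc (snd x)))) + 8 + (12 * length (code (enc (snd x))) + 4)))
    (main e (code (enc (fst x)) @ r))"
    unfolding enc_prod_def code.simps append_Cons append_assoc
    by (intro runs_Seq[OF runs_Pop_main runs_Seq[OF runs_Swap runs_Drop]])
  then show "runs (Pop 2 ;; Swap ;; Drop) (main e (code (enc x) @ r)) (32 * sz x + 20) (main e (code (enc (fst x)) @ r))"
    by (rule runs_mono) (simp add: sz_def enc_prod_def)
  show "pb (\<lambda>x :: 'a \<times> 'b. sz (fst x))"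
    by (rule pb_mono[OF pb_size]) (simp add: sz_def enc_prod_def)
qed (auto intro!: pb_intros)

lemma ptc_snd0: "ptc snd"
proof (rule ptcI)
  fix x :: "'a \<times> 'b" and e r
  have "runs (Pop 2 ;; Drop) (main e (code (enc x) @ r))
    (1 + (12 * length (code (enc (fst x))) + 4))
    (main e (code (enc (snd x)) @ r))"
    unfolding enc_prod_def code.simps append_Cons append_assoc
    by (intro runs_Seq[OF runs_Pop_main runs_Drop])
  then show "runs (Pop 2 ;; Drop) (main e (code (enc x) @ r)) (32 * sz x + 20) (main e (code (enc (snd x)) @ r))"
    by (rule runs_mono) (simp add: sz_def enc_prod_def)
  show "pb (\<lambda>x :: 'a \<times> 'b. sz (snd x))"
    by (rule pb_mono[OF pb_size]) (simp add: sz_def enc_prod_def)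
qed (auto intro!: pb_intros)

lemma ptc_fst [ptc_intros]: "ptc f \<Longrightarrow> ptc (\<lambda>x. fst (f x))"
  by (rule ptc_comp[OF _ ptc_fst0])

lemma ptc_snd [ptc_intros]: "ptc f \<Longrightarrow> ptc (\<lambda>x. snd (f x))"
  by (rule ptc_comp[OF _ ptc_snd0])

lemma ptc_Pair [ptc_intros]:
  assumes "ptc f" "ptc g"
  shows "ptc (\<lambda>x. (f x, g x))"
proof -
  from assms(1) obtain c A where c: "wf_cmd c" "pb A" "pb (\<lambda>x. sz (f x))"
    "\<And>x e r. runs c (main e (code (enc x) @ r)) (A x) (main e (code (enc (f x)) @ r))" by (rule ptcE) blast
  from assms(2) obtain d B where d: "wf_cmd d" "pb B" "pb (\<lambda>x. sz (g x))"
    "\<And>x e r. runs d (main e (code (enc x) @ r)) (B x) (main e (code (enc (g x)) @ r))" by (rule ptcE) blast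
  show ?thesis
  proof (rule ptcI)
    fix x e r
    \<comment> \<open>From the top, the stack holds in turn \<open>x, x\<close>, then
      \<open>f x, x\<close>, then \<open>x, f x\<close>, then \<open>g x, f x\<close>, then
      \<open>f x, g x\<close>; the final 2 is the node that joins the two.\<close>
    have "runs (Dup ;; c ;; Swap ;; d ;; Swap ;; Push 2 2) (main e (code (enc x) @ r))
      (32 * sz x + 6 + (A x + (16 * (sz (f x) + sz x) + 8 + (B x + (16 * (sz (g x) + sz (f x)) + 8 + 2)))))
      (main e (2 # code (enc (f x)) @ code (enc (g x)) @ r))"
      unfolding sz_def
      by (intro runs_Seq[OF runs_Dup] runs_Seq[OF c(4)] runs_Seq[OF runs_Swap] runs_Seq[OF d(4)] runs_Push_main)
    then show "runs (Dup ;; c ;; Swap ;; d ;; Swap ;; Push 2 2) (main e (code (enc x) @ r))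
      (32 * sz x + 6 + (A x + (16 * (sz (f x) + sz x) + 8 + (B x + (16 * (sz (g x) + sz (f x)) + 8 + 2)))))
      (main e (code (enc (f x, g x)) @ r))" by (simp add: enc_prod_def)
  qed (use c d in \<open>auto intro!: pb_intros c d\<close>)
qed

lemma ptc_comp2: "ptc (\<lambda>p. h (fst p) (snd p)) \<Longrightarrow> ptc f \<Longrightarrow> ptc g \<Longrightarrow> ptc (\<lambda>x. h (f x) (g x))"
  using ptc_comp[OF ptc_Pair] by fastforce

lemma ptc_If [ptc_intros]:
  assumes "ptc h" "ptc f" "ptc g"
  shows "ptc (\<lambda>x. if h x then f x else g x)"
proof -
  from assms(1) obtain b T where b: "wf_cmd b" "pb T" "pb (\<lambda>x. sz (h x))"
    "\<And>x e r. runs b (main e (code (enc x) @ r)) (T x) (main e (code (enc (h x)) @ r))" by (rule ptcE) blast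
  from assms(2) obtain c A where c: "wf_cmd c" "pb A" "pb (\<lambda>x. sz (f x))"
    "\<And>x e r. runs c (main e (code (enc x) @ r)) (A x) (main e (code (enc (f x)) @ r))" by (rule ptcE) blast
  from assms(3) obtain d B where d: "wf_cmd d" "pb B" "pb (\<lambda>x. sz (g x))"
    "\<And>x e r. runs d (main e (code (enc x) @ r)) (B x) (main e (code (enc (g x)) @ r))" by (rule ptcE) blast
  show ?thesis
  proof (rule ptcI)
    fix x e r
    \<comment> \<open>The code of \<open>True\<close> starts with 2 and that of \<open>False\<close>
      is 1, so the topmost symbol decides.\<close>
    let ?C = "Cond 2 {2} (Drop ;; c) (Drop ;; d)"
    let ?st = "main e (code (enc (h x)) @ code (enc x) @ r)"
    have 1: "runs (Drop ;; c) ?st (12 * sz (h x) + 4 + A x) (main e (code (enc (f x)) @ r))"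
      "runs (Drop ;; d) ?st (12 * sz (h x) + 4 + B x) (main e (code (enc (g x)) @ r))"
      unfolding sz_def by (intro runs_Seq[OF runs_Drop] c d)+
    have "runs ?C ?st (12 * sz (h x) + 4 + (A x + B x) + 2) (main e (code (enc (if h x then f x else g x)) @ r))"
    proof (rule runs_Cond)
      assume "read_tape (?st 2) \<in> {2}"
      then have "h x" by (simp add: read_stacks enc_bool_def split: if_splits)
      with 1(1) show "runs (Drop ;; c) ?st (12 * sz (h x) + 4 + (A x + B x)) (main e (code (enc (if h x then f x else g x)) @ r))"
        by (auto elim: runs_mono)
    next
      assume "read_tape (?st 2) \<notin> {2}"
      then have "\<not> h x" by (simp add: read_stacks enc_bool_def split: if_splits)
      with 1(2) show "runs (Drop ;; d) ?st (12 * sz (h x) + 4 + (A x + B x)) (main e (code (enc (if h x then f x else g x)) @ r))"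
        by (auto elim: runs_mono)
    qed
    then show "runs (Dup ;; b ;; ?C) (main e (code (enc x) @ r)) (32 * sz x + 6 + (T x + (12 * sz (h x) + 4 + (A x + B x) + 2)))
      (main e (code (enc (if h x then f x else g x)) @ r))"
      unfolding sz_def[of x] by (intro runs_Seq[OF runs_Dup] runs_Seq[OF b(4)])
  next
    show "pb (\<lambda>x. sz (if h x then f x else g x))"
      by (rule pb_mono[OF pb_add[OF c(3) d(3)]]) simp
  qed (use b c d in \<open>auto intro!: pb_intros b c d\<close>)
qed

lemma ptc_bool [ptc_intros]:
  assumes "ptc a"
  shows "ptc (\<lambda>x. \<not> a x)" "ptc b \<Longrightarrow> ptc (\<lambda>x. a x \<and> b x)" "ptc b \<Longrightarrow> ptc (\<lambda>x. a x \<or> b x)"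
    "ptc b \<Longrightarrow> ptc (\<lambda>x. a x \<longrightarrow> b x)"
proof -
  have "ptc (\<lambda>x. if a x then False else True)" by (intro ptc_intros assms)
  then show "ptc (\<lambda>x. \<not> a x)" by (rule back_subst[of ptc]) auto
  assume b: "ptc b"
  have "ptc (\<lambda>x. if a x then b x else False)" by (intro ptc_intros assms b)
  then show "ptc (\<lambda>x. a x \<and> b x)" by (rule back_subst[of ptc]) auto
  have "ptc (\<lambda>x. if a x then True else b x)" by (intro ptc_intros assms b)
  then show "ptc (\<lambda>x. a x \<or> b x)" by (rule back_subst[of ptc]) auto
  have "ptc (\<lambda>x. if a x then b x else True)" by (intro ptc_intros assms b)
  then show "ptc (\<lambda>x. a x \<longrightarrow> b x)" by (rule back_subst[of ptc]) auto
qed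

lemma ptc_eq [ptc_intros]:
  assumes "ptc f" "ptc g"
  shows "ptc (\<lambda>x. f x = g x)"
proof -
  have "ptc (\<lambda>p :: 'b \<times> 'b. fst p = snd p)"
  proof (rule ptcI)
    fix p :: "'b \<times> 'b" and e r
    have "runs (Pop 2 ;; Equal) (main e (2 # code (enc (fst p)) @ code (enc (snd p)) @ r))
      (1 + (100 * (length (code (enc (fst p))) + length (code (enc (snd p)))) + 100))
      (main e (code (enc (enc (fst p) = enc (snd p))) @ r))"
      by (rule runs_Seq[OF runs_Pop_main runs_Equal])
    then show "runs (Pop 2 ;; Equal) (main e (code (enc p) @ r)) (100 * sz p + 101)
      (main e (code (enc (fst p = snd p)) @ r))"
      by (auto elim!: runs_mono simp: enc_prod_def sz_def)
    show "pb (\<lambda>p :: 'b \<times> 'b. sz (fst p = snd p))"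
      by (rule pb_mono[OF pb_const[of 3]]) (simp add: sz_bool)
  qed (auto intro!: pb_intros)
  from ptc_comp2[OF this assms] show ?thesis .
qed

lemma ptc_Cons [ptc_intros]: "ptc f \<Longrightarrow> ptc g \<Longrightarrow> ptc (\<lambda>x. f x # g x)"
  by (rule ptc_recode[of "\<lambda>x. (f x, g x)"]) (simp_all add: enc_prod_def ptc_Pair)

lemma sz_enc_code: "length (code (enc x)) = sz x"
  by (simp add: sz_def)

text \<open>The value \<open>hd []\<close> is unspecified but fixed, so that its code can be built into the machine.\<close>

lemma ptc_hd [ptc_intros]:
  assumes "ptc f"
  shows "ptc (\<lambda>x. hd (f x))"
proof -
  have "ptc (hd :: 'b list \<Rightarrow> 'b)"
  proof (rule ptcI)
    fix xs :: "'b list" and e r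
    let ?N = "sz (hd [] :: 'b)"
    show "runs (Cond 2 {2} (Pop 2 ;; Swap ;; Drop) (Drop ;; Pushes (code (enc (hd [] :: 'b)))))
      (main e (code (enc xs) @ r)) (1 + (28 * sz xs + 12) + 2 * ?N + 2) (main e (code (enc (hd xs)) @ r))"
    proof (rule runs_Cond)
      assume "read_tape (main e (code (enc xs) @ r) 2) \<in> {2}"
      then obtain y ys where xs: "xs = y # ys" by (cases xs) (auto simp: read_stacks)
      have "runs (Pop 2 ;; Swap ;; Drop) (main e (2 # code (enc y) @ code (enc ys) @ r))
        (1 + (16 * (length (code (enc y)) + length (code (enc ys))) + 8 + (12 * length (code (enc ys)) + 4)))
        (main e (code (enc y) @ r))"
        by (intro runs_Seq[OF runs_Pop_main runs_Seq[OF runs_Swap runs_Drop]])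
      then show "runs (Pop 2 ;; Swap ;; Drop) (main e (code (enc xs) @ r)) (1 + (28 * sz xs + 12) + 2 * ?N) (main e (code (enc (hd xs)) @ r))"
        unfolding sz_enc_code by (auto elim!: runs_mono simp: xs)
    next
      assume "read_tape (main e (code (enc xs) @ r) 2) \<notin> {2}"
      then have xs: "xs = []" by (cases xs) (auto simp: read_stacks)
      show "runs (Drop ;; Pushes (code (enc (hd [] :: 'b)))) (main e (code (enc xs) @ r)) (1 + (28 * sz xs + 12) + 2 * ?N) (main e (code (enc (hd xs)) @ r))"
        unfolding xs by (rule runs_mono[OF runs_Seq[OF runs_Drop runs_Pushes]]) (simp add: sz_def)
    qed
    have "sz (hd xs) \<le> sz xs + ?N" for xs :: "'b list" by (cases xs) auto
    then show "pb (\<lambda>xs :: 'b list. sz (hd xs))" by (rule pb_mono[rotated]) (auto intro!: pb_intros)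
  qed (auto intro!: pb_intros)
  from ptc_comp[OF assms this] show ?thesis .
qed

lemma ptc_tl [ptc_intros]:
  assumes "ptc f"
  shows "ptc (\<lambda>x. tl (f x))"
proof -
  have "ptc (tl :: 'b list \<Rightarrow> 'b list)"
  proof (rule ptcI)
    fix xs :: "'b list" and e r
    show "runs (Cond 2 {2} (Pop 2 ;; Drop) Skip) (main e (code (enc xs) @ r)) (1 + (12 * sz xs + 4) + 2) (main e (code (enc (tl xs)) @ r))"
    proof (rule runs_Cond)
      assume "read_tape (main e (code (enc xs) @ r) 2) \<in> {2}"
      then obtain y ys where xs: "xs = y # ys" by (cases xs) (auto simp: read_stacks)
      have "runs (Pop 2 ;; Drop) (main e (2 # code (enc y) @ code (enc ys) @ r)) (1 + (12 * length (code (enc y)) + 4))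
        (main e (code (enc ys) @ r))"
        by (intro runs_Seq[OF runs_Pop_main runs_Drop])
      then show "runs (Pop 2 ;; Drop) (main e (code (enc xs) @ r)) (1 + (12 * sz xs + 4)) (main e (code (enc (tl xs)) @ r))"
        unfolding sz_enc_code by (auto elim!: runs_mono simp: xs)
    next
      assume "read_tape (main e (code (enc xs) @ r) 2) \<notin> {2}"
      then have xs: "xs = []" by (cases xs) (auto simp: read_stacks)
      show "runs Skip (main e (code (enc xs) @ r)) (1 + (12 * sz xs + 4)) (main e (code (enc (tl xs)) @ r))"
        unfolding xs by (rule runs_mono[OF _ le0]) (simp add: runs_Skip)
    qed
    have "sz (tl xs) \<le> sz xs" for xs :: "'b list" by (cases xs) auto
    then show "pb (\<lambda>xs :: 'b list. sz (tl xs))" by (rule pb_mono[OF pb_size])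
  qed (auto intro!: pb_intros)
  from ptc_comp[OF assms this] show ?thesis .
qed

lemma sz_take: "sz (take k xs) \<le> sz xs"
  by (induction xs arbitrary: k) (auto simp: take_Cons' intro: le_SucI)

lemma sz_drop: "sz (drop k xs) \<le> sz xs"
proof (induction xs arbitrary: k)
  case (Cons a xs)
  show ?case
  proof (cases k)
    case (Suc j)
    from Cons[of j] show ?thesis by (simp add: Suc)
  qed simp
qed simp

lemma length_le_sz: "length xs < sz xs"
  by (induction xs) (auto simp: sz_def)

text \<open>The list lies above the accumulator. Pushing a node symbol turns the two into a pair, on
  which the body \<open>c\<close> works; popping it uncovers the list again, which starts with 2 as
  long as it is nonempty. \<open>t\<close> bounds the time of the body at all intermediate
  accumulators.\<close>

lemma runs_fold:
  assumes "\<And>x xs s e r. runs c (main e (code (enc (x # xs, s)) @ r)) (B (x # xs, s)) (main e (code (enc (xs, g x s)) @ r))"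
    and "\<And>k. k < length xs \<Longrightarrow> B (drop k xs, fold g (take k xs) s) \<le> t"
  shows "runs (While 2 {2} (Push 2 2 ;; c ;; Pop 2)) (main e (code (enc xs) @ code (enc s) @ r))
    (length xs * (t + 5) + 1) (main e (1 # code (enc (fold g xs s)) @ r))"
  using assms(2)
proof (induction xs arbitrary: s)
  case Nil
  show ?case by (auto intro!: runs_mono[OF runs_While_False] simp: read_stacks)
next
  case (Cons x xs)
  have "runs (Push 2 2) (main e (code (enc (x # xs)) @ code (enc s) @ r)) 2 (main e (code (enc (x # xs, s)) @ r))"
    using runs_Push_main[of 2 e "code (enc (x # xs)) @ code (enc s) @ r"] by (simp add: enc_prod_def)
  moreover have "runs c (main e (code (enc (x # xs, s)) @ r)) t (main e (code (enc (xs, g x s)) @ r))"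
    by (rule runs_mono[OF assms(1)]) (use Cons.prems[of 0] in simp)
  moreover have "runs (Pop 2) (main e (code (enc (xs, g x s)) @ r)) 1 (main e (code (enc xs) @ code (enc (g x s)) @ r))"
    using runs_Pop_main[of e 2] by (simp add: enc_prod_def)
  ultimately have 1: "runs (Push 2 2 ;; c ;; Pop 2) (main e (code (enc (x # xs)) @ code (enc s) @ r)) (2 + (t + 1))
    (main e (code (enc xs) @ code (enc (g x s)) @ r))" by (intro runs_Seq)
  have "B (drop k xs, fold g (take k xs) (g x s)) \<le> t" if "k < length xs" for k
    using Cons.prems[of "Suc k"] that by simp
  note 2 = Cons.IH[OF this]
  have "read_tape (main e (code (enc (x # xs)) @ code (enc s) @ r) 2) \<in> {2}" by (simp add: read_stacks)
  from runs_While_True[OF this 1 2] show ?case by (auto elim!: runs_mono)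
qed

text \<open>The bound \<open>b\<close> must hold for the accumulator after every prefix of the list;
  only then is each round, and so their sum, polynomial in the original argument rather than in a
  growing intermediate value.\<close>

lemma ptc_fold:
  assumes g: "ptc (\<lambda>q. g (fst q) (fst (snd q)) (snd (snd q)))" and xs: "ptc xs" and s: "ptc s"
    and b: "pb b" "\<And>z k. sz (fold (g z) (take k (xs z)) (s z)) \<le> b z"
  shows "ptc (\<lambda>z. fold (g z) (xs z) (s z))"
proof -
  \<comment> \<open>The folded function depends on the argument \<open>z\<close>, which the loop
    must not lose; it travels along inside the accumulator.\<close>
  define G where "G = (\<lambda>x p. (fst p, g (fst p) x (snd p)))"
  define body where "body = (\<lambda>q. (tl (fst q), G (hd (fst q)) (snd q)))"
  have fold_G: "fold G ys (z, t) = (z, fold (g z) ys t)" for ys z t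
    by (induction ys arbitrary: t) (auto simp: G_def)
  have "ptc (\<lambda>q. (fst (snd q), hd (fst q), snd (snd q)))" by (intro ptc_intros)
  from ptc_comp[OF this g] have "ptc (\<lambda>q. g (fst (snd q)) (hd (fst q)) (snd (snd q)))" by simp
  then have "ptc body" unfolding body_def G_def by (intro ptc_intros)
  then obtain c B where c: "wf_cmd c" "pb B"
    "\<And>x e r. runs c (main e (code (enc x) @ r)) (B x) (main e (code (enc (body x)) @ r))" by (rule ptcE) blast
  have step: "runs c (main e (code (enc (x # ys, t)) @ r)) (B (x # ys, t)) (main e (code (enc (ys, G x t)) @ r))"
    for x ys t e r
    using c(3)[of e "(x # ys, t)" r] by (simp add: body_def)
  obtain p where p: "\<And>x. B x \<le> poly p (sz x)" using c(2) unfolding pb_def by blast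
  have "ptc (\<lambda>z. (xs z, z, s z))" by (intro ptc_intros xs s)
  then obtain c0 B0 where c0: "wf_cmd c0" "pb B0"
    "\<And>z e r. runs c0 (main e (code (enc z) @ r)) (B0 z) (main e (code (enc (xs z, z, s z)) @ r))" by (rule ptcE) blast
  define t where "t z = poly p (sz (xs z) + (sz z + b z + 1) + 1)" for z
  have "ptc (\<lambda>z. fold G (xs z) (z, s z))"
  proof (rule ptcI)
    fix z e r
    let ?W = "While 2 {2} (Push 2 2 ;; c ;; Pop 2)"
    have "B (drop k (xs z), fold G (take k (xs z)) (z, s z)) \<le> t z" for k
    proof -
      have "B (drop k (xs z), fold G (take k (xs z)) (z, s z)) \<le> poly p (sz (drop k (xs z), fold G (take k (xs z)) (z, s z)))"
        by (rule p)
      also have "\<dots> \<le> t z"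
        unfolding t_def by (rule poly_nat_mono) (simp add: fold_G b(2) sz_drop add_mono)
      finally show ?thesis .
    qed
    then have "runs ?W (main e (code (enc (xs z)) @ code (enc (z, s z)) @ r)) (length (xs z) * (t z + 5) + 1)
      (main e (1 # code (enc (fold G (xs z) (z, s z))) @ r))"
      by (intro runs_fold[where B = B] step)
    moreover have "runs (Pop 2) (main e (code (enc (xs z, z, s z)) @ r)) 1 (main e (code (enc (xs z)) @ code (enc (z, s z)) @ r))"
      using runs_Pop_main[of e 2] by (simp add: enc_prod_def)
    ultimately have "runs (c0 ;; Pop 2 ;; ?W ;; Pop 2) (main e (code (enc z) @ r))
      (B0 z + (1 + ((length (xs z) * (t z + 5) + 1) + 1))) (main e (code (enc (fold G (xs z) (z, s z))) @ r))"
      by (intro runs_Seq[OF c0(3)] runs_Seq[OF _ runs_Seq[OF _ runs_Pop_main]])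
    then show "runs (c0 ;; Pop 2 ;; ?W ;; Pop 2) (main e (code (enc z) @ r))
      (B0 z + (1 + ((sz (xs z) * (t z + 5) + 1) + 1))) (main e (code (enc (fold G (xs z) (z, s z))) @ r))"
      by (rule runs_mono) (simp add: length_le_sz less_imp_le)
  next
    show "pb (\<lambda>z. sz (fold G (xs z) (z, s z)))"
    proof (rule pb_mono)
      show "sz (fold G (xs z) (z, s z)) \<le> sz z + b z + 1" for z
        using b(2)[of z "length (xs z)"] by (simp add: fold_G)
    qed (intro pb_intros b)
  qed (use c c0 xs in \<open>auto intro!: pb_intros b simp: t_def\<close>)
  then have "ptc (\<lambda>z. snd (fold G (xs z) (z, s z)))" by (intro ptc_intros)
  then show ?thesis by (simp add: fold_G)
qed


subsection \<open>Lists\<close>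

lemma ptc_Ball [ptc_intros]:
  assumes "ptc (\<lambda>q. P (fst q) (snd q))" "ptc xs"
  shows "ptc (\<lambda>z. \<forall>x\<in>set (xs z). P z x)"
proof -
  have "ptc (\<lambda>q. P (fst q) (fst (snd q)))"
    by (rule ptc_comp2[OF assms(1)]) (intro ptc_intros)+
  then have "ptc (\<lambda>z. fold (\<lambda>x b. b \<and> P z x) (xs z) True)"
    by (intro ptc_fold[where b = "\<lambda>_. 3"] ptc_intros assms pb_intros) (auto simp: sz_bool)
  moreover have "fold (\<lambda>x b. b \<and> P z x) ys b \<longleftrightarrow> b \<and> (\<forall>x\<in>set ys. P z x)" for z ys b
    by (induction ys arbitrary: b) auto
  ultimately show ?thesis by simp
qed

lemma ptc_Bex [ptc_intros]:
  assumes "ptc (\<lambda>q. P (fst q) (snd q))" "ptc xs"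
  shows "ptc (\<lambda>z. \<exists>x\<in>set (xs z). P z x)"
proof -
  have "ptc (\<lambda>z. \<not> (\<forall>x\<in>set (xs z). \<not> P z x))" by (intro ptc_intros assms)
  then show ?thesis by simp
qed

lemma ptc_member [ptc_intros]: "ptc f \<Longrightarrow> ptc xs \<Longrightarrow> ptc (\<lambda>z. f z \<in> set (xs z))"
proof -
  assume f: "ptc f" and xs: "ptc xs"
  have "ptc (\<lambda>q. f (fst q))" by (rule ptc_comp[OF ptc_fst[OF ptc_id] f])
  then have "ptc (\<lambda>z. \<exists>x\<in>set (xs z). f z = x)" by (intro ptc_intros xs)
  then show ?thesis by simp
qed

lemma sz_append: "sz (xs @ ys) + 1 = sz xs + sz ys"
  by (induction xs) auto

lemma sz_rev [simp]: "sz (rev xs) = sz xs"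
proof (induction xs)
  case (Cons a xs)
  then show ?case using sz_append[of "rev xs" "[a]"] by simp
qed simp

lemma sz_member: "x \<in> set xs \<Longrightarrow> sz x \<le> sz xs"
  by (induction xs) auto

lemma ptc_rev [ptc_intros]: "ptc f \<Longrightarrow> ptc (\<lambda>z. rev (f z))"
proof -
  assume f: "ptc f"
  have "sz (fold (\<lambda>x acc. x # acc) (take k (f z)) []) \<le> sz (f z)" for z k
    using sz_take[of k "f z"] by (simp add: fold_Cons_rev)
  then have "ptc (\<lambda>z. fold (\<lambda>x acc. x # acc) (f z) [])"
    by (intro ptc_fold[where b = "\<lambda>z. sz (f z)"] ptc_intros pb_intros f)
  then show ?thesis by (simp add: fold_Cons_rev)
qed

lemma ptc_append [ptc_intros]: "ptc f \<Longrightarrow> ptc g \<Longrightarrow> ptc (\<lambda>z. f z @ g z)"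
proof -
  assume f: "ptc f" and g: "ptc g"
  have *: "fold (\<lambda>x acc. x # acc) xs acc = rev xs @ acc" for xs acc :: "'b list"
    by (induction xs arbitrary: acc) auto
  have "sz (fold (\<lambda>x acc. x # acc) (take k (rev (f z))) (g z)) \<le> sz (f z) + sz (g z)" for z k
    using sz_take[of k "rev (f z)"] sz_append[of "rev (take k (rev (f z)))" "g z"] by (simp add: *)
  then have "ptc (\<lambda>z. fold (\<lambda>x acc. x # acc) (rev (f z)) (g z))"
    by (intro ptc_fold[where b = "\<lambda>z. sz (f z) + sz (g z)"] ptc_intros pb_intros f g)
  then show ?thesis by (simp add: *)
qed

lemma ptc_concat [ptc_intros]: "ptc f \<Longrightarrow> ptc (\<lambda>z. concat (f z))"
proof -
  assume f: "ptc f"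
  have *: "fold (\<lambda>x acc. x @ acc) xs acc = concat (rev xs) @ acc" for xs and acc :: "'b list"
    by (induction xs arbitrary: acc) auto
  have **: "sz (fold (\<lambda>x acc. x @ acc) xs acc) \<le> sz xs + sz acc" for xs and acc :: "'b list"
  proof (induction xs arbitrary: acc)
    case (Cons x xs)
    from Cons[of "x @ acc"] show ?case using sz_append[of x acc] by simp
  qed simp
  have "sz (fold (\<lambda>x acc. x @ acc) (take k (rev (f z))) []) \<le> sz (f z) + 1" for z k
    using sz_take[of k "rev (f z)"] **[of "take k (rev (f z))" "[]"] by simp
  then have "ptc (\<lambda>z. fold (\<lambda>x acc. x @ acc) (rev (f z)) [])"
    by (intro ptc_fold[where b = "\<lambda>z. sz (f z) + 1"] ptc_intros pb_intros f)
  then show ?thesis by (simp add: *)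
qed

lemma sz_map_le:
  assumes "\<And>x. x \<in> set xs \<Longrightarrow> sz (f x) \<le> M"
  shows "sz (map f xs) \<le> length xs * (M + 1) + 1"
  using assms
proof (induction xs)
  case (Cons x xs)
  then have "sz (f x) \<le> M" "sz (map f xs) \<le> length xs * (M + 1) + 1" by auto
  then show ?case by simp
qed simp

lemma ptc_map [ptc_intros]:
  assumes h: "ptc (\<lambda>q. h (fst q) (snd q))" and xs: "ptc xs"
  shows "ptc (\<lambda>z. map (h z) (xs z))"
proof -
  have h': "ptc (\<lambda>q. h (fst q) (fst (snd q)))"
    by (rule ptc_comp2[OF h]) (intro ptc_intros)+
  obtain p where p: "\<And>q. sz (h (fst q) (snd q)) \<le> poly p (sz q)"
    using pb_ptc[OF h] unfolding pb_def by blast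
  \<comment> \<open>An element is no larger than its list, so this is one bound for the results on
    all elements.\<close>
  define M where "M z = poly p (sz z + sz (xs z) + 1)" for z
  have *: "fold (\<lambda>x acc. h z x # acc) ys acc = rev (map (h z) ys) @ acc" for ys acc z
    by (induction ys arbitrary: acc) auto
  have "sz (fold (\<lambda>x acc. h z x # acc) (take k (xs z)) []) \<le> sz (xs z) * (M z + 1) + 1" for z k
  proof -
    have "sz (h z x) \<le> M z" if "x \<in> set (take k (xs z))" for x
    proof -
      have "sz (h z x) \<le> poly p (sz (z, x))" using p[of "(z, x)"] by simp
      also have "\<dots> \<le> M z"
        unfolding M_def using sz_member[OF in_set_takeD[OF that]] by (intro poly_nat_mono) simp
      finally show ?thesis .
    qed
    then have "sz (map (h z) (take k (xs z))) \<le> length (take k (xs z)) * (M z + 1) + 1"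
      by (rule sz_map_le)
    also have "\<dots> \<le> sz (xs z) * (M z + 1) + 1"
      using length_le_sz[of "xs z"] by (intro add_mono mult_le_mono) auto
    finally show ?thesis by (simp add: *)
  qed
  then have "ptc (\<lambda>z. fold (\<lambda>x acc. h z x # acc) (xs z) [])"
    by (intro ptc_fold[where b = "\<lambda>z. sz (xs z) * (M z + 1) + 1"] ptc_intros h' xs)
      (unfold M_def, intro pb_intros xs pb_size)
  then have "ptc (\<lambda>z. rev (fold (\<lambda>x acc. h z x # acc) (xs z) []))" by (intro ptc_intros)
  then show ?thesis by (simp add: *)
qed

lemma ptc_filter [ptc_intros]:
  assumes h: "ptc (\<lambda>q. P (fst q) (snd q))" and xs: "ptc xs"
  shows "ptc (\<lambda>z. filter (P z) (xs z))"
proof -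
  have "ptc (\<lambda>z. concat (map (\<lambda>x. if P z x then [x] else []) (xs z)))"
    by (intro ptc_intros assms)
  moreover have "concat (map (\<lambda>x. if P z x then [x] else []) ys) = filter (P z) ys" for z ys
    by (induction ys) auto
  ultimately show ?thesis by simp
qed

text \<open>Removal of duplicates in the form in which \<open>vars\<close> uses it to list the
  variables of a formula.\<close>

lemma ptc_insert_fold [ptc_intros]:
  assumes xs: "ptc xs"
  shows "ptc (\<lambda>z. fold List.insert (xs z) [])"
proof -
  have *: "sz (fold List.insert ys acc) \<le> sz ys + sz acc" for ys acc :: "'b list"
  proof (induction ys arbitrary: acc)
    case (Cons y ys)
    from Cons[of "List.insert y acc"] show ?case by (auto simp: List.insert_def)
  qed simp
  have "sz (fold List.insert (take k (xs z)) []) \<le> sz (xs z) + 1" for z k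
    using *[of "take k (xs z)" "[]"] sz_take[of k "xs z"] by simp
  then show ?thesis
    by (intro ptc_fold[where b = "\<lambda>z. sz (xs z) + 1"] ptc_intros pb_intros assms)
      (unfold List.insert_def, intro ptc_intros)
qed

lemma ptc_product [ptc_intros]:
  assumes "ptc f" "ptc g"
  shows "ptc (\<lambda>z. List.product (f z) (g z))"
proof -
  have "ptc (\<lambda>q. g (fst q))" by (rule ptc_comp[OF ptc_fst[OF ptc_id] assms(2)])
  then show ?thesis unfolding product_concat_map by (intro ptc_intros assms)
qed


subsection \<open>Natural numbers in binary\<close>

instantiation nat :: enc
begin
definition "enc n = enc (binary n)"
instance by standard (simp add: enc_nat_def binary_inject)
end

lemma binary_shift: "binary (2 * n + of_bool b) = (if n = 0 \<and> \<not> b then [] else b # binary n)"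
  by (subst binary.simps) auto

lemma ptc_binary [ptc_intros]: "ptc f \<Longrightarrow> ptc (\<lambda>z. binary (f z))"
  by (rule ptc_recode[of f]) (simp_all add: enc_nat_def)

lemma ptc_natI: "ptc (\<lambda>z. binary (f z)) \<Longrightarrow> ptc f"
  by (rule ptc_recode[of "\<lambda>z. binary (f z)"]) (simp_all add: enc_nat_def)

lemma ptc_shift [ptc_intros]:
  fixes f :: "'a::enc \<Rightarrow> nat"
  assumes "ptc f" "ptc b"
  shows "ptc (\<lambda>z. 2 * f z + of_bool (b z))"
  by (rule ptc_natI, unfold binary_shift) (intro ptc_intros assms)

lemma ptc_odd [ptc_intros]:
  fixes f :: "'a::enc \<Rightarrow> nat"
  assumes "ptc f"
  shows "ptc (\<lambda>z. odd (f z))"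
proof -
  have "ptc (\<lambda>z. binary (f z) \<noteq> [] \<and> hd (binary (f z)))" by (intro ptc_intros assms)
  then show ?thesis by (rule back_subst[of ptc]) (auto simp: binary.simps[of "f _"] fun_eq_iff)
qed

lemma tl_binary: "tl (binary n) = binary (n div 2)"
  by (subst binary.simps) (simp add: binary.simps[of 0])

lemma ptc_div2 [ptc_intros]:
  fixes f :: "'a::enc \<Rightarrow> nat"
  assumes "ptc f"
  shows "ptc (\<lambda>z. f z div 2)"
proof -
  have "ptc (\<lambda>z. tl (binary (f z)))" by (intro ptc_intros assms)
  then show ?thesis unfolding tl_binary by (rule ptc_natI)
qed

lemma less_power_length_binary: "n < 2 ^ length (binary n)"
proof (induction n rule: less_induct)
  case (less n)
  show ?case
  proof (cases "n = 0")
    case False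
    then have "n div 2 < 2 ^ length (binary (n div 2))" by (intro less) simp
    then show ?thesis using False by (subst binary.simps) auto
  qed (simp add: binary.simps)
qed

lemma length_binary_le: "n < 2 ^ k \<Longrightarrow> length (binary n) \<le> k"
proof (induction n arbitrary: k rule: less_induct)
  case (less n)
  show ?case
  proof (cases "n = 0")
    case False
    with less.prems have "k \<noteq> 0" by (intro notI) simp
    then obtain j where k: "k = Suc j" using not0_implies_Suc by blast
    have "length (binary (n div 2)) \<le> j"
    proof (rule less.IH)
      show "n div 2 < n" using False by simp
      show "n div 2 < 2 ^ j" using less.prems unfolding k by simp
    qed
    then show ?thesis using False k by (subst binary.simps) auto
  qed (simp add: binary.simps)
qed

lemma sz_bools: "sz (bs :: bool list) \<le> 4 * length bs + 1"
  by (induction bs) (auto simp: sz_bool)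

lemma sz_nat: "sz (n :: nat) = sz (binary n)"
  by (simp add: sz_def enc_nat_def)

lemma sz_nat_le: "(n :: nat) < 2 ^ k \<Longrightarrow> sz n \<le> 4 * k + 1"
  using sz_bools[of "binary n"] length_binary_le[of n k] by (simp add: sz_nat)

lemma less_power_sz: "(n :: nat) < 2 ^ sz n"
proof -
  have "length (binary n) < sz n" unfolding sz_nat by (rule length_le_sz)
  then have "(2::nat) ^ length (binary n) \<le> 2 ^ sz n" by (intro power_increasing) auto
  with less_power_length_binary[of n] show ?thesis by (rule less_le_trans)
qed

text \<open>Size is not monotone: a bit 1 costs four symbols and a bit 0 only two, so that 8 has a
  shorter code than 7. Hence the factor 4.\<close>

lemma sz_nat_mono:
  fixes m n :: nat
  assumes "m \<le> n"
  shows "sz m \<le> 4 * sz n + 1"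
  using sz_nat_le[of m "sz n"] less_power_sz[of n] assms by simp

lemma sz_le_nat: "sz (n::nat) \<le> 4 * n + 1"
  by (rule sz_nat_le) (rule less_exp)

lemma fold_shift: "fold (\<lambda>b n. 2 * n + of_bool b) bs n = n * 2 ^ length bs + fold (\<lambda>b n. 2 * n + of_bool b) bs 0"
  for n :: nat
proof (induction bs arbitrary: n)
  case (Cons b bs)
  show ?case using Cons[of "2 * n + of_bool b"] Cons[of "of_bool b"] by (simp add: algebra_simps)
qed simp

lemma fold_shift_less: "fold (\<lambda>b n. 2 * n + of_bool b) bs (0::nat) < 2 ^ length bs"
proof (induction bs)
  case (Cons b bs)
  then show ?case by (simp add: fold_shift[of bs "of_bool b"])
qed simp

lemma fold_shift_binary: "fold (\<lambda>b n. 2 * n + of_bool b) (rev (binary n)) (0::nat) = n"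
proof (induction n rule: less_induct)
  case (less n)
  then show ?case by (subst binary.simps) auto
qed

lemma ptc_fold_shift:
  assumes "ptc f"
  shows "ptc (\<lambda>z. fold (\<lambda>b n. 2 * n + of_bool b) (f z) (0::nat))"
proof -
  have "sz (fold (\<lambda>b n. 2 * n + of_bool b) (take k (f z)) (0::nat)) \<le> 4 * sz (f z) + 1" for z k
  proof (rule sz_nat_le)
    have "(2::nat) ^ length (take k (f z)) \<le> 2 ^ sz (f z)"
      using length_le_sz[of "f z"] by (intro power_increasing) auto
    with fold_shift_less[of "take k (f z)"]
    show "fold (\<lambda>b n. 2 * n + of_bool b) (take k (f z)) (0::nat) < 2 ^ sz (f z)"
      by (rule less_le_trans)
  qed
  then show ?thesis
    by (intro ptc_fold[where b = "\<lambda>z. 4 * sz (f z) + 1"] ptc_intros pb_intros assms)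
qed

text \<open>A state of the adder: what is left of the summands, the carry, and the sum bits so far.\<close>

definition add_step :: "bool \<Rightarrow> nat \<times> nat \<times> bool \<times> bool list \<Rightarrow> nat \<times> nat \<times> bool \<times> bool list" where
  "add_step _ s = (fst s div 2, fst (snd s) div 2,
     (odd (fst s) \<and> odd (fst (snd s)) \<or> fst (snd (snd s)) \<and> (odd (fst s) \<or> odd (fst (snd s)))),
     (odd (fst s) = (odd (fst (snd s)) = fst (snd (snd s)))) # snd (snd (snd s)))"

text \<open>Invariant of schoolbook addition: the collected bits, plus the remaining summands and
  the carry shifted by the number of these bits, always represent the same value. The bits are
  collected with the most significant one in front.\<close>

lemma fold_add_step:
  fixes x y x' y' :: nat
  assumes "fold add_step us (x, y, c, bs) = (x', y', c', bs')"
  shows "x' = x div 2 ^ length us \<and> y' = y div 2 ^ length us \<and> length bs' = length us + length bs \<and>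
    fold (\<lambda>b n. 2 * n + of_bool b) bs' 0 + 2 ^ length bs' * (x' + y' + of_bool c') =
    fold (\<lambda>b n. 2 * n + of_bool b) bs 0 + 2 ^ length bs * (x + y + of_bool c)"
  using assms
proof (induction us arbitrary: x y c bs)
  case (Cons u us)
  define b where "b \<longleftrightarrow> (odd x = (odd y = c))"
  define d where "d \<longleftrightarrow> (odd x \<and> odd y \<or> c \<and> (odd x \<or> odd y))"
  have "fold add_step us (x div 2, y div 2, d, b # bs) = (x', y', c', bs')"
    using Cons.prems by (simp add: add_step_def[of u "(x, y, c, bs)"] b_def d_def)
  from Cons.IH[OF this] have *: "x' = x div 2 div 2 ^ length us" "y' = y div 2 div 2 ^ length us"
    "length bs' = length us + length (b # bs)"
    "fold (\<lambda>b n. 2 * n + of_bool b) bs' 0 + 2 ^ length bs' * (x' + y' + of_bool c') =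
    fold (\<lambda>b n. 2 * n + of_bool b) (b # bs) 0 + 2 ^ length (b # bs) * (x div 2 + y div 2 + of_bool d)"
    by auto
  have "of_bool b + 2 * (x div 2 + y div 2 + of_bool d) = x + y + of_bool c"
    by (cases "odd x"; cases "odd y"; cases c) (auto simp: b_def d_def elim!: oddE)
  then have "2 ^ length bs * (of_bool b + 2 * (x div 2 + y div 2 + of_bool d)) = 2 ^ length bs * (x + y + of_bool c)"
    by simp
  then have "fold (\<lambda>b n. 2 * n + of_bool b) (b # bs) 0 + 2 ^ length (b # bs) * (x div 2 + y div 2 + of_bool d) =
     fold (\<lambda>b n. 2 * n + of_bool b) bs 0 + 2 ^ length bs * (x + y + of_bool c)"
    using fold_shift[of bs "of_bool b"] by (simp add: algebra_simps)
  with * show ?case by (simp add: div_mult2_eq)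
qed simp

lemma sz_fold_add_step: "sz (fold add_step us (x, y, c, bs)) \<le> 4 * sz x + 4 * sz y + 4 * length us + sz bs + 8"
proof -
  have bits: "sz (snd (snd (snd (fold add_step us s)))) \<le> 4 * length us + sz (snd (snd (snd s)))" for s
  proof (induction us arbitrary: s)
    case (Cons u us)
    have "sz (snd (snd (snd (add_step u s)))) \<le> sz (snd (snd (snd s))) + 4"
      by (simp add: add_step_def sz_bool)
    with Cons[of "add_step u s"] show ?case by simp
  qed simp
  obtain x' y' c' bs' where *: "fold add_step us (x, y, c, bs) = (x', y', c', bs')" by (metis surj_pair)
  have "sz bs' \<le> 4 * length us + sz bs" using bits[of "(x, y, c, bs)"] by (simp add: *)
  then show ?thesis
    using fold_add_step[OF *] sz_nat_mono[of x' x] sz_nat_mono[of y' y]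
    by (simp add: * sz_bool)
qed

lemma power_binary_div: "x div 2 ^ length (binary x @ us) = 0" "y div 2 ^ length (us @ binary y) = 0"
proof -
  have "x < 2 ^ length (binary x @ us)"
    using less_power_length_binary[of x] by (auto simp: power_add intro: less_le_trans)
  then show "x div 2 ^ length (binary x @ us) = 0" by simp
  have "y < 2 ^ length (us @ binary y)"
    using less_power_length_binary[of y] by (auto simp: power_add intro: less_le_trans)
  then show "y div 2 ^ length (us @ binary y) = 0" by simp
qed

lemma ptc_add [ptc_intros]:
  fixes f g :: "'a::enc \<Rightarrow> nat"
  assumes "ptc f" "ptc g"
  shows "ptc (\<lambda>z. f z + g z)"
proof -
  \<comment> \<open>Only the length of this list matters: it is at least the number of bits of
    either summand, so both are used up in the end.\<close>
  let ?fuel = "\<lambda>z. binary (f z) @ binary (g z)"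
  let ?s = "\<lambda>z. fold add_step (?fuel z) (f z, g z, False, [])"
  have "sz (fold add_step (take k (?fuel z)) (f z, g z, False, [])) \<le> 8 * sz (f z) + 8 * sz (g z) + 9" for z k
    using sz_fold_add_step[of "take k (?fuel z)" "f z" "g z" False "[]"]
      length_le_sz[of "binary (f z)"] length_le_sz[of "binary (g z)"] by (simp add: sz_nat)
  then have "ptc ?s"
    by (intro ptc_fold[where b = "\<lambda>z. 8 * sz (f z) + 8 * sz (g z) + 9"] ptc_intros pb_intros assms)
      (unfold add_step_def, intro ptc_intros)
  then have "ptc (\<lambda>z. fold (\<lambda>b n. 2 * n + of_bool b) (fst (snd (snd (?s z))) # snd (snd (snd (?s z)))) (0::nat))"
    by (intro ptc_fold_shift ptc_intros)
  moreover have "fold (\<lambda>b n. 2 * n + of_bool b) (fst (snd (snd (?s z))) # snd (snd (snd (?s z)))) 0 = f z + g z" for z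
  proof -
    obtain x' y' c' bs' where *: "?s z = (x', y', c', bs')" by (metis surj_pair)
    have "x' = 0" "y' = 0"
      using fold_add_step[OF *] power_binary_div(1)[of "f z" "binary (g z)"] power_binary_div(2)[of "g z" "binary (f z)"]
      by simp_all
    then have "fold (\<lambda>b n. 2 * n + of_bool b) bs' 0 + 2 ^ length bs' * of_bool c' = f z + g z"
      using fold_add_step[OF *] by (cases c') auto
    then show ?thesis unfolding * using fold_shift[of bs' "of_bool c'"] by (simp add: mult.commute)
  qed
  ultimately show ?thesis by simp
qed

lemma ptc_Suc [ptc_intros]: "ptc f \<Longrightarrow> ptc (\<lambda>z. Suc (f z))"
  using ptc_add[OF _ ptc_const, of f 1] by simp

text \<open>Horner's scheme over the bits of one factor; the start value \<open>m * y\<close> makes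
  the statement inductive.\<close>

lemma fold_mult: "fold (\<lambda>b n. 2 * n + (if b then y else 0)) bs (m * y) = fold (\<lambda>b n. 2 * n + of_bool b) bs m * (y :: nat)"
proof (induction bs arbitrary: m)
  case (Cons b bs)
  show ?case using Cons[of "2 * m + of_bool b"] by (cases b) (simp_all add: algebra_simps)
qed simp

lemma ptc_mult [ptc_intros]:
  fixes f g :: "'a::enc \<Rightarrow> nat"
  assumes "ptc f" "ptc g"
  shows "ptc (\<lambda>z. f z * g z)"
proof -
  have g: "ptc (\<lambda>q. g (fst q))" by (rule ptc_comp[OF ptc_fst[OF ptc_id] assms(2)])
  have "ptc (\<lambda>q :: 'a \<times> bool \<times> nat. 2 * snd (snd q) + of_bool False)" by (intro ptc_intros)
  then have "ptc (\<lambda>q :: 'a \<times> bool \<times> nat. 2 * snd (snd q))" by simp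
  then have step: "ptc (\<lambda>q. 2 * snd (snd q) + (if fst (snd q) then g (fst q) else 0))"
    by (intro ptc_add ptc_intros g)
  have "sz (fold (\<lambda>b n. 2 * n + (if b then g z else 0)) (take k (rev (binary (f z)))) 0) \<le> 4 * (sz (f z) + sz (g z)) + 1" for z k
  proof (rule sz_nat_le)
    let ?bs = "take k (rev (binary (f z)))"
    have "length ?bs \<le> sz (f z)" using length_le_sz[of "binary (f z)"] by (simp add: sz_nat)
    then have "(2::nat) ^ length ?bs \<le> 2 ^ sz (f z)" by (intro power_increasing) auto
    with fold_shift_less[of ?bs] have "fold (\<lambda>b n. 2 * n + of_bool b) ?bs (0::nat) < 2 ^ sz (f z)"
      by (rule less_le_trans)
    then have "fold (\<lambda>b n. 2 * n + of_bool b) ?bs 0 * g z < 2 ^ sz (f z) * 2 ^ sz (g z)"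
      using less_power_sz[of "g z"] by (intro mult_strict_mono) auto
    then show "fold (\<lambda>b n. 2 * n + (if b then g z else 0)) ?bs 0 < 2 ^ (sz (f z) + sz (g z))"
      using fold_mult[of "g z" ?bs 0] by (simp add: power_add)
  qed
  then have "ptc (\<lambda>z. fold (\<lambda>b n. 2 * n + (if b then g z else 0)) (rev (binary (f z))) 0)"
    by (intro ptc_fold[where b = "\<lambda>z. 4 * (sz (f z) + sz (g z)) + 1"] step ptc_intros pb_intros assms)
  moreover have "fold (\<lambda>b n. 2 * n + (if b then g z else 0)) (rev (binary (f z))) 0 = f z * g z" for z
    using fold_mult[of "g z" "rev (binary (f z))" 0] by (simp add: fold_shift_binary)
  ultimately show ?thesis by simp
qed

text \<open>Bits are compared from the least significant one on, so a later difference overrides all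
  earlier ones. Starting with \<open>True\<close> makes equal numbers comparable as
  \<open>\<le>\<close>.\<close>

definition le_step :: "bool \<Rightarrow> nat \<times> nat \<times> bool \<Rightarrow> nat \<times> nat \<times> bool" where
  "le_step _ s = (fst s div 2, fst (snd s) div 2,
     if odd (fst s) = odd (fst (snd s)) then snd (snd s) else odd (fst (snd s)))"

lemma fold_le_step:
  assumes "fold le_step us (x, y, r) = (x', y', r')"
  shows "x' = x div 2 ^ length us \<and> y' = y div 2 ^ length us \<and>
    (x' < y' \<or> x' = y' \<and> r' \<longleftrightarrow> x < y \<or> x = y \<and> r)"
  using assms
proof (induction us arbitrary: x y r)
  case (Cons u us)
  define d where "d = (if odd x = odd y then r else odd y)"
  have "le_step u (x, y, r) = (x div 2, y div 2, d)" by (simp add: le_step_def d_def)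
  with Cons.prems have "fold le_step us (x div 2, y div 2, d) = (x', y', r')" by simp
  from Cons.IH[OF this] have *: "x' = x div 2 div 2 ^ length us" "y' = y div 2 div 2 ^ length us"
    "x' < y' \<or> x' = y' \<and> r' \<longleftrightarrow> x div 2 < y div 2 \<or> x div 2 = y div 2 \<and> d" by auto
  have "x div 2 < y div 2 \<or> x div 2 = y div 2 \<and> d \<longleftrightarrow> x < y \<or> x = y \<and> r"
    unfolding d_def by (cases "odd x"; cases "odd y"; cases r; simp; presburger)
  with * show ?case by (simp add: div_mult2_eq)
qed simp

lemma ptc_le [ptc_intros]:
  fixes f g :: "'a::enc \<Rightarrow> nat"
  assumes "ptc f" "ptc g"
  shows "ptc (\<lambda>z. f z \<le> g z)"
proof -
  let ?fuel = "\<lambda>z. binary (f z) @ binary (g z)"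
  let ?s = "\<lambda>z. fold le_step (?fuel z) (f z, g z, True)"
  have "sz (fold le_step (take k (?fuel z)) (f z, g z, True)) \<le> 4 * sz (f z) + 4 * sz (g z) + 7" for z k
  proof -
    obtain x' y' c' where *: "fold le_step (take k (?fuel z)) (f z, g z, True) = (x', y', c')" by (metis surj_pair)
    show ?thesis
      unfolding * using fold_le_step[OF *] sz_nat_mono[of x' "f z"] sz_nat_mono[of y' "g z"] by (simp add: sz_bool)
  qed
  then have "ptc ?s"
    by (intro ptc_fold[where b = "\<lambda>z. 4 * sz (f z) + 4 * sz (g z) + 7"] ptc_intros pb_intros assms)
      (unfold le_step_def, intro ptc_intros)
  then have "ptc (\<lambda>z. snd (snd (?s z)))" by (intro ptc_intros)
  moreover have "snd (snd (?s z)) \<longleftrightarrow> f z \<le> g z" for z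
  proof -
    obtain x' y' c' where *: "?s z = (x', y', c')" by (metis surj_pair)
    have "x' = 0" "y' = 0"
      using fold_le_step[OF *] power_binary_div(1)[of "f z" "binary (g z)"] power_binary_div(2)[of "g z" "binary (f z)"]
      by simp_all
    then show ?thesis unfolding * using fold_le_step[OF *] by auto
  qed
  ultimately show ?thesis by simp
qed

lemma ptc_less [ptc_intros]:
  fixes f g :: "'a::enc \<Rightarrow> nat"
  assumes "ptc f" "ptc g"
  shows "ptc (\<lambda>z. f z < g z)"
proof -
  have "ptc (\<lambda>z. Suc (f z) \<le> g z)" by (intro ptc_intros assms)
  then show ?thesis by (simp add: Suc_le_eq)
qed

lemma ptc_length [ptc_intros]:
  assumes "ptc f"
  shows "ptc (\<lambda>z. length (f z))"
proof -
  have *: "fold (\<lambda>_. Suc) xs n = length xs + n" for xs :: "'b list" and n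
    by (induction xs arbitrary: n) auto
  have "sz (fold (\<lambda>_. Suc) (take k (f z)) 0) \<le> 4 * sz (f z) + 1" for z k
    using sz_le_nat[of "min (length (f z)) k"] length_le_sz[of "f z"] by (simp add: *)
  then have "ptc (\<lambda>z. fold (\<lambda>_. Suc) (f z) 0)"
    by (intro ptc_fold[where b = "\<lambda>z. 4 * sz (f z) + 1"] ptc_intros pb_intros assms)
  then show ?thesis by (simp add: *)
qed

lemma ptc_enumerate [ptc_intros]:
  assumes "ptc f"
  shows "ptc (\<lambda>z. List.enumerate 0 (f z))"
proof -
  have *: "fold (\<lambda>x acc. acc @ [(length acc, x)]) xs acc = acc @ List.enumerate (length acc) xs" for xs and acc :: "(nat \<times> 'b) list"
    by (induction xs arbitrary: acc) auto
  have "sz (List.enumerate n xs) \<le> sz xs + length xs * (4 * (n + length xs) + 2)" for n and xs :: "'b list"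
  proof (induction xs arbitrary: n)
    case (Cons x xs)
    from Cons[of "Suc n"] sz_le_nat[of n] show ?case by (simp add: algebra_simps)
  qed simp
  note sz_enum = this
  have "sz (fold (\<lambda>x acc. acc @ [(length acc, x)]) (take k (f z)) []) \<le> sz (f z) + sz (f z) * (4 * sz (f z) + 2)" for z k
  proof -
    have "sz (List.enumerate 0 (take k (f z))) \<le> sz (take k (f z)) + length (take k (f z)) * (4 * (0 + length (take k (f z))) + 2)"
      by (rule sz_enum)
    also have "\<dots> \<le> sz (f z) + sz (f z) * (4 * sz (f z) + 2)"
      using length_le_sz[of "f z"] by (intro add_mono mult_le_mono sz_take) auto
    finally show ?thesis by (simp add: *)
  qed
  then have "ptc (\<lambda>z. fold (\<lambda>x acc. acc @ [(length acc, x)]) (f z) [])"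
    by (intro ptc_fold[where b = "\<lambda>z. sz (f z) + sz (f z) * (4 * sz (f z) + 2)"] ptc_intros pb_intros assms)
  then show ?thesis by (simp add: *)
qed

lemma ptc_upt [ptc_intros]:
  assumes "ptc f"
  shows "ptc (\<lambda>z. [0..<length (f z)])"
proof -
  have "ptc (\<lambda>z. map fst (List.enumerate 0 (f z)))" by (intro ptc_intros assms)
  then show ?thesis by simp
qed

text \<open>The default makes the value known for every index; beyond the end of the list,
  \<open>xs ! i\<close> may be any function of the index, and no program for it is at hand.\<close>

definition nth_or :: "'a \<Rightarrow> 'a list \<Rightarrow> nat \<Rightarrow> 'a" where
  "nth_or d xs i = (if i < length xs then xs ! i else d)"

lemma ptc_nth_or [ptc_intros]:
  assumes "ptc f" "ptc xs" "ptc i"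
  shows "ptc (\<lambda>z. nth_or (f z) (xs z) (i z))"
proof -
  have i: "ptc (\<lambda>q. i (fst q))" by (rule ptc_comp[OF ptc_fst[OF ptc_id] assms(3)])
  have "ptc (\<lambda>z. hd (map snd (filter (\<lambda>p. fst p = i z) (List.enumerate 0 (xs z))) @ [f z]))"
    by (intro ptc_intros assms i)
  moreover have "filter (\<lambda>p. fst p = i) (List.enumerate n ys) = (if n \<le> i \<and> i < n + length ys then [(i, ys ! (i - n))] else [])"
    for i n and ys :: "'b list"
    by (induction ys arbitrary: n) (auto simp: nth_Cons' Suc_diff_Suc)
  ultimately show ?thesis by (elim back_subst[of ptc]) (auto simp: nth_or_def)
qed


section \<open>From polynomial-time functions to Turing machines\<close>

declare split_paired_All [simp del] split_paired_Ex [simp del]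

text \<open>
  State 0 walks to the right end of the input; if \<open>g\<close> holds it may add 2 to each input symbol,
  which guesses one bit per input bit.
\<close>

definition walk :: instr where
  "walk r = (if r ! 0 \<in> {1, 2} then (0, r, (replicate 7 Stay)[0 := Go_Right]) else (1, r, replicate 7 Stay))"

text \<open>The last instruction turns the topmost symbol of the main stack into a verdict: 2, as in
  the code of \<open>True\<close>, leads to the accepting state, anything else to the state after
  it.\<close>

definition program :: "cmd \<Rightarrow> instr list" where
  "program c = walk # assemble c 1 @
     [goto (\<lambda>r. if r ! 2 = 2 then csize c + 2 else csize c + 3)]"

text \<open>The head moves on after marking a cell and does not return in state 0, so each cell is
  guessed once.\<close>

definition guess_delta :: "(nat \<times> nat list \<times> nat \<times> nat list \<times> move list) set" where
  "guess_delta = {(0, r, 0, r[0 := r ! 0 + 2], (replicate 7 Stay)[0 := Go_Right]) | r.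
     valid_word r \<and> r ! 0 \<in> {1, 2}}"

definition machine :: "bool \<Rightarrow> cmd \<Rightarrow> tm" where
  "machine g c = \<lparr>num_tapes = 7, start_state = 0, accept_state = csize c + 2,
     delta = (\<lambda>(s, r). (s, r, (program c ! s) r)) ` ({..<csize c + 2} \<times> Collect valid_word) \<union>
       (if g then guess_delta else {})\<rparr>"

lemma machine_simps [simp]:
  "num_tapes (machine g c) = 7" "start_state (machine g c) = 0" "accept_state (machine g c) = csize c + 2"
  by (simp_all add: machine_def)

lemma length_program [simp]: "length (program c) = csize c + 2"
  by (simp add: program_def)

lemma in_delta_machine:
  "(s, r, a) \<in> delta (machine g c) \<longleftrightarrow>
     valid_word r \<and> (s < csize c + 2 \<and> a = (program c ! s) r \<or>
       g \<and> s = 0 \<and> r ! 0 \<in> {1, 2} \<and> a = (0, r[0 := r ! 0 + 2], (replicate 7 Stay)[0 := Go_Right]))"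
  by (auto simp: machine_def guess_delta_def)

lemma finite_valid_word: "finite (Collect valid_word)"
  unfolding valid_word_def using finite_lists_length_eq[of "{..<5::nat}" 7]
  by (simp add: conj_commute)

lemma wf_instr: "F \<in> set (assemble c s) \<Longrightarrow> length r = 7 \<Longrightarrow> F r = (q, w, m) \<Longrightarrow> length w = 7 \<and> length m = 7"
  by (induction c arbitrary: s) (auto simp: goto_def)

lemma wf_program: "F \<in> set (program c) \<Longrightarrow> length r = 7 \<Longrightarrow> F r = (q, w, m) \<Longrightarrow> length w = 7 \<and> length m = 7"
  using wf_instr[of F c 1 r q w m] by (auto simp: program_def walk_def goto_def split: if_splits)

lemma wf_machine: "wf_tm (machine g c)"
  unfolding wf_tm_def
proof (intro conjI ballI)
  have "finite guess_delta"
  proof (rule finite_subset)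
    show "guess_delta \<subseteq> (\<lambda>r. (0, r, 0, r[0 := r ! 0 + 2], (replicate 7 Stay)[0 := Go_Right])) ` Collect valid_word"
      by (auto simp: guess_delta_def)
  qed (simp add: finite_valid_word)
  then show "finite (delta (machine g c))" by (simp add: machine_def finite_valid_word)
next
  fix t assume "t \<in> delta (machine g c)"
  then obtain s r q w m where t: "t = (s, r, q, w, m)" "(s, r, q, w, m) \<in> delta (machine g c)"
    by (metis surj_pair)
  have "length r = 7" using t(2) by (auto simp: in_delta_machine valid_word_def)
  moreover have "length w = 7 \<and> length m = 7"
    using t(2) \<open>length r = 7\<close> wf_program[of "program c ! s" c r q w m] by (auto simp: in_delta_machine)
  ultimately show "case t of (q, r, q', w, m) \<Rightarrow>
      length r = num_tapes (machine g c) \<and> length w = num_tapes (machine g c) \<and> length m = num_tapes (machine g c)"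
    by (simp add: t(1))
qed simp

lemma deterministic_machine: "deterministic (machine False c)"
  unfolding deterministic_def by (auto simp: in_delta_machine)

lemma tm_step_iff:
  "tm_step M (q, ts) d \<longleftrightarrow> (\<exists>q' w m. (q, map read_tape ts, q', w, m) \<in> delta M \<and> d = (q', map2 act (zip w m) ts))"
  using tm_stepD by (blast intro: tm_step.intros)

lemma halting_machine: "csize c + 2 \<le> q \<Longrightarrow> halting (machine g c) (q, ts)"
  by (simp add: halting_def tm_step_iff in_delta_machine)

lemma hosts_machine:
  "hosts (machine g c) 1 (assemble c 1)"
  "hosts (machine g c) (csize c + 1) [goto (\<lambda>r. if r ! 2 = 2 then csize c + 2 else csize c + 3)]"
  by (auto simp: hosts_def in_delta_machine program_def nth_append)

lemma nth_read: "j < 7 \<Longrightarrow> map read_tape (map st [0..<7]) ! j = read_tape (st j)"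
  by simp

lemma ex_transition:
  "(\<exists>q w m. ((q, w, m) = (q1, w1, m1) \<or> P \<and> (q, w, m) = (q2, w2, m2)) \<and> d = (q, h w m)) \<longleftrightarrow>
     d = (q1, h w1 m1) \<or> P \<and> d = (q2, h w2 m2)"
  by auto

lemma tm_step_walk:
  assumes "tapes_ok st"
  shows "tm_step (machine g c) (conf 0 st) d \<longleftrightarrow>
    (if read_tape (st 0) \<in> {1, 2}
     then d = conf 0 (st(0 := act (read_tape (st 0), Go_Right) (st 0))) \<or>
       g \<and> d = conf 0 (st(0 := act (read_tape (st 0) + 2, Go_Right) (st 0)))
     else d = conf 1 st)"
proof -
  let ?r = "map read_tape (map st [0..<7])"
  have r0: "?r ! 0 = read_tape (st 0)" by (rule nth_read) simp
  have upd: "map2 act (zip (?r[0 := a]) ((replicate 7 Stay)[0 := Go_Right])) (map st [0..<7]) =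
    map (st(0 := act (a, Go_Right) (st 0))) [0..<7]" for a by (rule map2_act_upd) simp
  have upd0: "map2 act (zip ?r ((replicate 7 Stay)[0 := Go_Right])) (map st [0..<7]) =
    map (st(0 := act (read_tape (st 0), Go_Right) (st 0))) [0..<7]"
    using upd[of "read_tape (st 0)"] unfolding r0[symmetric] list_update_id .
  have "tm_step (machine g c) (conf 0 st) d \<longleftrightarrow> (\<exists>q' w m. ((q', w, m) = walk ?r \<or>
     (g \<and> ?r ! 0 \<in> {1, 2}) \<and> (q', w, m) = (0, ?r[0 := ?r ! 0 + 2], (replicate 7 Stay)[0 := Go_Right])) \<and>
     d = (q', map2 act (zip w m) (map st [0..<7])))"
    unfolding conf_def tm_step_iff in_delta_machine using valid_word_read[OF assms]
    by (simp add: program_def)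
  also have "\<dots> \<longleftrightarrow> (if read_tape (st 0) \<in> {1, 2}
     then d = conf 0 (st(0 := act (read_tape (st 0), Go_Right) (st 0))) \<or>
       g \<and> d = conf 0 (st(0 := act (read_tape (st 0) + 2, Go_Right) (st 0)))
     else d = conf 1 st)"
  proof (cases "read_tape (st 0) \<in> {1, 2}")
    case True
    then have w: "walk ?r = (0, ?r, (replicate 7 Stay)[0 := Go_Right])" unfolding walk_def r0 by (rule if_P)
    show ?thesis unfolding w r0 if_P[OF True] conf_def ex_transition upd upd0 using True by blast
  next
    case False
    then have w: "walk ?r = (1, ?r, replicate 7 Stay)" unfolding walk_def r0 by (rule if_not_P)
    show ?thesis unfolding w r0 if_not_P[OF False] conf_def ex_transition map2_act_Stay using False by blast
  qed
  finally show ?thesis .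
qed

text \<open>An input bit with the bit guessed for it. An unmarked cell carries the guess
  \<open>False\<close>, so the original input is itself one of the guesses.\<close>

definition sym_of :: "bool \<times> bool \<Rightarrow> nat" where
  "sym_of p = (if fst p then 2 else 1) + (if snd p then 2 else 0)"

definition in_tape :: "(bool \<times> bool) list \<Rightarrow> int \<Rightarrow> nat" where
  "in_tape w i = (if 0 \<le> i \<and> i < int (length w) then sym_of (w ! nat i) else 0)"

definition env0 :: "(bool \<times> bool) list \<Rightarrow> int \<Rightarrow> nat \<Rightarrow> tape" where
  "env0 w h j = (if j = 0 then (in_tape w, h) else (\<lambda>_. 0, 0))"

definition plain :: "bool list \<Rightarrow> (bool \<times> bool) list" where
  "plain x = map (\<lambda>b. (b, False)) x"

lemma plain_simps [simp]: "plain [] = []" "plain (b # x) = (b, False) # plain x" "length (plain x) = length x"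
  "map fst (plain x) = x"
  by (simp_all add: plain_def comp_def)

text \<open>\<open>u\<close> is the part already passed, with its guesses; the head stands at the
  first cell of the rest \<open>v\<close>.\<close>

definition walking :: "(bool \<times> bool) list \<Rightarrow> bool list \<Rightarrow> config" where
  "walking u v = conf 0 (main (env0 (u @ plain v) (int (length u))) [])"

definition walked :: "(bool \<times> bool) list \<Rightarrow> config" where
  "walked w = conf 1 (main (env0 w (int (length w))) [])"

lemma tape_of_in_tape: "tape_of x = in_tape (plain x)"
  by (auto simp: tape_of_def in_tape_def sym_of_def plain_def fun_eq_iff)

lemma stk_Nil: "stk [] = (\<lambda>_. 0, 0)"
  by (auto simp: stk_def)

lemma initial_machine: "initial (machine g c) x = walking [] x"
proof -
  have "map (main (env0 (plain x) 0) []) [0..<7] = (in_tape (plain x), 0) # replicate 6 (\<lambda>_. 0, 0)"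
    by (rule nth_equalityI) (auto simp: stacks_def env0_def stk_Nil S4_def nth_Cons')
  then show ?thesis by (simp add: initial_def walking_def conf_def tape_of_in_tape)
qed

lemma sym_of_less: "sym_of p < 5"
  by (simp add: sym_of_def)

lemma tapes_ok_main:
  assumes "\<And>j i. fst (e j) i < 5" "set xs \<subseteq> {1, 2}"
  shows "tapes_ok (main e xs)"
proof -
  have "xs ! k < 5" if "k < length xs" for k
    using assms(2) nth_mem[OF that] by auto
  then show ?thesis using assms(1) by (auto simp: tapes_ok_def stacks_def stk_def S4_def)
qed

lemma tapes_ok_env0: "tapes_ok (main (env0 w h) [])"
  by (rule tapes_ok_main) (auto simp: env0_def in_tape_def sym_of_less)

lemma in_tape_upd: "(in_tape (u @ p # v))(int (length u) := sym_of q) = in_tape (u @ q # v)"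
proof
  fix i
  show "((in_tape (u @ p # v))(int (length u) := sym_of q)) i = in_tape (u @ q # v) i"
  proof (cases "i = int (length u)")
    case False
    then have "nat i \<noteq> length u" if "0 \<le> i" using that by auto
    with False show ?thesis by (auto simp: in_tape_def nth_append nth_Cons')
  qed (simp add: in_tape_def)
qed

lemma step_walking_Cons:
  "tm_step (machine g c) (walking u (b # v)) d \<longleftrightarrow> (\<exists>y. (y \<longrightarrow> g) \<and> d = walking (u @ [(b, y)]) v)"
proof -
  let ?st = "main (env0 (u @ plain (b # v)) (int (length u))) []"
  have 0: "?st 0 = (in_tape (u @ (b, False) # plain v), int (length u))"
    by (simp add: stacks_def env0_def)
  have r: "read_tape (?st 0) = sym_of (b, False)" unfolding 0 by (simp add: in_tape_def)
  have eq: "?st(0 := act (sym_of (b, y), Go_Right) (?st 0)) = main (env0 ((u @ [(b, y)]) @ plain v) (int (length (u @ [(b, y)])))) []" for y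
    using in_tape_upd[of u "(b, False)" "plain v" "(b, y)"]
    by (auto simp: 0 stacks_def env0_def fun_eq_iff)
  have sym: "sym_of (b, False) \<in> {1, 2}" "sym_of (b, False) + 2 = sym_of (b, True)"
    by (auto simp: sym_of_def)
  show ?thesis unfolding walking_def tm_step_walk[OF tapes_ok_env0] r if_P[OF sym(1)] sym(2) eq
    by (metis (full_types))
qed

lemma step_walking_Nil: "tm_step (machine g c) (walking u []) d \<longleftrightarrow> d = walked u"
proof -
  have "read_tape (main (env0 (u @ plain []) (int (length u))) [] 0) = 0"
    by (simp add: stacks_def env0_def in_tape_def)
  then show ?thesis unfolding walking_def tm_step_walk[OF tapes_ok_env0] by (simp add: walked_def)
qed


subsection \<open>Runs\<close>

text \<open>Every run has to be short, including those with useless guesses, since \<open>NP\<close>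
  is defined by a bound on all runs.\<close>

definition bounded_runs :: "tm \<Rightarrow> config \<Rightarrow> nat \<Rightarrow> bool" where
  "bounded_runs M c n \<longleftrightarrow> (\<forall>k d. (tm_step M ^^ k) c d \<longrightarrow> k \<le> n)"

definition accepting :: "tm \<Rightarrow> config \<Rightarrow> bool" where
  "accepting M c \<longleftrightarrow> (\<exists>d. (tm_step M)\<^sup>*\<^sup>* c d \<and> halting M d \<and> fst d = accept_state M)"

lemma bounded_runs_Suc:
  assumes "\<And>d. tm_step M c d \<Longrightarrow> bounded_runs M d n"
  shows "bounded_runs M c (Suc n)"
  unfolding bounded_runs_def
proof (intro allI impI)
  fix k d assume k: "(tm_step M ^^ k) c d"
  show "k \<le> Suc n"
  proof (cases k)
    case (Suc j)
    with k obtain c' where "tm_step M c c'" "(tm_step M ^^ j) c' d" by (metis relpowp_Suc_E2)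
    then have "j \<le> n" using assms unfolding bounded_runs_def by blast
    with Suc show ?thesis by simp
  qed simp
qed

lemma bounded_runs_halting: "halting M c \<Longrightarrow> bounded_runs M c 0"
  unfolding bounded_runs_def halting_def by (metis le0 not_gr0 relpowp_Suc_E2 gr0_conv_Suc)

lemma bounded_runs_mono: "bounded_runs M c m \<Longrightarrow> m \<le> n \<Longrightarrow> bounded_runs M c n"
  unfolding bounded_runs_def using le_trans by blast

lemma accepting_step:
  assumes "\<not> halting M c"
  shows "accepting M c \<longleftrightarrow> (\<exists>d. tm_step M c d \<and> accepting M d)"
proof
  assume "accepting M c"
  then obtain d where d: "(tm_step M)\<^sup>*\<^sup>* c d" "halting M d" "fst d = accept_state M"
    by (auto simp: accepting_def)
  from d(1) show "\<exists>d. tm_step M c d \<and> accepting M d"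
  proof (cases rule: converse_rtranclpE)
    case base
    with d(2) assms show ?thesis by simp
  next
    case (step c')
    with d show ?thesis unfolding accepting_def by blast
  qed
next
  assume "\<exists>d. tm_step M c d \<and> accepting M d"
  then show "accepting M c"
    unfolding accepting_def by (blast intro: converse_rtranclp_into_rtranclp)
qed

lemma accepting_halting: "halting M c \<Longrightarrow> accepting M c \<longleftrightarrow> fst c = accept_state M"
  unfolding accepting_def halting_def by (metis converse_rtranclpE rtranclp.rtrancl_refl)

lemma dstep_bounded_runs:
  assumes "(dstep M ^^ n) c d" "halting M d"
  shows "bounded_runs M c n"
  using assms(1)
proof (induction n arbitrary: c)
  case 0
  then show ?case using assms(2) bounded_runs_halting by simp
next
  case (Suc n)
  from Suc.prems obtain c' where c': "dstep M c c'" "(dstep M ^^ n) c' d" by (metis relpowp_Suc_E2)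
  show ?case
  proof (rule bounded_runs_Suc)
    fix e assume "tm_step M c e"
    then have "e = c'" using c'(1) unfolding dstep_def by blast
    then show "bounded_runs M e n" using Suc.IH[OF c'(2)] by simp
  qed
qed

lemma dstep_accepting:
  assumes "(dstep M ^^ n) c d"
  shows "accepting M c \<longleftrightarrow> accepting M d"
  using assms
proof (induction n arbitrary: c)
  case (Suc n)
  from Suc.prems obtain c' where c': "dstep M c c'" "(dstep M ^^ n) c' d" by (metis relpowp_Suc_E2)
  then have *: "tm_step M c e \<longleftrightarrow> e = c'" for e unfolding dstep_def by blast
  then have "\<not> halting M c" unfolding halting_def by blast
  from accepting_step[OF this] show ?case unfolding * using Suc.IH[OF c'(2)] by simp
qed simp

lemma dstep_relpowp: "(dstep M ^^ n) c d \<Longrightarrow> (tm_step M ^^ n) c d"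
  by (rule relpowp_mono) (auto simp: dstep_def)

lemma bounded_runs_walking:
  assumes "\<And>w. length w = length u + length v \<Longrightarrow> bounded_runs (machine g c) (walked w) n"
  shows "bounded_runs (machine g c) (walking u v) (n + length v + 1)"
  using assms
proof (induction v arbitrary: u)
  case Nil
  then show ?case by (auto intro!: bounded_runs_Suc simp: step_walking_Nil)
next
  case (Cons b v)
  show ?case unfolding length_Cons add_Suc_right add_Suc
  proof (rule bounded_runs_Suc)
    fix d assume "tm_step (machine g c) (walking u (b # v)) d"
    then obtain y where "d = walking (u @ [(b, y)]) v" unfolding step_walking_Cons by blast
    then show "bounded_runs (machine g c) d (n + length v + 1)"
      using Cons.IH[of "u @ [(b, y)]"] Cons.prems by simp
  qed
qed

text \<open>Each cell offers a free choice if \<open>g\<close> holds and none otherwise, so the scan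
  can end in exactly those words of pairs that project to the input.\<close>

lemma accepting_walking:
  "accepting (machine g c) (walking u v) \<longleftrightarrow>
     (\<exists>w. map fst w = v \<and> (\<forall>p\<in>set w. snd p \<longrightarrow> g) \<and> accepting (machine g c) (walked (u @ w)))"
proof (induction v arbitrary: u)
  case Nil
  have "\<not> halting (machine g c) (walking u [])" by (simp add: halting_def step_walking_Nil)
  from accepting_step[OF this] show ?case by (simp add: step_walking_Nil)
next
  case (Cons b v)
  have "\<not> halting (machine g c) (walking u (b # v))" unfolding halting_def step_walking_Cons by blast
  note accepting_step[OF this]
  also have "(\<exists>d. tm_step (machine g c) (walking u (b # v)) d \<and> accepting (machine g c) d) \<longleftrightarrow>
      (\<exists>y. (y \<longrightarrow> g) \<and> accepting (machine g c) (walking (u @ [(b, y)]) v))"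
    unfolding step_walking_Cons by blast
  also have "\<dots> \<longleftrightarrow> (\<exists>w. map fst w = b # v \<and> (\<forall>p\<in>set w. snd p \<longrightarrow> g) \<and> accepting (machine g c) (walked (u @ w)))"
  proof
    assume "\<exists>y. (y \<longrightarrow> g) \<and> accepting (machine g c) (walking (u @ [(b, y)]) v)"
    then obtain y w where "y \<longrightarrow> g" "map fst w = v" "\<forall>p\<in>set w. snd p \<longrightarrow> g"
      "accepting (machine g c) (walked ((u @ [(b, y)]) @ w))" unfolding Cons.IH by blast
    then show "\<exists>w. map fst w = b # v \<and> (\<forall>p\<in>set w. snd p \<longrightarrow> g) \<and> accepting (machine g c) (walked (u @ w))"
      by (intro exI[of _ "(b, y) # w"]) auto
  next
    assume "\<exists>w. map fst w = b # v \<and> (\<forall>p\<in>set w. snd p \<longrightarrow> g) \<and> accepting (machine g c) (walked (u @ w))"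
    then obtain p w where *: "fst p = b" "map fst w = v" "snd p \<longrightarrow> g" "\<forall>p\<in>set w. snd p \<longrightarrow> g"
      "accepting (machine g c) (walked (u @ p # w))"
      unfolding map_eq_Cons_conv by (metis list.set_intros)
    have "(u @ [(b, snd p)]) @ w = u @ p # w" unfolding *(1)[symmetric] by simp
    with *(2-5) show "\<exists>y. (y \<longrightarrow> g) \<and> accepting (machine g c) (walking (u @ [(b, y)]) v)"
      unfolding Cons.IH by metis
  qed
  finally show ?case .
qed

lemma walking_run: "(tm_step (machine g c) ^^ (length v + 1)) (walking u v) (walked (u @ plain v))"
proof (induction v arbitrary: u)
  case Nil
  then show ?case by (simp add: OO_def step_walking_Nil)
next
  case (Cons b v)
  have "tm_step (machine g c) (walking u (b # v)) (walking (u @ [(b, False)]) v)"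
    unfolding step_walking_Cons by (intro exI[of _ False]) simp
  with Cons[of "u @ [(b, False)]"] show ?case
    by (auto simp del: relpowp.simps intro: relpowp_Suc_I2)
qed


subsection \<open>Reading the input and writing the output\<close>

text \<open>The scan ends on the blank behind the input, and reading goes left from there, so the
  list is built from its end: 1 is the empty list, and each cell adds a node symbol and the code of
  its pair.\<close>

definition Read :: cmd where
  "Read = (Op 0 (\<lambda>a. (a, Go_Left)) ;; Push 2 1 ;; While 0 {1..4}
     (Cond 0 {sym_of (False, False)} (Pushes (2 # code (enc (False, False))))
       (Cond 0 {sym_of (True, False)} (Pushes (2 # code (enc (True, False))))
       (Cond 0 {sym_of (False, True)} (Pushes (2 # code (enc (False, True))))
          (Pushes (2 # code (enc (True, True)))))) ;;
      Op 0 (\<lambda>a. (a, Go_Left))))"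

lemma wf_Read: "wf_cmd Read"
  by (simp add: Read_def)

lemma main_env_left:
  "(main (env0 w h) xs)(0 := act (read_tape (main (env0 w h) xs 0), Go_Left) (main (env0 w h) xs 0)) = main (env0 w (h - 1)) xs"
  by (auto simp: stacks_def env0_def fun_eq_iff)

lemma runs_left: "runs (Op 0 (\<lambda>a. (a, Go_Left))) (main (env0 w h) xs) 1 (main (env0 w (h - 1)) xs)"
  using runs_Op[of 0 "\<lambda>a. (a, Go_Left)" "main (env0 w h) xs"] unfolding main_env_left .

lemma read_env0: "read_tape (main (env0 w h) xs 0) = in_tape w h"
  by (simp add: stacks_def env0_def)

text \<open>A cell costs at most 25 steps: 16 for pushing eight symbols, six for the three tests,
  one for the move and two for the loop.\<close>

lemma runs_Read_loop:
  assumes "k \<le> length w"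
  shows "runs (While 0 {1..4}
     (Cond 0 {sym_of (False, False)} (Pushes (2 # code (enc (False, False))))
       (Cond 0 {sym_of (True, False)} (Pushes (2 # code (enc (True, False))))
       (Cond 0 {sym_of (False, True)} (Pushes (2 # code (enc (False, True))))
          (Pushes (2 # code (enc (True, True)))))) ;;
      Op 0 (\<lambda>a. (a, Go_Left)))) (main (env0 w (int k - 1)) (code (enc (drop k w)))) (25 * k + 1)
    (main (env0 w (- 1)) (code (enc w)))"
  using assms
proof (induction k)
  case 0
  show ?case by (auto intro!: runs_mono[OF runs_While_False] simp: read_env0 in_tape_def)
next
  case (Suc k)
  let ?xs = "code (enc (drop (Suc k) w))"
  let ?C = "Cond 0 {sym_of (False, False)} (Pushes (2 # code (enc (False, False))))
       (Cond 0 {sym_of (True, False)} (Pushes (2 # code (enc (True, False))))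
       (Cond 0 {sym_of (False, True)} (Pushes (2 # code (enc (False, True))))
          (Pushes (2 # code (enc (True, True))))))"
  have k: "k < length w" using Suc.prems by simp
  obtain b y where p: "w ! k = (b, y)" by (cases "w ! k")
  have drop: "drop k w = (b, y) # drop (Suc k) w" using Cons_nth_drop_Suc[OF k] p by simp
  have read: "read_tape (main (env0 w (int k)) xs 0) = sym_of (b, y)" for xs
    using k by (simp add: read_env0 in_tape_def p)
  have push: "runs (Pushes (2 # code (enc (b, y)))) (main (env0 w (int k)) ?xs) 16 (main (env0 w (int k)) (code (enc (drop k w))))"
    unfolding drop using runs_Pushes[of "2 # code (enc (b, y))" "env0 w (int k)" ?xs]
    by (auto elim!: runs_mono simp: enc_prod_def enc_bool_def)
  have "runs ?C (main (env0 w (int k)) ?xs) (16 + 2 + 2 + 2) (main (env0 w (int k)) (code (enc (drop k w))))"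
    by (intro runs_Cond) (use push in \<open>cases b; cases y; auto simp: read sym_of_def elim: runs_mono\<close>)+
  from runs_Seq[OF this runs_left]
  have 1: "runs (?C ;; Op 0 (\<lambda>a. (a, Go_Left))) (main (env0 w (int (Suc k) - 1)) ?xs) (16 + 2 + 2 + 2 + 1)
    (main (env0 w (int k - 1)) (code (enc (drop k w))))" by simp
  have "read_tape (main (env0 w (int (Suc k) - 1)) ?xs 0) \<in> {1..4}" using read[of ?xs] by (simp add: sym_of_def)
  from runs_While_True[OF this 1 Suc.IH] k show ?case by (auto elim!: runs_mono)
qed

lemma runs_Read: "runs Read (main (env0 w (int (length w))) []) (25 * length w + 4) (main (env0 w (- 1)) (code (enc w)))"
proof -
  have "runs Read (main (env0 w (int (length w))) []) (1 + (2 + (25 * length w + 1))) (main (env0 w (- 1)) (code (enc w)))"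
    unfolding Read_def
    using runs_Read_loop[of "length w" w]
    by (intro runs_Seq[OF runs_left runs_Seq[OF runs_Push_main]]) simp
  then show ?thesis by (rule runs_mono) simp
qed

text \<open>After the node symbol of the list, \<open>False\<close> occupies one symbol and
  \<open>True\<close> three, whence the different numbers of pops.\<close>

definition Write :: cmd where
  "Write = While 2 {2} (Pop 2 ;; Cond 2 {1} (Pop 2 ;; Op 6 (\<lambda>_. (1, Go_Right)))
     (Pop 2 ;; Pop 2 ;; Pop 2 ;; Op 6 (\<lambda>_. (2, Go_Right))))"

lemma wf_Write: "wf_cmd Write"
  by (simp add: Write_def)

lemma tape_of_snoc: "(tape_of xs)(int (length xs) := (if b then 2 else 1)) = tape_of (xs @ [b])"
proof
  fix i
  show "((tape_of xs)(int (length xs) := (if b then 2 else 1))) i = tape_of (xs @ [b]) i"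
  proof (cases "i = int (length xs)")
    case False
    then have "nat i \<noteq> length xs" if "0 \<le> i" using that by auto
    with False show ?thesis by (auto simp: tape_of_def nth_append)
  qed (simp add: tape_of_def)
qed

lemma runs_emit:
  assumes "e 6 = (tape_of ys, int (length ys))"
  shows "runs (Op 6 (\<lambda>_. (if b then 2 else 1, Go_Right))) (main e r) 1
    (main (e(6 := (tape_of (ys @ [b]), int (length (ys @ [b]))))) r)"
proof -
  have "(main e r)(6 := act (if b then 2 else 1, Go_Right) (main e r 6)) =
    main (e(6 := (tape_of (ys @ [b]), int (length (ys @ [b]))))) r"
    by (rule ext) (auto simp: stacks_def act_eq assms tape_of_snoc simp del: act.simps)
  with runs_Op[of 6 "\<lambda>_. (if b then 2 else 1, Go_Right)" "main e r"] show ?thesis by simp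
qed

lemma runs_Write:
  assumes "e 6 = (tape_of ys, int (length ys))"
  shows "\<exists>e'. runs Write (main e (code (enc xs) @ r)) (9 * length xs + 1) (main e' (1 # r)) \<and>
    fst (e' 6) = tape_of (ys @ xs)"
  using assms
proof (induction xs arbitrary: e ys)
  case Nil
  then show ?case unfolding Write_def
    by (auto intro!: exI[of _ e] runs_mono[OF runs_While_False] simp: read_stacks)
next
  case (Cons b xs)
  let ?e = "e(6 := (tape_of (ys @ [b]), int (length (ys @ [b]))))"
  let ?ys = "code (enc xs) @ r"
  have "?e 6 = (tape_of (ys @ [b]), int (length (ys @ [b])))" by simp
  from Cons.IH[of ?e "ys @ [b]", OF this] obtain e' where e': "runs Write (main ?e ?ys) (9 * length xs + 1) (main e' (1 # r))"
    "fst (e' 6) = tape_of (ys @ b # xs)" unfolding append_assoc append_Cons append_Nil by blast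
  note emit = runs_emit[of e ys b ?ys, OF Cons.prems]
  have "runs (Cond 2 {1} (Pop 2 ;; Op 6 (\<lambda>_. (1, Go_Right)))
     (Pop 2 ;; Pop 2 ;; Pop 2 ;; Op 6 (\<lambda>_. (2, Go_Right)))) (main e (code (enc b) @ ?ys)) (1 + (1 + (1 + 1)) + 2) (main ?e ?ys)"
  proof (rule runs_Cond)
    assume "read_tape (main e (code (enc b) @ ?ys) 2) \<in> {1}"
    then have b: "b = False" by (cases b) (auto simp: read_stacks enc_bool_def)
    have "runs (Pop 2 ;; Op 6 (\<lambda>_. (1, Go_Right))) (main e (1 # ?ys)) (1 + 1) (main ?e ?ys)"
      using runs_Seq[OF runs_Pop_main emit] by (simp add: b)
    then show "runs (Pop 2 ;; Op 6 (\<lambda>_. (1, Go_Right))) (main e (code (enc b) @ ?ys)) (1 + (1 + (1 + 1))) (main ?e ?ys)"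
      by (auto elim!: runs_mono simp: b enc_bool_def)
  next
    assume "read_tape (main e (code (enc b) @ ?ys) 2) \<notin> {1}"
    then have b: "b = True" by (cases b) (auto simp: read_stacks enc_bool_def)
    have "runs (Pop 2 ;; Pop 2 ;; Pop 2 ;; Op 6 (\<lambda>_. (2, Go_Right))) (main e (2 # 1 # 1 # ?ys)) (1 + (1 + (1 + 1))) (main ?e ?ys)"
      using runs_Seq[OF runs_Pop_main runs_Seq[OF runs_Pop_main runs_Seq[OF runs_Pop_main emit]]] by (simp add: b)
    then show "runs (Pop 2 ;; Pop 2 ;; Pop 2 ;; Op 6 (\<lambda>_. (2, Go_Right))) (main e (code (enc b) @ ?ys)) (1 + (1 + (1 + 1))) (main ?e ?ys)"
      by (simp add: b enc_bool_def)
  qed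
  from runs_Seq[OF runs_Pop_main this]
  have 1: "runs (Pop 2 ;; Cond 2 {1} (Pop 2 ;; Op 6 (\<lambda>_. (1, Go_Right)))
     (Pop 2 ;; Pop 2 ;; Pop 2 ;; Op 6 (\<lambda>_. (2, Go_Right)))) (main e (code (enc (b # xs)) @ r)) (1 + (1 + (1 + (1 + 1)) + 2)) (main ?e ?ys)"
    by simp
  have "read_tape (main e (code (enc (b # xs)) @ r) 2) \<in> {2}" by (simp add: read_stacks)
  from runs_While_True[OF this 1 e'(1)[unfolded Write_def]]
  have "runs Write (main e (code (enc (b # xs)) @ r)) (9 * length (b # xs) + 1) (main e' (1 # r))"
    unfolding Write_def by (rule runs_mono) simp
  with e'(2) show ?case by blast
qed

lemma machine_run:
  assumes "wf_cmd c" "runs c (main (env0 w (int (length w))) []) T st"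
  shows "\<exists>n\<le>T + 1. (dstep (machine g c) ^^ n) (walked w)
    (conf (if read_tape (st 2) = 2 then csize c + 2 else csize c + 3) st)"
proof -
  let ?M = "machine g c" and ?q = "if read_tape (st 2) = 2 then csize c + 2 else csize c + 3"
  from assms(2) obtain n where n: "n \<le> T" "exec c (main (env0 w (int (length w))) []) n st"
    by (auto simp: runs_def)
  have *: "(dstep ?M ^^ n) (walked w) (conf (csize c + 1) st)" "tapes_ok st"
    using exec_sound[OF n(2) assms(1) tapes_ok_env0 hosts_machine(1)[of g c]] by (simp_all add: walked_def)
  have "dstep ?M (conf (csize c + 1) st) (conf ?q st)"
    using dstep_goto[OF hosts_machine(2) *(2), of g c] nth_read[of 2 st] by (simp split: if_splits)
  with *(1) have "(dstep ?M ^^ (n + 1)) (walked w) (conf ?q st)"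
    by (simp only: Suc_eq_plus1[symmetric] relpowp_Suc_I)
  with n(1) show ?thesis by (intro exI[of _ "n + 1"]) simp
qed

lemma sz_pairs: "sz (w :: (bool \<times> bool) list) \<le> 8 * length w + 1"
  by (induction w) (auto simp: sz_bool)

lemma pb_length:
  assumes "pb B"
  shows "\<exists>p. \<forall>w :: (bool \<times> bool) list. B w \<le> poly p (length w)"
proof -
  from assms obtain p where p: "\<And>w. B w \<le> poly p (sz w)" unfolding pb_def by blast
  have "B w \<le> poly (pcompose p [:1, 8:]) (length w)" for w
    using p[of w] poly_nat_mono[OF sz_pairs[of w], of p] by (simp add: poly_pcompose algebra_simps)
  then show ?thesis by blast
qed

text \<open>A run scans and guesses, reads the marked word and evaluates \<open>R\<close>
  deterministically. Input and guess form a single list as long as the input, so the time is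
  polynomial whatever is guessed.\<close>

theorem NP_certificate:
  fixes R :: "(bool \<times> bool) list \<Rightarrow> bool"
  assumes "ptc R"
  shows "{x. \<exists>w. map fst w = x \<and> R w} \<in> NP"
proof -
  obtain c B where c: "wf_cmd c" "pb B"
    "\<And>w e r. runs c (main e (code (enc w) @ r)) (B w) (main e (code (enc (R w)) @ r))"
    using assms by (rule ptcE) blast
  let ?c = "Read ;; c" let ?M = "machine True ?c"
  obtain p where p: "\<And>w. B w \<le> poly p (length w)" using pb_length[OF c(2)] by blast
  have wf: "wf_cmd ?c" using c wf_Read by simp
  have run: "\<exists>n\<le>25 * length w + 4 + B w + 1. \<exists>d. (dstep ?M ^^ n) (walked w) d \<and> halting ?M d \<and>
    (fst d = accept_state ?M \<longleftrightarrow> R w)" for w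
  proof -
    have r: "runs ?c (main (env0 w (int (length w))) []) (25 * length w + 4 + B w) (main (env0 w (- 1)) (code (enc (R w))))"
      using runs_Seq[OF runs_Read c(3)[of "env0 w (- 1)" w "[]", simplified]] by simp
    have q: "read_tape (main (env0 w (- 1)) (code (enc (R w))) 2) = 2 \<longleftrightarrow> R w"
      by (simp add: read_stacks enc_bool_def)
    from machine_run[OF wf r, of True] obtain n where n: "n \<le> 25 * length w + 4 + B w + 1"
      "(dstep ?M ^^ n) (walked w) (conf (if R w then csize ?c + 2 else csize ?c + 3) (main (env0 w (- 1)) (code (enc (R w)))))"
      unfolding q by blast
    then show ?thesis
      by (intro exI[of _ n] conjI exI[of _ "conf (if R w then csize ?c + 2 else csize ?c + 3) (main (env0 w (- 1)) (code (enc (R w))))"])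
        (auto simp: conf_def halting_machine)
  qed
  have "bounded_runs ?M (walked w) (25 * length w + 4 + poly p (length w) + 1)" for w
  proof -
    from run[of w] obtain n where n: "n \<le> 25 * length w + 4 + B w + 1" "bounded_runs ?M (walked w) n"
      using dstep_bounded_runs by blast
    show ?thesis by (rule bounded_runs_mono[OF n(2)]) (use n(1) p[of w] in linarith)
  qed
  then have "bounded_runs ?M (walking [] x) (25 * length x + 4 + poly p (length x) + 1 + length x + 1)" for x
    using bounded_runs_walking[of "[]" x True ?c "25 * length x + 4 + poly p (length x) + 1"]
    by (metis add_0 list.size(3))
  \<comment> \<open>Per cell there are 25 steps of reading and one of scanning; the constant 6
    collects what happens at the ends.\<close>
  then have bound: "\<forall>x n d. (tm_step ?M ^^ n) (initial ?M x) d \<longrightarrow> n \<le> poly ([:6, 26:] + p) (length x)"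
    unfolding bounded_runs_def initial_machine by (auto simp: algebra_simps)
  have "accepting ?M (walked w) \<longleftrightarrow> R w" for w
    using run[of w] dstep_accepting accepting_halting by blast
  then have "accepts ?M x \<longleftrightarrow> (\<exists>w. map fst w = x \<and> R w)" for x
    using accepting_walking[of True ?c "[]" x] unfolding accepts_def initial_machine accepting_def[symmetric] by simp
  with wf_machine bound show ?thesis unfolding NP_def by blast
qed

text \<open>Without guessing, the word read is the input with all guesses \<open>False\<close>, and
  \<open>map fst\<close> recovers it. \<open>Write\<close> leaves the 1 of the empty list on the
  stack, so the run ends in the state after the accepting one, which halts as well.\<close>

theorem polytime_computable_ptc:
  fixes f :: "bool list \<Rightarrow> bool list"
  assumes "ptc f"
  shows "polytime_computable f"
proof -
  have "ptc (\<lambda>w :: (bool \<times> bool) list. f (map fst w))" by (rule ptc_comp[OF _ assms]) (intro ptc_intros)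
  then obtain c and B :: "(bool \<times> bool) list \<Rightarrow> nat" where c: "wf_cmd c" "pb B" "pb (\<lambda>w :: (bool \<times> bool) list. sz (f (map fst w)))"
    "\<And>(w :: (bool \<times> bool) list) e r.
       runs c (main e (code (enc w) @ r)) (B w) (main e (code (enc (f (map fst w))) @ r))"
    by (rule ptcE) blast
  let ?c = "Read ;; c ;; Write" let ?M = "machine False ?c"
  let ?T = "\<lambda>w. 25 * length w + 4 + (B w + (9 * sz (f (map fst w)) + 1))"
  have "pb (\<lambda>w. ?T w)"
  proof (rule pb_mono)
    show "?T w \<le> 25 * sz w + 4 + (B w + (9 * sz (f (map fst w)) + 1))" for w
      using length_le_sz[of w] by simp
  qed (intro pb_intros c)
  then obtain p where p: "\<And>w. ?T w \<le> poly p (length w)" using pb_length by blast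
  have wf: "wf_cmd ?c" using c wf_Read wf_Write by simp
  have "\<exists>n d. n \<le> poly ([:2, 1:] + p) (length x) \<and> (tm_step ?M ^^ n) (initial ?M x) d \<and>
      halting ?M d \<and> fst (last (snd d)) = tape_of (f x)" for x
  proof -
    let ?w = "plain x"
    have "env0 ?w (- 1) 6 = (tape_of [], int (length []))" by (auto simp: env0_def tape_of_def)
    from runs_Write[of "env0 ?w (- 1)" "[]" "f x" "[]", OF this] obtain e' where e':
      "runs Write (main (env0 ?w (- 1)) (code (enc (f x)))) (9 * length (f x) + 1) (main e' [1])"
      "fst (e' 6) = tape_of (f x)" by auto
    have "runs ?c (main (env0 ?w (int (length ?w))) []) (25 * length ?w + 4 + (B ?w + (9 * length (f x) + 1))) (main e' [1])"
      using c(4)[of "env0 ?w (- 1)" ?w "[]"] by (intro runs_Seq[OF runs_Read] runs_Seq[OF _ e'(1)]) simp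
    then have "runs ?c (main (env0 ?w (int (length ?w))) []) (?T ?w) (main e' [1])"
      by (rule runs_mono) (simp add: length_le_sz less_imp_le)
    from machine_run[OF wf this, of False] obtain n where n: "n \<le> ?T ?w + 1"
      "(dstep ?M ^^ n) (walked ?w) (conf (csize ?c + 3) (main e' [1]))" by (auto simp: read_stacks)
    have "(tm_step ?M ^^ (length x + 1 + n)) (initial ?M x) (conf (csize ?c + 3) (main e' [1]))"
      unfolding initial_machine using walking_run[of x False ?c "[]", unfolded append_Nil] dstep_relpowp[OF n(2)]
      by (rule relcomppI[THEN relpowp_add[THEN fun_cong, THEN fun_cong, THEN iffD2]])
    moreover have "halting ?M (conf (csize ?c + 3) (main e' [1]))"
      unfolding conf_def by (rule halting_machine) simp
    moreover have "fst (last (snd (conf (csize ?c + 3) (main e' [1])))) = tape_of (f x)"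
      using e'(2) by (simp add: conf_def last_map stacks_def)
    moreover have "length x + 1 + n \<le> poly ([:2, 1:] + p) (length x)"
      using n(1) p[of ?w] by simp
    ultimately show ?thesis by blast
  qed
  then show ?thesis unfolding polytime_computable_def using wf_machine deterministic_machine by blast
qed


section \<open>From satisfiability to sensing all targets\<close>

definition sensable :: "esg_inst \<Rightarrow> bool" where
  "sensable I \<longleftrightarrow> (\<exists>\<psi>. sensing_plan (game_of I) \<psi> \<and> valid_plan (game_of I) (order_of I) \<psi> \<and>
     sensed (game_of I) \<psi> = targets (game_of I))"

text \<open>The ordering is that of the list and all values are 1, so a pure list-colouring problem
  remains: sensors are the colours, \<open>can\<close> gives the lists, and positions at distance at
  most \<open>\<tau>\<close> exclude each other.\<close>

definition colour_inst :: "'t list \<Rightarrow> 's list \<Rightarrow> ('s \<Rightarrow> 't \<Rightarrow> bool) \<Rightarrow> nat \<Rightarrow> esg_inst" where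
  "colour_inst ts ss can \<tau> =
     \<lparr>inst_values = map (\<lambda>_. (1, 1)) ts, inst_recharge = enat \<tau>,
      inst_columns = map (\<lambda>s. map (can s) ts) ss, inst_order = map Suc [0..<length ts]\<rparr>"

lemma wf_colour_inst: "wf_inst (colour_inst ts ss can \<tau>)"
proof -
  have "bij_betw (order_of (colour_inst ts ss can \<tau>)) {..<length ts} {1..length ts}"
    unfolding bij_betw_def
  proof
    show "inj_on (order_of (colour_inst ts ss can \<tau>)) {..<length ts}"
      by (auto simp: inj_on_def order_of_def colour_inst_def)
    have "order_of (colour_inst ts ss can \<tau>) ` {..<length ts} = Suc ` {..<length ts}"
      by (intro image_cong) (auto simp: order_of_def colour_inst_def)
    then show "order_of (colour_inst ts ss can \<tau>) ` {..<length ts} = {1..length ts}"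
      by (simp add: image_Suc_lessThan)
  qed
  then show ?thesis
    by (auto simp: wf_inst_def wf_esg_def target_ordering_def game_of_def colour_inst_def)
qed

text \<open>A plan yields a colouring by picking for each position some sensor that senses it; a
  colouring yields a plan by letting each sensor sense its colour class. As \<open>ss\<close> is
  distinct, indices of sensors can be identified with colours.\<close>

lemma sensable_colour_inst:
  assumes "distinct ss"
  shows "sensable (colour_inst ts ss can \<tau>) \<longleftrightarrow>
    (\<exists>\<chi>. (\<forall>i<length ts. \<chi> i \<in> set ss \<and> can (\<chi> i) (ts ! i)) \<and>
       (\<forall>i j. i < j \<longrightarrow> j < length ts \<longrightarrow> j - i \<le> \<tau> \<longrightarrow> \<chi> i \<noteq> \<chi> j))"
proof
  let ?I = "colour_inst ts ss can \<tau>"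
  assume "sensable ?I"
  then obtain \<psi> where \<psi>: "sensing_plan (game_of ?I) \<psi>" "valid_plan (game_of ?I) (order_of ?I) \<psi>"
    "sensed (game_of ?I) \<psi> = targets (game_of ?I)" by (auto simp: sensable_def)
  have "\<exists>s<length ss. i \<in> \<psi> s" if "i < length ts" for i
    using \<psi>(3) that by (auto simp: sensed_def game_of_def colour_inst_def)
  then obtain f where f: "\<And>i. i < length ts \<Longrightarrow> f i < length ss \<and> i \<in> \<psi> (f i)" by metis
  have "can (ss ! f i) (ts ! i)" if "i < length ts" for i
  proof -
    have "f i \<in> sensors (game_of ?I)" "i \<in> \<psi> (f i)" using f[OF that] by (auto simp: game_of_def colour_inst_def)
    then have "can_sense (game_of ?I) (f i) i" using \<psi>(2) unfolding valid_plan_def by blast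
    then show ?thesis using f[OF that] that by (simp add: game_of_def colour_inst_def)
  qed
  moreover have "ss ! f i \<noteq> ss ! f j" if ij: "i < j" "j < length ts" "j - i \<le> \<tau>" for i j
  proof
    assume "ss ! f i = ss ! f j"
    then have "f i = f j" using assms f[of i] f[of j] ij by (simp add: nth_eq_iff_index_eq)
    then have "f i < length ss" "i \<in> \<psi> (f i)" "j \<in> \<psi> (f i)" "i \<noteq> j" using f[of i] f[of j] ij by auto
    then have "enat (nat \<bar>int (order_of ?I i) - int (order_of ?I j)\<bar>) > enat \<tau>"
      using \<psi>(2) by (auto simp: valid_plan_def game_of_def colour_inst_def)
    moreover have "order_of ?I i = Suc i" "order_of ?I j = Suc j"
      using ij by (auto simp: order_of_def colour_inst_def)
    ultimately show False using ij by auto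
  qed
  ultimately show "\<exists>\<chi>. (\<forall>i<length ts. \<chi> i \<in> set ss \<and> can (\<chi> i) (ts ! i)) \<and>
       (\<forall>i j. i < j \<longrightarrow> j < length ts \<longrightarrow> j - i \<le> \<tau> \<longrightarrow> \<chi> i \<noteq> \<chi> j)"
    using f by (intro exI[of _ "\<lambda>i. ss ! f i"]) auto
next
  let ?I = "colour_inst ts ss can \<tau>"
  assume "\<exists>\<chi>. (\<forall>i<length ts. \<chi> i \<in> set ss \<and> can (\<chi> i) (ts ! i)) \<and>
       (\<forall>i j. i < j \<longrightarrow> j < length ts \<longrightarrow> j - i \<le> \<tau> \<longrightarrow> \<chi> i \<noteq> \<chi> j)"
  then obtain \<chi> where \<chi>: "\<And>i. i < length ts \<Longrightarrow> \<chi> i \<in> set ss \<and> can (\<chi> i) (ts ! i)"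
    "\<And>i j. i < j \<Longrightarrow> j < length ts \<Longrightarrow> j - i \<le> \<tau> \<Longrightarrow> \<chi> i \<noteq> \<chi> j" by auto
  define \<psi> where "\<psi> s = {i. i < length ts \<and> \<chi> i = ss ! s}" for s
  have order: "order_of ?I i = Suc i" if "i < length ts" for i
    using that by (auto simp: order_of_def colour_inst_def)
  have far: "\<tau> < nat \<bar>int (Suc i) - int (Suc j)\<bar>" if "i < length ts" "j < length ts" "\<chi> i = \<chi> j" "i \<noteq> j" for i j
  proof (rule ccontr)
    assume "\<not> ?thesis"
    then have "i < j \<Longrightarrow> j - i \<le> \<tau>" "j < i \<Longrightarrow> i - j \<le> \<tau>" by linarith+
    with \<chi>(2)[of i j] \<chi>(2)[of j i] that show False by (metis nat_neq_iff)
  qed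
  have "sensing_plan (game_of ?I) \<psi>"
    using assms by (auto simp: sensing_plan_def game_of_def colour_inst_def \<psi>_def nth_eq_iff_index_eq)
  moreover have "valid_plan (game_of ?I) (order_of ?I) \<psi>"
    unfolding valid_plan_def
  proof (intro conjI ballI impI)
    fix s t assume "s \<in> sensors (game_of ?I)" "t \<in> \<psi> s"
    then have "s < length ss" "t < length ts" "\<chi> t = ss ! s" by (auto simp: game_of_def colour_inst_def \<psi>_def)
    then show "can_sense (game_of ?I) s t" using \<chi>(1)[of t] by (simp add: game_of_def colour_inst_def)
  next
    fix s t t' assume "s \<in> sensors (game_of ?I)" "t \<in> \<psi> s" "t' \<in> \<psi> s" "t \<noteq> t'"
    then have "t < length ts" "t' < length ts" "\<chi> t = \<chi> t'" "t \<noteq> t'" by (auto simp: \<psi>_def)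
    then show "recharge (game_of ?I) < enat (nat \<bar>int (order_of ?I t) - int (order_of ?I t')\<bar>)"
      using far[of t t'] order[of t] order[of t'] by (simp add: game_of_def) (simp add: colour_inst_def)
  qed
  moreover have "sensed (game_of ?I) \<psi> = targets (game_of ?I)"
  proof -
    have "\<exists>s<length ss. \<chi> i = ss ! s" if "i < length ts" for i
      using \<chi>(1)[OF that] by (metis in_set_conv_nth)
    then show ?thesis by (auto simp: sensed_def game_of_def colour_inst_def \<psi>_def)
  qed
  ultimately show "sensable ?I" by (auto simp: sensable_def)
qed

text \<open>With unit values the unsensed value is a number of targets, so threshold 0 asks for all
  of them. This carries hardness over to the version with a threshold.\<close>

lemma colour_inst_threshold:
  "(\<exists>\<psi>. sensing_plan (game_of (colour_inst ts ss can \<tau>)) \<psi> \<and>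
      valid_plan (game_of (colour_inst ts ss can \<tau>)) (order_of (colour_inst ts ss can \<tau>)) \<psi> \<and>
      unsensed_value (game_of (colour_inst ts ss can \<tau>)) \<psi> \<le> 0) \<longleftrightarrow> sensable (colour_inst ts ss can \<tau>)"
proof -
  let ?G = "game_of (colour_inst ts ss can \<tau>)"
  have "unsensed_value ?G \<psi> \<le> 0 \<longleftrightarrow> sensed ?G \<psi> = targets ?G" if "sensing_plan ?G \<psi>" for \<psi>
  proof -
    have "unsensed_value ?G \<psi> = (\<Sum>t\<in>targets ?G - sensed ?G \<psi>. 1)"
      unfolding unsensed_value_def by (intro sum.cong) (auto simp: game_of_def colour_inst_def)
    then have "unsensed_value ?G \<psi> \<le> 0 \<longleftrightarrow> targets ?G - sensed ?G \<psi> = {}"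
      by (auto simp: game_of_def)
    moreover have "sensed ?G \<psi> \<subseteq> targets ?G" using that by (auto simp: sensed_def sensing_plan_def)
    ultimately show ?thesis by auto
  qed
  then show ?thesis unfolding sensable_def by blast
qed


subsection \<open>The gadget\<close>

text \<open>
  The positions form one row of length \<open>(m + 1) (v + 1)\<close> for each of the \<open>m\<close> clauses, and the recharging
  time is one less, so that each sensor is used at most once in each window of that length. A row
  consists of \<open>m + 1\<close> blocks of \<open>v + 1\<close> positions, one for each of the \<open>v\<close> variables and an extra one.
  In row \<open>r\<close>, block 0 holds the false literal of each variable and block \<open>r + 1\<close> the true one; the
  extra position of block \<open>r + 1\<close> takes a true literal of clause \<open>r\<close> out of its place, which is
  then filled by the slack sensor of the row. As the block of the true literals moves to the right
  from row to row, the literal taken out can return to its place, and the false literals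
  cannot change because the true ones occur between any two consecutive occurrences of block 0.
\<close>

type_synonym 'v cnf = "('v \<times> bool) list list"

definition satisfiable :: "'v cnf \<Rightarrow> bool" where
  "satisfiable F \<longleftrightarrow> (\<exists>\<alpha>. \<forall>c\<in>set F. \<exists>l\<in>set c. \<alpha> (fst l) = snd l)"

definition vars :: "'v cnf \<Rightarrow> 'v list" where
  "vars F = fold List.insert (map fst (concat F)) []"

text \<open>Row with its clause, block, and place in the block, the empty list being the extra
  place. The clause is included so that the matrix entry depends on sensor and target alone.\<close>

type_synonym 'v target = "(nat \<times> ('v \<times> bool) list) \<times> nat \<times> 'v list"

datatype 'v sensor = Lit "'v \<times> bool" | Slack nat | Filler "'v target"

text \<open>Each filler belongs to a single target; fillers occupy the places meant for no literal,
  namely the extra place of block 0 and all blocks other than 0 and \<open>Suc r\<close>, and keep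
  the rows at their full length.\<close>

fun gadget_can :: "'v sensor \<Rightarrow> 'v target \<Rightarrow> bool" where
  "gadget_can (Lit l) t \<longleftrightarrow> snd (snd t) = [fst l] \<and> (fst (snd t) = 0 \<or> fst (snd t) = Suc (fst (fst t))) \<or>
     snd (snd t) = [] \<and> fst (snd t) = Suc (fst (fst t)) \<and> l \<in> set (snd (fst t))"
| "gadget_can (Slack r) t \<longleftrightarrow> fst (fst t) = r \<and> fst (snd t) = Suc r \<and>
     (\<exists>l\<in>set (snd (fst t)). snd (snd t) = [fst l])"
| "gadget_can (Filler t') t \<longleftrightarrow> t = t' \<and>
     (if fst (snd t) = 0 then snd (snd t) = [] else fst (snd t) \<noteq> Suc (fst (fst t)))"

definition gadget_targets :: "'v cnf \<Rightarrow> 'v target list" where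
  "gadget_targets F = List.product (List.enumerate 0 F)
     (List.product [0..<Suc (length F)] (map (\<lambda>x. [x]) (vars F) @ [[]]))"

definition gadget_sensors :: "'v cnf \<Rightarrow> 'v sensor list" where
  "gadget_sensors F = map Lit (List.product (vars F) [False, True]) @ map Slack [0..<length F] @
     map Filler (gadget_targets F)"

definition gadget_inst :: "'v cnf \<Rightarrow> esg_inst" where
  "gadget_inst F = colour_inst (gadget_targets F) (gadget_sensors F) gadget_can
     (length F * Suc (length (vars F)) + length (vars F))"

lemma fold_insert: "set (fold List.insert xs ys) = set xs \<union> set ys" "distinct ys \<Longrightarrow> distinct (fold List.insert xs ys)"
  by (induction xs arbitrary: ys) auto

lemma set_vars: "set (vars F) = fst ` (\<Union>c\<in>set F. set c)"
  by (simp add: vars_def fold_insert)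

lemma distinct_vars: "distinct (vars F)"
  by (simp add: vars_def fold_insert)

lemma distinct_targets: "distinct (gadget_targets F)"
proof -
  have "distinct (map (\<lambda>x. [x]) (vars F) @ [[]])" by (auto simp: distinct_map distinct_vars inj_on_def)
  then show ?thesis
    unfolding gadget_targets_def by (intro distinct_product distinct_enumerate distinct_upt)
qed

lemma distinct_sensors: "distinct (gadget_sensors F)"
  by (auto simp: gadget_sensors_def distinct_map distinct_vars distinct_targets distinct_product inj_on_def)

context
  fixes F :: "'v cnf" and m v B W :: nat and V :: "'v list"
  defines "m \<equiv> length F" and "V \<equiv> vars F" and "v \<equiv> length V" and "B \<equiv> Suc v" and "W \<equiv> Suc m * B"
begin

section \<open>Positions in the grid of rows, blocks and places\<close>

definition pos :: "nat \<Rightarrow> nat \<Rightarrow> nat \<Rightarrow> nat" where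
  "pos r k u = r * W + (k * B + u)"

lemma offset_less: "k \<le> m \<Longrightarrow> u \<le> v \<Longrightarrow> k * B + u < W"
proof -
  assume "k \<le> m" "u \<le> v"
  then have "k * B + u < k * B + B" by (simp add: B_def)
  also have "\<dots> = Suc k * B" by simp
  also have "\<dots> \<le> Suc m * B" using \<open>k \<le> m\<close> by (intro mult_le_mono) auto
  finally show ?thesis by (simp add: W_def)
qed

lemma offset_div_mod: "u \<le> v \<Longrightarrow> (k * B + u) div B = k" "u \<le> v \<Longrightarrow> (k * B + u) mod B = u"
proof -
  assume "u \<le> v"
  then have "u < B" "B \<noteq> 0" by (auto simp: B_def)
  then show "(k * B + u) div B = k" "(k * B + u) mod B = u" by simp_all
qed

lemma length_targets: "length (gadget_targets F) = m * W"
  by (simp add: gadget_targets_def m_def W_def B_def v_def V_def)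

lemma pos_less: "r < m \<Longrightarrow> k \<le> m \<Longrightarrow> u \<le> v \<Longrightarrow> pos r k u < m * W"
proof -
  assume "r < m" "k \<le> m" "u \<le> v"
  then have "pos r k u < r * W + W" using offset_less by (simp add: pos_def)
  also have "\<dots> = Suc r * W" by simp
  also have "\<dots> \<le> m * W" using \<open>r < m\<close> by (intro mult_le_mono) auto
  finally show ?thesis .
qed

lemma target_pos:
  assumes "r < m" "k \<le> m" "u \<le> v"
  shows "gadget_targets F ! pos r k u = ((r, F ! r), k, if u < v then [V ! u] else [])"
proof -
  let ?us = "map (\<lambda>x. [x]) V @ [[]]" let ?p = "List.product [0..<Suc m] ?us"
  have len: "length ?p = W" "length ?us = B" by (simp_all add: W_def B_def v_def)
  have o: "k * B + u < W" using offset_less assms by simp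
  have "pos r k u div W = r" "pos r k u mod W = k * B + u" using o by (auto simp: pos_def)
  moreover have "pos r k u < length (List.enumerate 0 F) * length ?p"
    unfolding len length_enumerate m_def[symmetric] by (rule pos_less[OF assms])
  ultimately have "gadget_targets F ! pos r k u = (List.enumerate 0 F ! r, ?p ! (k * B + u))"
    unfolding gadget_targets_def V_def[symmetric] m_def[symmetric] by (simp only: product_nth len)
  also have "k * B + u < length [0..<Suc m] * length ?us"
    using o len by (simp add: W_def)
  then have "?p ! (k * B + u) = ([0..<Suc m] ! k, ?us ! u)"
    using offset_div_mod[OF assms(3)] by (simp only: product_nth len(2))
  also have "[0..<Suc m] ! k = k" using assms(2) by (simp del: upt_Suc)
  also have "?us ! u = (if u < v then [V ! u] else [])" using assms(3) by (auto simp: nth_append v_def)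
  also have "List.enumerate 0 F ! r = (r, F ! r)" using assms(1) by (simp add: nth_enumerate_eq m_def)
  finally show ?thesis .
qed

lemma posE:
  assumes "i < m * W"
  obtains r k u where "r < m" "k \<le> m" "u \<le> v" "i = pos r k u"
proof
  have W: "W > 0" using assms by (cases W) auto
  show "i div W < m" using assms by (simp add: less_mult_imp_div_less)
  have "i mod W < Suc m * B" using W by (simp add: W_def)
  then show "i mod W div B \<le> m" by (simp add: less_mult_imp_div_less less_Suc_eq_le[symmetric])
  show "i mod W mod B \<le> v" by (simp add: less_Suc_eq_le[symmetric] B_def)
  show "i = pos (i div W) (i mod W div B) (i mod W mod B)" by (simp add: pos_def)
qed

text \<open>The literals in block 0 of the first row are declared false, and every later block 0
  repeats them. The literal at the extra place of a clause shares its row with block 0, so it is not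
  among the false ones.\<close>

lemma satisfiable_if_colouring:
  assumes can: "\<And>i. i < m * W \<Longrightarrow> \<chi> i \<in> set (gadget_sensors F) \<and> gadget_can (\<chi> i) (gadget_targets F ! i)"
    and conflict: "\<And>i j. i < j \<Longrightarrow> j < m * W \<Longrightarrow> j - i \<le> m * B + v \<Longrightarrow> \<chi> i \<noteq> \<chi> j"
  shows "satisfiable F"
proof -
  have W: "W = Suc (m * B + v)" by (simp add: W_def B_def)
  define A where "A r x = \<chi> (pos r 0 x)" for r x
  define T where "T r x = \<chi> (pos r (Suc r) x)" for r x
  have row: "\<chi> (pos r k u) \<noteq> \<chi> (pos r k' u')"
    if "r < m" "k \<le> m" "u \<le> v" "k' \<le> m" "u' \<le> v" "(k, u) \<noteq> (k', u')" for r k u k' u'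
  proof -
    have ne: "k * B + u \<noteq> k' * B + u'"
    proof
      assume eq: "k * B + u = k' * B + u'"
      have "(k * B + u) div B = k" "(k' * B + u') div B = k'" using that offset_div_mod by auto
      with eq have "k = k'" by simp
      with eq that show False by simp
    qed
    have less: "pos r k u < m * W" "pos r k' u' < m * W" using pos_less that by auto
    have o: "k * B + u < W" "k' * B + u' < W" using offset_less that by auto
    show ?thesis
    proof (cases "pos r k u < pos r k' u'")
      case True
      then show ?thesis using o less W by (intro conflict) (auto simp: pos_def)
    next
      case False
      then have "pos r k' u' < pos r k u" using ne by (simp add: pos_def)
      then show ?thesis using o less W by (intro conflict[symmetric]) (auto simp: pos_def)
    qed
  qed
  have A: "A r x = Lit (V ! x, True) \<or> A r x = Lit (V ! x, False)" if "r < m" "x < v" for r x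
  proof -
    have "gadget_can (A r x) ((r, F ! r), 0, [V ! x])"
      using can[OF pos_less[of r 0 x]] target_pos[of r 0 x] that by (simp add: A_def)
    then show ?thesis by (cases "A r x") auto
  qed
  have T: "(\<exists>b. T r x = Lit (V ! x, b)) \<or> T r x = Slack r" if "r < m" "x < v" for r x
  proof -
    have "gadget_can (T r x) ((r, F ! r), Suc r, [V ! x])"
      using can[OF pos_less[of r "Suc r" x]] target_pos[of r "Suc r" x] that by (simp add: T_def)
    then show ?thesis by (cases "T r x") auto
  qed
  \<comment> \<open>The extra place of this block admits neither a slack sensor nor a filler, only
    literals of the clause.\<close>
  have C: "\<exists>y<v. \<exists>b. T r v = Lit (V ! y, b) \<and> (V ! y, b) \<in> set (F ! r)" if "r < m" for r
  proof -
    have *: "gadget_can (T r v) ((r, F ! r), Suc r, [])"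
      using can[OF pos_less[of r "Suc r" v]] target_pos[of r "Suc r" v] that by (simp add: T_def)
    then obtain l where l: "T r v = Lit l" "l \<in> set (F ! r)" by (cases "T r v") auto
    then have "fst l \<in> set V" using that by (force simp: V_def set_vars m_def)
    then obtain y where "y < v" "fst l = V ! y" by (metis in_set_conv_nth v_def)
    with l show ?thesis by (cases l) auto
  qed
  \<comment> \<open>Everything behind block 0 of a row is less than a window away from block 0 of
    the next row.\<close>
  have next_row: "\<chi> (pos r (Suc k) u) \<noteq> A (Suc r) x" if "Suc r < m" "x < v" "Suc k \<le> m" "u \<le> v" for r k u x
    unfolding A_def
  proof (rule conflict)
    have o: "Suc k * B + u < W" using offset_less[of "Suc k" u] that by simp
    then show "pos r (Suc k) u < pos (Suc r) 0 x" by (simp add: pos_def)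
    show "pos (Suc r) 0 x < m * W" using that by (intro pos_less) auto
    have "x < B" using that by (simp add: B_def)
    then have "pos (Suc r) 0 x - pos r (Suc k) u < W" using o by (simp add: pos_def)
    then show "pos (Suc r) 0 x - pos r (Suc k) u \<le> m * B + v" using W by simp
  qed
  have same_row: "T r u \<noteq> A r x" "u \<noteq> u' \<Longrightarrow> T r u \<noteq> T r u'" if "r < m" "u \<le> v" "u' \<le> v" "x < v" for r u u' x
    unfolding A_def T_def using that by (intro row; simp)+
  have step: "A (Suc r) x = A r x" if r: "Suc r < m" "x < v" for r x
  proof -
    have "r < m" using r by simp
    obtain b where b: "A r x = Lit (V ! x, b)" using A[OF \<open>r < m\<close> r(2)] by auto
    have "\<exists>u\<le>v. T r u = Lit (V ! x, \<not> b)"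
    proof (cases "T r x = Slack r")
      case False
      with T[OF \<open>r < m\<close> r(2)] obtain b' where "T r x = Lit (V ! x, b')" by blast
      with same_row(1)[OF \<open>r < m\<close>, of x x x] r b have "T r x = Lit (V ! x, \<not> b)" by (cases b; cases b') auto
      then show ?thesis using r by (intro exI[of _ x]) simp
    next
      case True
      from C[OF \<open>r < m\<close>] obtain y b' where y: "y < v" "T r v = Lit (V ! y, b')" by blast
      \<comment> \<open>Otherwise three positions of one row, all of different colours, would have
        to share the two literals of the variable at index \<open>y\<close>.\<close>
      have "T r y = Slack r"
      proof (rule ccontr)
        assume "T r y \<noteq> Slack r"
        with T[OF \<open>r < m\<close> y(1)] obtain b'' where "T r y = Lit (V ! y, b'')" by blast
        moreover obtain d where "A r y = Lit (V ! y, d)" using A[OF \<open>r < m\<close> y(1)] by auto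
        ultimately show False
          using same_row(1)[OF \<open>r < m\<close>, of y y y] same_row(1)[OF \<open>r < m\<close>, of v v y]
            same_row(2)[OF \<open>r < m\<close>, of y v y] y by (cases b''; cases b'; cases d) auto
      qed
      \<comment> \<open>The slack sensor serves only once in a row, so the literal moved to the
        extra place is the one missing at \<open>x\<close>.\<close>
      then have "y = x" using same_row(2)[OF \<open>r < m\<close>, of x y x] True y r by (metis less_imp_le)
      with y b same_row(1)[OF \<open>r < m\<close>, of v v x] r have "T r v = Lit (V ! x, \<not> b)" by (cases b; cases b') auto
      then show ?thesis by blast
    qed
    then obtain u where "u \<le> v" "T r u = Lit (V ! x, \<not> b)" by blast
    with next_row[OF r, of r u] r have "A (Suc r) x \<noteq> Lit (V ! x, \<not> b)" by (simp add: T_def)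
    with A[OF r] b show ?thesis by (cases b) auto
  qed
  have A0: "A r x = A 0 x" if "r < m" "x < v" for r x
    using that by (induction r) (auto simp: step)
  \<comment> \<open>Block 0 holds the false literals, so a variable is true if its negative literal
    stands there.\<close>
  define \<alpha> where "\<alpha> y = (\<exists>x<v. V ! x = y \<and> A 0 x = Lit (y, False))" for y
  have "\<exists>l\<in>set c. \<alpha> (fst l) = snd l" if c: "c \<in> set F" for c
  proof -
    obtain r where r: "r < m" "F ! r = c" using c by (auto simp: m_def in_set_conv_nth)
    obtain y b where y: "y < v" "T r v = Lit (V ! y, b)" "(V ! y, b) \<in> set c" using C[OF r(1)] r(2) by blast
    have "A 0 y \<noteq> Lit (V ! y, b)" using same_row(1)[OF r(1), of v v y] y A0[OF r(1) y(1)] by simp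
    moreover have "A 0 y = Lit (V ! y, True) \<or> A 0 y = Lit (V ! y, False)" using A[of 0 y] r y by auto
    moreover have "\<alpha> (V ! y) \<longleftrightarrow> A 0 y = Lit (V ! y, False)"
      using y(1) distinct_vars[of F] by (auto simp: \<alpha>_def V_def v_def nth_eq_iff_index_eq)
    ultimately have "\<alpha> (V ! y) = b" by (cases b) auto
    with y(3) show ?thesis by force
  qed
  then show ?thesis unfolding satisfiable_def by blast
qed

text \<open>\<open>L r\<close> is a true literal chosen in clause \<open>r\<close>. Only literals
  occur in several rows, and in later rows their offset never decreases: false literals keep it,
  true ones advance to a later block. So two uses of a colour are at least \<open>W\<close>
  apart.\<close>

lemma colouring_if_satisfiable:
  assumes "satisfiable F"
  shows "\<exists>\<chi>. (\<forall>i<m * W. \<chi> i \<in> set (gadget_sensors F) \<and> gadget_can (\<chi> i) (gadget_targets F ! i)) \<and>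
    (\<forall>i j. i < j \<longrightarrow> j < m * W \<longrightarrow> j - i \<le> m * B + v \<longrightarrow> \<chi> i \<noteq> \<chi> j)"
proof -
  obtain \<alpha> where \<alpha>: "\<And>c. c \<in> set F \<Longrightarrow> \<exists>l\<in>set c. \<alpha> (fst l) = snd l"
    using assms by (auto simp: satisfiable_def)
  then have "\<exists>l\<in>set (F ! r). \<alpha> (fst l) = snd l" if "r < m" for r
    using that by (simp add: m_def)
  then obtain L where L: "\<And>r. r < m \<Longrightarrow> L r \<in> set (F ! r) \<and> \<alpha> (fst (L r)) = snd (L r)" by metis
  define g where "g r k u = (if k = 0 \<and> u < v then Lit (V ! u, \<not> \<alpha> (V ! u))
    else if k = Suc r then
      (if u < v then (if fst (L r) = V ! u then Slack r else Lit (V ! u, \<alpha> (V ! u))) else Lit (L r))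
    else Filler (gadget_targets F ! pos r k u))" for r k u
  define \<chi> where "\<chi> i = g (i div W) (i mod W div B) (i mod W mod B)" for i
  have \<chi>: "\<chi> (pos r k u) = g r k u" if "r < m" "k \<le> m" "u \<le> v" for r k u
  proof -
    have "k * B + u < W" using offset_less that by simp
    then have "pos r k u div W = r" "pos r k u mod W = k * B + u" by (auto simp: pos_def)
    moreover have "(k * B + u) div B = k" "(k * B + u) mod B = u" using that offset_div_mod by auto
    ultimately show ?thesis by (simp add: \<chi>_def)
  qed
  have V: "x = y" if "V ! x = V ! y" "x < v" "y < v" for x y
    using that distinct_vars[of F] by (auto simp: V_def v_def nth_eq_iff_index_eq)
  have LV: "fst (L r) \<in> set V" if "r < m" for r
    using L[OF that] that by (force simp: V_def set_vars m_def)
  have g: "k = 0 \<and> u < v \<and> g r k u = Lit (V ! u, \<not> \<alpha> (V ! u)) \<or>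
      k = Suc r \<and> (u < v \<and> V ! u \<noteq> fst (L r) \<and> g r k u = Lit (V ! u, \<alpha> (V ! u)) \<or>
        u = v \<and> g r k u = Lit (fst (L r), \<alpha> (fst (L r)))) \<or>
      k = Suc r \<and> u < v \<and> V ! u = fst (L r) \<and> g r k u = Slack r \<or>
      g r k u = Filler (gadget_targets F ! pos r k u)" if "r < m" "u \<le> v" for r k u
    using L[OF that(1)] that(2) by (auto simp: g_def)
  show ?thesis
  proof (intro exI[of _ \<chi>] conjI allI impI)
    fix i assume "i < m * W"
    then obtain r k u where i: "r < m" "k \<le> m" "u \<le> v" "i = pos r k u" by (rule posE)
    have Vu: "V ! u \<in> set V" if "u < v" using that by (simp add: v_def)
    have t: "gadget_targets F ! i \<in> set (gadget_targets F)"
      using \<open>i < m * W\<close> length_targets by simp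
    show "\<chi> i \<in> set (gadget_sensors F)"
      using i(1) Vu LV[OF i(1)] t
      by (cases "L r") (auto simp: i(4) \<chi>[OF i(1-3)] g_def gadget_sensors_def m_def[symmetric] V_def[symmetric])
    show "gadget_can (\<chi> i) (gadget_targets F ! i)"
      unfolding i(4) \<chi>[OF i(1-3)] target_pos[OF i(1-3)] g_def
      using L[OF i(1)] i(3) by (auto intro!: bexI[of _ "L r"])
  next
    fix i j assume ij: "i < j" "j < m * W" "j - i \<le> m * B + v"
    from ij have "i < m * W" by simp
    then obtain r k u where i: "r < m" "k \<le> m" "u \<le> v" "i = pos r k u" by (rule posE)
    from ij(2) obtain r' k' u' where j: "r' < m" "k' \<le> m" "u' \<le> v" "j = pos r' k' u'" by (rule posE)
    show "\<chi> i \<noteq> \<chi> j"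
    proof
      assume "\<chi> i = \<chi> j"
      then have eq: "g r k u = g r' k' u'" by (simp add: i(4) j(4) \<chi>[OF i(1-3)] \<chi>[OF j(1-3)])
      have "gadget_targets F ! i \<noteq> gadget_targets F ! j"
        using ij distinct_targets[of F] length_targets by (simp add: nth_eq_iff_index_eq)
      then have filler: "Filler (gadget_targets F ! pos r k u) \<noteq> Filler (gadget_targets F ! pos r' k' u')"
        by (simp add: i(4) j(4))
      \<comment> \<open>Fillers of different targets differ, and a literal made true never equals
        one made false; two false literals, or two colours in the moving blocks, remain.\<close>
      have cases: "(k = 0 \<and> k' = 0 \<and> u = u') \<or> (k = Suc r \<and> k' = Suc r' \<and> (r = r' \<longrightarrow> u = u'))"
        using g[OF i(1,3), of k] g[OF j(1,3), of k'] V[of u u']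
        by (elim disjE conjE; simp add: eq filler) (use eq filler in auto)
      have "r' \<ge> r"
      proof (rule ccontr)
        assume "\<not> r' \<ge> r"
        then have "Suc r' * W \<le> r * W" by (intro mult_le_mono) auto
        moreover have "k' * B + u' < W" using offset_less j by simp
        ultimately have "j < i" by (simp add: i(4) j(4) pos_def)
        with ij(1) show False by simp
      qed
      moreover have "r \<noteq> r'" using cases ij(1) i(4) j(4) by auto
      ultimately have "r < r'" by simp
      have "k * B + u \<le> k' * B + u'"
      proof (cases "k = 0")
        case True
        then show ?thesis using cases by auto
      next
        case False
        \<comment> \<open>Advancing by a whole block outweighs any move to the left inside a block,
          such as the return from the extra place.\<close>
        then have "Suc k \<le> k'" using cases \<open>r < r'\<close> by auto
        then have "Suc k * B \<le> k' * B" by (intro mult_le_mono) auto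
        then show ?thesis using i(3) by (simp add: B_def)
      qed
      moreover have "Suc r * W \<le> r' * W" using \<open>r < r'\<close> by (intro mult_le_mono) auto
      ultimately have "W \<le> j - i" by (simp add: i(4) j(4) pos_def)
      with ij(3) show False by (simp add: W_def B_def)
    qed
  qed
qed

lemma sensable_gadget: "sensable (gadget_inst F) \<longleftrightarrow> satisfiable F"
proof -
  have \<tau>: "length F * Suc (length (vars F)) + length (vars F) = m * B + v"
    by (simp add: m_def B_def v_def V_def)
  show ?thesis
    unfolding gadget_inst_def \<tau> sensable_colour_inst[OF distinct_sensors] length_targets
    using satisfiable_if_colouring colouring_if_satisfiable by blast
qed

end


section \<open>The computation tableau as a formula\<close>

definition models :: "('v \<Rightarrow> bool) \<Rightarrow> 'v cnf \<Rightarrow> bool" where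
  "models \<alpha> F \<longleftrightarrow> (\<forall>c\<in>set F. \<exists>l\<in>set c. \<alpha> (fst l) = snd l)"

lemma models_simps [simp]:
  "models \<alpha> []" "models \<alpha> (c # F) \<longleftrightarrow> (\<exists>l\<in>set c. \<alpha> (fst l) = snd l) \<and> models \<alpha> F"
  "models \<alpha> (F @ G) \<longleftrightarrow> models \<alpha> F \<and> models \<alpha> G"
  "models \<alpha> (concat Fs) \<longleftrightarrow> (\<forall>F\<in>set Fs. models \<alpha> F)"
  "models \<alpha> (map f xs) \<longleftrightarrow> (\<forall>x\<in>set xs. \<exists>l\<in>set (f x). \<alpha> (fst l) = snd l)"
  by (auto simp: models_def)

lemma ball_product: "(\<forall>p\<in>set (List.product xs ys). P p) \<longleftrightarrow> (\<forall>x\<in>set xs. \<forall>y\<in>set ys. P (x, y))"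
  by auto

lemma ball_enumerate: "(\<forall>p\<in>set (List.enumerate 0 xs). P p) \<longleftrightarrow> (\<forall>i<length xs. P (i, xs ! i))"
  by (auto simp: in_set_enumerate_eq)

lemma ball_upt: "(\<forall>i\<in>set [0..<n]. P i) \<longleftrightarrow> (\<forall>i<n. P i)" "(\<exists>i\<in>set [0..<n]. P i) \<longleftrightarrow> (\<exists>i<n. P i)"
  by auto

lemma ball_filter: "(\<forall>x\<in>set (filter Q xs). P x) \<longleftrightarrow> (\<forall>x\<in>set xs. Q x \<longrightarrow> P x)"
  by auto

lemmas tableau_sets = ball_product ball_enumerate ball_upt ball_filter

type_synonym transition = "nat \<times> nat list \<times> nat \<times> nat list \<times> move list"

fun applies :: "transition \<Rightarrow> config \<Rightarrow> config \<Rightarrow> bool" where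
  "applies (q, r, q', w, m) c c' \<longleftrightarrow>
     fst c = q \<and> map read_tape (snd c) = r \<and> c' = (q', map2 act (zip w m) (snd c))"

lemma tm_step_applies: "tm_step M c c' \<longleftrightarrow> (\<exists>d\<in>delta M. applies d c c')"
proof -
  obtain q ts where c: "c = (q, ts)" by (cases c)
  show ?thesis unfolding c tm_step_iff
  proof
    assume "\<exists>q' w m. (q, map read_tape ts, q', w, m) \<in> delta M \<and> c' = (q', map2 act (zip w m) ts)"
    then obtain q' w m where "(q, map read_tape ts, q', w, m) \<in> delta M" "c' = (q', map2 act (zip w m) ts)" by blast
    then show "\<exists>d\<in>delta M. applies d (q, ts) c'" by (intro bexI) auto
  next
    assume "\<exists>d\<in>delta M. applies d (q, ts) c'"
    then obtain q0 r q' w m where "(q0, r, q', w, m) \<in> delta M" "applies (q0, r, q', w, m) (q, ts) c'"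
      by (metis surj_pair)
    then show "\<exists>q' w m. (q, map read_tape ts, q', w, m) \<in> delta M \<and> c' = (q', map2 act (zip w m) ts)"
      by auto
  qed
qed

type_synonym tvar = "nat \<times> nat \<times> nat \<times> nat"

text \<open>
  At time \<open>t\<close> the transition of index \<open>d\<close> is used; the head of tape \<open>j\<close> is on cell \<open>i\<close>;
  cell \<open>i\<close> of tape \<open>j\<close> contains \<open>a\<close>. Cell 0 of a tape has index \<open>i = L + 1\<close>,
  where \<open>L\<close> is the time of the last step.
\<close>

definition trans_var :: "nat \<Rightarrow> nat \<Rightarrow> tvar" where
  "trans_var d t = (0, d, t, 0)"

definition head_var :: "nat \<Rightarrow> nat \<Rightarrow> nat \<Rightarrow> tvar" where
  "head_var j t i = (1, j, t, i)"

definition cell_var :: "nat \<Rightarrow> nat \<Rightarrow> nat \<Rightarrow> nat \<Rightarrow> tvar" where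
  "cell_var j a t i = (Suc (Suc a), j, t, i)"

text \<open>
  Idle transitions, which keep an accepting configuration, make all accepting runs equally long.
\<close>

definition idles :: "tm \<Rightarrow> nat \<Rightarrow> transition set" where
  "idles M g = {(accept_state M, r, accept_state M, r, replicate (num_tapes M) Stay) | r.
     length r = num_tapes M \<and> set r \<subseteq> {..<g} \<and> (\<forall>a. (accept_state M, r, a) \<notin> delta M)}"

locale tableau =
  fixes M :: tm and g :: nat and ds :: "transition list"
  assumes wf: "wf_tm M" and g: "3 \<le> g"
    and symbols: "(q, r, q', w, m) \<in> delta M \<Longrightarrow> set r \<union> set w \<subseteq> {..<g}"
    and ds: "set ds = delta M \<union> idles M g"
begin

definition "src d = fst (ds ! d)"
definition "reads d = fst (snd (ds ! d))"
definition "tgt d = fst (snd (snd (ds ! d)))"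
definition "writes d = fst (snd (snd (snd (ds ! d))))"
definition "moves d = snd (snd (snd (snd (ds ! d))))"

text \<open>For a move to the left \<open>i\<close> is the new cell, otherwise the old one; no index
  is ever decremented.\<close>

definition head_clause :: "nat \<Rightarrow> nat \<Rightarrow> nat \<Rightarrow> nat \<Rightarrow> (tvar \<times> bool) list" where
  "head_clause d j t i = (case moves d ! j of
      Go_Left \<Rightarrow> [(trans_var d t, False), (head_var j t (Suc i), False), (head_var j (Suc t) i, True)]
    | Stay \<Rightarrow> [(trans_var d t, False), (head_var j t i, False), (head_var j (Suc t) i, True)]
    | Go_Right \<Rightarrow> [(trans_var d t, False), (head_var j t i, False), (head_var j (Suc t) (Suc i), True)])"

text \<open>States need no variables: the transition used at a time determines the state before and
  after it, and consecutive transitions must agree. If several are chosen at one time, any of them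
  can be followed. The idle transition at the end certifies acceptance.\<close>

definition control :: "nat \<Rightarrow> tvar cnf" where
  "control L =
     map (\<lambda>t. map (\<lambda>d. (trans_var d t, True)) [0..<length ds]) [0..<Suc L] @
     concat (map (\<lambda>p. map (\<lambda>t. [(trans_var (fst p) t, False), (trans_var (snd p) (Suc t), False)]) [0..<Suc L])
       (filter (\<lambda>p. tgt (fst p) \<noteq> src (snd p)) (List.product [0..<length ds] [0..<length ds]))) @
     map (\<lambda>d. [(trans_var d 0, False)]) (filter (\<lambda>d. src d \<noteq> start_state M) [0..<length ds]) @
     map (\<lambda>d. [(trans_var d L, False)]) (filter (\<lambda>d. ds ! d \<notin> idles M g) [0..<length ds])"

text \<open>In the steps at times 0 to \<open>L\<close> a head gets at most \<open>L + 1\<close>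
  cells away from its start in the middle, hence \<open>2 * L + 3\<close> cells.\<close>

definition effects :: "nat \<Rightarrow> tvar cnf" where
  "effects L = concat (map (\<lambda>p. concat (map (\<lambda>t. concat (map (\<lambda>i.
     [[(trans_var (fst p) t, False), (head_var (snd p) t i, False), (cell_var (snd p) (reads (fst p) ! snd p) t i, True)],
      [(trans_var (fst p) t, False), (head_var (snd p) t i, False), (cell_var (snd p) (writes (fst p) ! snd p) (Suc t) i, True)],
      head_clause (fst p) (snd p) t i]) [0..<2 * L + 3])) [0..<Suc L]))
     (List.product [0..<length ds] [0..<num_tapes M]))"

text \<open>Apart from persistence away from the head, only uniqueness is demanded; existence of a
  symbol in each cell and of a head position follows from the start by induction over time.\<close>

definition frame :: "nat \<Rightarrow> tvar cnf" where
  "frame L = concat (map (\<lambda>j. concat (map (\<lambda>t. concat (map (\<lambda>i.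
     map (\<lambda>a. [(cell_var j a t i, False), (head_var j t i, True), (cell_var j a (Suc t) i, True)]) [0..<g] @
     map (\<lambda>p. [(cell_var j (fst p) t i, False), (cell_var j (snd p) t i, False)])
       (filter (\<lambda>p. fst p \<noteq> snd p) (List.product [0..<g] [0..<g])) @
     map (\<lambda>i'. [(head_var j t i, False), (head_var j t i', False)]) (filter (\<lambda>i'. i \<noteq> i') [0..<2 * L + 3]))
     [0..<2 * L + 3])) [0..<Suc L])) [0..<num_tapes M])"

definition start :: "bool list \<Rightarrow> nat \<Rightarrow> tvar cnf" where
  "start x L =
     map (\<lambda>p. [(cell_var 0 (if snd p then 2 else 1) 0 (fst p + Suc L), True)]) (List.enumerate 0 x) @
     concat (map (\<lambda>j. concat (map (\<lambda>i.
       if j = 0 \<and> Suc L \<le> i \<and> i < Suc L + length x then [] else [[(cell_var j 0 0 i, True)]])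
       [0..<2 * L + 3])) [0..<num_tapes M]) @
     map (\<lambda>j. [(head_var j 0 (Suc L), True)]) [0..<num_tapes M]"

definition formula :: "bool list \<Rightarrow> nat \<Rightarrow> tvar cnf" where
  "formula x L = control L @ effects L @ frame L @ start x L"

section \<open>The groups of clauses as conditions on an assignment\<close>

lemma models_control:
  "models \<alpha> (control L) \<longleftrightarrow>
     (\<forall>t\<le>L. \<exists>d<length ds. \<alpha> (trans_var d t)) \<and>
     (\<forall>d<length ds. \<forall>d'<length ds. \<forall>t\<le>L. \<alpha> (trans_var d t) \<longrightarrow> \<alpha> (trans_var d' (Suc t)) \<longrightarrow> tgt d = src d') \<and>
     (\<forall>d<length ds. \<alpha> (trans_var d 0) \<longrightarrow> src d = start_state M) \<and>
     (\<forall>d<length ds. \<alpha> (trans_var d L) \<longrightarrow> ds ! d \<in> idles M g)"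
proof -
  have 1: "models \<alpha> (map (\<lambda>t. map (\<lambda>d. (trans_var d t, True)) [0..<length ds]) [0..<Suc L]) \<longleftrightarrow>
    (\<forall>t\<le>L. \<exists>d<length ds. \<alpha> (trans_var d t))"
    by (simp only: models_simps(5) set_map bex_simps ball_upt less_Suc_eq_le fst_conv snd_conv) simp
  have 2: "models \<alpha> (concat (map (\<lambda>p. map (\<lambda>t. [(trans_var (fst p) t, False), (trans_var (snd p) (Suc t), False)]) [0..<Suc L])
       (filter (\<lambda>p. tgt (fst p) \<noteq> src (snd p)) (List.product [0..<length ds] [0..<length ds])))) \<longleftrightarrow>
    (\<forall>d<length ds. \<forall>d'<length ds. tgt d \<noteq> src d' \<longrightarrow>
      (\<forall>t\<le>L. \<not> \<alpha> (trans_var d t) \<or> \<not> \<alpha> (trans_var d' (Suc t))))"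
    by (simp only: models_simps(4,5) set_map ball_simps ball_filter ball_product ball_upt less_Suc_eq_le fst_conv snd_conv) simp
  have 3: "models \<alpha> (map (\<lambda>d. [(trans_var d t, False)]) (filter Q [0..<length ds])) \<longleftrightarrow>
    (\<forall>d<length ds. Q d \<longrightarrow> \<not> \<alpha> (trans_var d t))" for Q t
    by auto
  show ?thesis unfolding control_def models_simps(3) 1 2 3 by blast
qed

lemma models_effects:
  "models \<alpha> (effects L) \<longleftrightarrow> (\<forall>d<length ds. \<forall>j<num_tapes M. \<forall>t\<le>L. \<forall>i<2 * L + 3.
     (\<alpha> (trans_var d t) \<longrightarrow> \<alpha> (head_var j t i) \<longrightarrow>
       \<alpha> (cell_var j (reads d ! j) t i) \<and> \<alpha> (cell_var j (writes d ! j) (Suc t) i)) \<and>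
     (\<exists>l\<in>set (head_clause d j t i). \<alpha> (fst l) = snd l))"
proof -
  have 1: "models \<alpha> [[(trans_var d t, False), (head_var j t i, False), (cell_var j a t i, True)],
      [(trans_var d t, False), (head_var j t i, False), (cell_var j b (Suc t) i, True)], c] \<longleftrightarrow>
    (\<alpha> (trans_var d t) \<longrightarrow> \<alpha> (head_var j t i) \<longrightarrow> \<alpha> (cell_var j a t i) \<and> \<alpha> (cell_var j b (Suc t) i)) \<and>
    (\<exists>l\<in>set c. \<alpha> (fst l) = snd l)" for d j t i a b c
    by auto
  show ?thesis unfolding effects_def
    by (simp only: models_simps(4) set_map ball_simps ball_product ball_upt less_Suc_eq_le fst_conv snd_conv 1)
qed

lemma models_frame:
  "models \<alpha> (frame L) \<longleftrightarrow> (\<forall>j<num_tapes M. \<forall>t\<le>L. \<forall>i<2 * L + 3.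
     (\<forall>a<g. \<alpha> (cell_var j a t i) \<longrightarrow> \<not> \<alpha> (head_var j t i) \<longrightarrow> \<alpha> (cell_var j a (Suc t) i)) \<and>
     (\<forall>a<g. \<forall>b<g. \<alpha> (cell_var j a t i) \<longrightarrow> \<alpha> (cell_var j b t i) \<longrightarrow> a = b) \<and>
     (\<forall>i'<2 * L + 3. \<alpha> (head_var j t i) \<longrightarrow> \<alpha> (head_var j t i') \<longrightarrow> i = i'))"
proof -
  have 1: "models \<alpha> (map (\<lambda>a. [(cell_var j a t i, False), (head_var j t i, True), (cell_var j a (Suc t) i, True)]) [0..<g]) \<longleftrightarrow>
    (\<forall>a<g. \<alpha> (cell_var j a t i) \<longrightarrow> \<not> \<alpha> (head_var j t i) \<longrightarrow> \<alpha> (cell_var j a (Suc t) i))" for j t i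
    unfolding models_simps tableau_sets by auto
  have 2: "models \<alpha> (map (\<lambda>p. [(cell_var j (fst p) t i, False), (cell_var j (snd p) t i, False)])
       (filter (\<lambda>p. fst p \<noteq> snd p) (List.product [0..<g] [0..<g]))) \<longleftrightarrow>
    (\<forall>a<g. \<forall>b<g. \<alpha> (cell_var j a t i) \<longrightarrow> \<alpha> (cell_var j b t i) \<longrightarrow> a = b)" for j t i
    unfolding models_simps tableau_sets by auto
  have 3: "models \<alpha> (map (\<lambda>i'. [(head_var j t i, False), (head_var j t i', False)]) (filter (\<lambda>i'. i \<noteq> i') [0..<2 * L + 3])) \<longleftrightarrow>
    (\<forall>i'<2 * L + 3. \<alpha> (head_var j t i) \<longrightarrow> \<alpha> (head_var j t i') \<longrightarrow> i = i')" for j t i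
    unfolding models_simps tableau_sets by auto
  show ?thesis unfolding frame_def
    by (simp only: models_simps(3,4) set_map ball_simps ball_upt less_Suc_eq_le 1 2 3)
qed

lemma models_start:
  "models \<alpha> (start x L) \<longleftrightarrow>
     (\<forall>i<length x. \<alpha> (cell_var 0 (if x ! i then 2 else 1) 0 (i + Suc L))) \<and>
     (\<forall>j<num_tapes M. \<forall>i<2 * L + 3. (j = 0 \<and> Suc L \<le> i \<and> i < Suc L + length x) \<or> \<alpha> (cell_var j 0 0 i)) \<and>
     (\<forall>j<num_tapes M. \<alpha> (head_var j 0 (Suc L)))"
proof -
  have 1: "models \<alpha> (map (\<lambda>p. [(cell_var 0 (if snd p then 2 else 1) 0 (fst p + Suc L), True)]) (List.enumerate 0 x)) \<longleftrightarrow>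
    (\<forall>i<length x. \<alpha> (cell_var 0 (if x ! i then 2 else 1) 0 (i + Suc L)))"
    unfolding models_simps ball_enumerate by simp
  have 0: "models \<alpha> (if b then [] else [[(y, True)]]) \<longleftrightarrow> b \<or> \<alpha> y" for b y
    by simp
  have 2: "models \<alpha> (concat (map (\<lambda>j. concat (map (\<lambda>i.
       if j = 0 \<and> Suc L \<le> i \<and> i < Suc L + length x then [] else [[(cell_var j 0 0 i, True)]])
       [0..<2 * L + 3])) [0..<num_tapes M])) \<longleftrightarrow>
    (\<forall>j<num_tapes M. \<forall>i<2 * L + 3. (j = 0 \<and> Suc L \<le> i \<and> i < Suc L + length x) \<or> \<alpha> (cell_var j 0 0 i))"
    by (simp only: models_simps(4) set_map ball_simps ball_upt 0)
  have 3: "models \<alpha> (map (\<lambda>j. [(head_var j 0 (Suc L), True)]) [0..<num_tapes M]) \<longleftrightarrow>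
    (\<forall>j<num_tapes M. \<alpha> (head_var j 0 (Suc L)))"
    by auto
  show ?thesis unfolding start_def models_simps(3) 1 2 3 ..
qed

lemma ds_cases:
  assumes "d < length ds"
  shows "ds ! d = (src d, reads d, tgt d, writes d, moves d)"
    and "length (reads d) = num_tapes M" "length (writes d) = num_tapes M" "length (moves d) = num_tapes M"
    and "set (reads d) \<subseteq> {..<g}" "set (writes d) \<subseteq> {..<g}"
proof -
  show *: "ds ! d = (src d, reads d, tgt d, writes d, moves d)"
    by (simp add: src_def reads_def tgt_def writes_def moves_def)
  have "ds ! d \<in> delta M \<union> idles M g" using assms ds nth_mem by blast
  then have "(length (reads d) = num_tapes M \<and> length (writes d) = num_tapes M \<and> length (moves d) = num_tapes M) \<and>
    set (reads d) \<subseteq> {..<g} \<and> set (writes d) \<subseteq> {..<g}"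
  proof
    assume "ds ! d \<in> delta M"
    then show ?thesis using wf symbols unfolding * wf_tm_def by fastforce
  next
    assume "ds ! d \<in> idles M g"
    then show ?thesis unfolding * idles_def by auto
  qed
  then show "length (reads d) = num_tapes M" "length (writes d) = num_tapes M" "length (moves d) = num_tapes M"
    "set (reads d) \<subseteq> {..<g}" "set (writes d) \<subseteq> {..<g}" by auto
qed

text \<open>An idle transition is provided only for words on which the accepting state has no proper
  transition, so its use proves that the configuration halts.\<close>

lemma idle_applies:
  assumes "d \<in> idles M g" "applies d c c'"
  shows "c' = c" "halting M c" "fst c = accept_state M"
proof -
  obtain q ts where c: "c = (q, ts)" by (cases c)
  from assms obtain r where r: "map read_tape ts = r" "q = accept_state M" "length r = num_tapes M"
    "\<forall>a. (accept_state M, r, a) \<notin> delta M"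
    "c' = (accept_state M, map2 act (zip r (replicate (num_tapes M) Stay)) ts)"
    by (auto simp: idles_def c)
  have "length ts = num_tapes M" using r by auto
  then have "map2 act (zip r (replicate (num_tapes M) Stay)) ts = ts"
    using r(1,3) by (intro nth_equalityI) (auto simp del: act.simps)
  then show "c' = c" "fst c = accept_state M" using r c by auto
  show "halting M c" using r(1,2,4) by (auto simp: halting_def c tm_step_iff)
qed

lemma applies_run: "d < length ds \<Longrightarrow> applies (ds ! d) c c' \<Longrightarrow> (tm_step M)\<^sup>*\<^sup>* c c'"
  using ds nth_mem[of d ds] idle_applies(1) tm_step_applies by (metis UnE r_into_rtranclp rtranclp.rtrancl_refl)

lemma initial_tapes:
  "length (snd (initial M x)) = num_tapes M"
  "j < num_tapes M \<Longrightarrow> snd (initial M x) ! j = (if j = 0 then tape_of x else (\<lambda>_. 0), 0)"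
  using wf by (auto simp: initial_def wf_tm_def nth_Cons')

text \<open>One chosen transition is followed at each time. \<open>holds\<close> says that the
  assignment describes the tapes and that all chosen transitions start in the current state; it also
  keeps the heads within \<open>t\<close> cells of the start, hence inside the window.\<close>

lemma accepts_if_models:
  assumes "models \<alpha> (formula x L)"
  shows "accepts M x"
proof -
  have F: "models \<alpha> (control L)" "models \<alpha> (effects L)" "models \<alpha> (frame L)" "models \<alpha> (start x L)"
    using assms by (simp_all add: formula_def)
  have some: "\<exists>d<length ds. \<alpha> (trans_var d t)" if "t \<le> L" for t
    using F(1) that unfolding models_control by blast
  have compat: "tgt d = src d'" if "\<alpha> (trans_var d t)" "\<alpha> (trans_var d' (Suc t))" "t \<le> L" "d < length ds" "d' < length ds" for d d' t
    using F(1) that unfolding models_control by blast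
  have first: "src d = start_state M" if "\<alpha> (trans_var d 0)" "d < length ds" for d
    using F(1) that unfolding models_control by blast
  have last: "ds ! d \<in> idles M g" if "\<alpha> (trans_var d L)" "d < length ds" for d
    using F(1) that unfolding models_control by blast
  have eff: "\<alpha> (cell_var j (reads d ! j) t i)" "\<alpha> (cell_var j (writes d ! j) (Suc t) i)"
    if "\<alpha> (trans_var d t)" "\<alpha> (head_var j t i)" "t \<le> L" "d < length ds" "j < num_tapes M" "i < 2 * L + 3" for d j t i
    using F(2) that unfolding models_effects by blast+
  have hd: "\<exists>l\<in>set (head_clause d j t i). \<alpha> (fst l) = snd l"
    if "t \<le> L" "d < length ds" "j < num_tapes M" "i < 2 * L + 3" for d j t i
    using F(2) that unfolding models_effects by blast
  have keep: "\<alpha> (cell_var j a (Suc t) i)"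
    if "\<alpha> (cell_var j a t i)" "\<not> \<alpha> (head_var j t i)" "t \<le> L" "j < num_tapes M" "i < 2 * L + 3" "a < g" for j t i a
    using F(3) that unfolding models_frame by blast
  have cell_unique: "a = b"
    if "\<alpha> (cell_var j a t i)" "\<alpha> (cell_var j b t i)" "t \<le> L" "j < num_tapes M" "i < 2 * L + 3" "a < g" "b < g" for j t i a b
    using F(3) that unfolding models_frame by blast
  have head_unique: "i = i'"
    if "\<alpha> (head_var j t i)" "\<alpha> (head_var j t i')" "t \<le> L" "j < num_tapes M" "i < 2 * L + 3" "i' < 2 * L + 3" for j t i i'
    using F(3) that unfolding models_frame by blast
  define holds where "holds t c \<longleftrightarrow> length (snd c) = num_tapes M \<and>
    (\<forall>d<length ds. \<alpha> (trans_var d t) \<longrightarrow> src d = fst c) \<and>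
    (\<forall>j<num_tapes M. \<bar>snd (snd c ! j)\<bar> \<le> int t \<and> (\<forall>z. fst (snd c ! j) z < g) \<and>
       \<alpha> (head_var j t (nat (snd (snd c ! j) + int (Suc L)))) \<and>
       (\<forall>i<2 * L + 3. \<alpha> (cell_var j (fst (snd c ! j) (int i - int (Suc L))) t i)))" for t c
  have init: "holds 0 (initial M x)"
    unfolding holds_def
  proof (intro conjI allI impI)
    fix d assume "d < length ds" "\<alpha> (trans_var d 0)"
    then show "src d = fst (initial M x)" using first by (simp add: initial_def)
  next
    fix j i assume j: "j < num_tapes M" and i: "i < 2 * L + 3"
    let ?a = "fst (snd (initial M x) ! j) (int i - int (Suc L))"
    show "\<alpha> (cell_var j ?a 0 i)"
    proof (cases "j = 0 \<and> Suc L \<le> i \<and> i < Suc L + length x")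
      case True
      then obtain n where n: "i = n + Suc L" "n < length x" by (metis add.commute le_Suc_ex nat_add_left_cancel_less)
      then have "\<alpha> (cell_var 0 (if x ! n then 2 else 1) 0 (n + Suc L))" using F(4) unfolding models_start by blast
      moreover have "?a = (if x ! n then 2 else 1)"
        using True n j by (simp add: initial_tapes tape_of_def)
      ultimately show ?thesis using True n by simp
    next
      case False
      then have "?a = 0" using j by (auto simp: initial_tapes tape_of_def)
      moreover have "\<alpha> (cell_var j 0 0 i)" using F(4) False i j unfolding models_start by blast
      ultimately show ?thesis by simp
    qed
  next
    fix j assume j: "j < num_tapes M"
    show "\<alpha> (head_var j 0 (nat (snd (snd (initial M x) ! j) + int (Suc L))))"
      using F(4) j unfolding models_start by (simp add: initial_tapes nat_add_distrib)
  qed (use g in \<open>auto simp: initial_tapes tape_of_def\<close>)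
  \<comment> \<open>Uniqueness of the cell contents identifies the symbol that the transition
    demands with the one on the tape.\<close>
  have reads: "map read_tape (snd c) = reads d" if h: "holds t c" and d: "\<alpha> (trans_var d t)" "d < length ds" "t \<le> L" for t c d
  proof (rule nth_equalityI)
    show "length (map read_tape (snd c)) = length (reads d)" using h d by (simp add: holds_def ds_cases)
    fix j assume "j < length (map read_tape (snd c))"
    then have j: "j < num_tapes M" using h by (simp add: holds_def)
    let ?p = "snd (snd c ! j)" let ?i = "nat (?p + int (Suc L))"
    have p: "\<bar>?p\<bar> \<le> int t" "\<alpha> (head_var j t ?i)" using h j by (auto simp: holds_def)
    then have i: "?i < 2 * L + 3" "int ?i - int (Suc L) = ?p" using d by auto
    have "\<alpha> (cell_var j (fst (snd c ! j) (int ?i - int (Suc L))) t ?i)" using h j i(1) unfolding holds_def by blast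
    then have "\<alpha> (cell_var j (read_tape (snd c ! j)) t ?i)" unfolding i(2) by (simp add: read_tape_eq)
    moreover have "\<alpha> (cell_var j (reads d ! j) t ?i)" using eff(1) d p i(1) j by blast
    moreover have "read_tape (snd c ! j) < g" using h j by (auto simp: holds_def read_tape_eq)
    moreover have "reads d ! j < g" using ds_cases(2,5)[OF d(2)] j by (metis lessThan_iff nth_mem subsetD)
    ultimately have "read_tape (snd c ! j) = reads d ! j" using cell_unique d i j by blast
    then show "map read_tape (snd c) ! j = reads d ! j" using h j by (simp add: holds_def)
  qed
  have step: "\<exists>c'. (tm_step M)\<^sup>*\<^sup>* c c' \<and> holds (Suc t) c'" if h: "holds t c" and t: "t < L" for t c
  proof -
    obtain d where d: "d < length ds" "\<alpha> (trans_var d t)" using some[of t] t by auto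
    let ?c' = "(tgt d, map2 act (zip (writes d) (moves d)) (snd c))"
    have len: "length (snd c) = num_tapes M" using h by (simp add: holds_def)
    have "applies (ds ! d) c ?c'"
      using ds_cases(1)[OF d(1)] reads[OF h d(2,1)] h d t by (auto simp: holds_def)
    then have "(tm_step M)\<^sup>*\<^sup>* c ?c'" by (rule applies_run[OF d(1)])
    moreover have "holds (Suc t) ?c'"
      unfolding holds_def
    proof (intro conjI allI impI)
      show "length (snd ?c') = num_tapes M" using len ds_cases[OF d(1)] by simp
      show "src d' = fst ?c'" if "d' < length ds" "\<alpha> (trans_var d' (Suc t))" for d'
        using compat[OF d(2) that(2)] d(1) that(1) t by simp
    next
      fix j assume j: "j < num_tapes M"
      let ?p = "snd (snd c ! j)" let ?i = "nat (?p + int (Suc L))"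
      have j': "snd ?c' ! j = act (writes d ! j, moves d ! j) (snd c ! j)"
        using len ds_cases[OF d(1)] j by simp
      have f: "fst (snd ?c' ! j) = (fst (snd c ! j))(?p := writes d ! j)"
        and p': "snd (snd ?c' ! j) = ?p + shift (moves d ! j)" unfolding j' act_eq by simp_all
      have p: "\<bar>?p\<bar> \<le> int t" "\<alpha> (head_var j t ?i)" using h j by (auto simp: holds_def)
      have sh: "\<bar>shift (moves d ! j)\<bar> \<le> 1" by (cases "moves d ! j") auto
      show "\<bar>snd (snd ?c' ! j)\<bar> \<le> int (Suc t)" unfolding p' using p sh by linarith
      have w: "writes d ! j < g" using ds_cases(3,6)[OF d(1)] j by (metis lessThan_iff nth_mem subsetD)
      show "fst (snd ?c' ! j) z < g" for z unfolding f using w h j by (auto simp: holds_def)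
      have i: "?i < 2 * L + 3" using p(1) t by auto
      show "\<alpha> (head_var j (Suc t) (nat (snd (snd ?c' ! j) + int (Suc L))))"
      proof (cases "moves d ! j")
        case Go_Left
        \<comment> \<open>The clause for a left move is indexed by the cell that the head enters,
          one below \<open>?i\<close>.\<close>
        have "?i = Suc (nat (?p + int L))" using p(1) t by (simp add: nat_eq_iff)
        moreover have e: "snd (snd ?c' ! j) + int (Suc L) = ?p + int L" unfolding p' Go_Left by simp
        moreover have "nat (?p + int L) < 2 * L + 3" using i by simp
        ultimately show ?thesis
          unfolding e using hd[of t d j "nat (?p + int L)"] d j t p(2) by (auto simp: head_clause_def Go_Left)
      next
        case Stay
        have "snd (snd ?c' ! j) + int (Suc L) = ?p + int (Suc L)" unfolding p' Stay by simp
        then show ?thesis using hd[of t d j ?i] d j t i p(2) by (auto simp: head_clause_def Stay)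
      next
        case Go_Right
        have "nat (snd (snd ?c' ! j) + int (Suc L)) = Suc ?i" unfolding p' Go_Right using p(1) t by (simp add: nat_eq_iff)
        then show ?thesis using hd[of t d j ?i] d j t i p(2) by (auto simp: head_clause_def Go_Right)
      qed
      show "\<alpha> (cell_var j (fst (snd ?c' ! j) (int i - int (Suc L))) (Suc t) i)" if i': "i < 2 * L + 3" for i
      proof (cases "i = ?i")
        case True
        then have "int i - int (Suc L) = ?p" using p(1) t by auto
        then show ?thesis unfolding f using eff(2)[OF d(2) p(2)] d(1) j t i True by simp
      next
        case False
        then have "int i - int (Suc L) \<noteq> ?p" by auto
        moreover have "\<not> \<alpha> (head_var j t i)" using head_unique[OF _ p(2)] False t j i i' by auto
        moreover have "\<alpha> (cell_var j (fst (snd c ! j) (int i - int (Suc L))) t i)" "fst (snd c ! j) (int i - int (Suc L)) < g"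
          using h j i' unfolding holds_def by blast+
        ultimately show ?thesis unfolding f using keep t j i' by simp
      qed
    qed
    ultimately show ?thesis by blast
  qed
  have "\<exists>c. (tm_step M)\<^sup>*\<^sup>* (initial M x) c \<and> holds t c" if "t \<le> L" for t
    using that
  proof (induction t)
    case 0
    show ?case using init by blast
  next
    case (Suc t)
    then obtain c where "(tm_step M)\<^sup>*\<^sup>* (initial M x) c" "holds t c" by auto
    with step[of t c] Suc.prems show ?case by (metis Suc_le_lessD rtranclp_trans)
  qed
  then obtain c where c: "(tm_step M)\<^sup>*\<^sup>* (initial M x) c" "holds L c" by blast
  obtain d where d: "d < length ds" "\<alpha> (trans_var d L)" using some[of L] by auto
  have "applies (ds ! d) c (tgt d, map2 act (zip (writes d) (moves d)) (snd c))"
    using ds_cases(1)[OF d(1)] reads[OF c(2) d(2,1)] c(2) d by (auto simp: holds_def)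
  from idle_applies(2,3)[OF last[OF d(2,1)] this] show ?thesis
    unfolding accepts_def using c(1) by blast
qed

text \<open>Symbols stay below \<open>g\<close> throughout a run, so the word under the heads of a
  final configuration is among those that have an idle transition.\<close>

lemma run_bounds:
  assumes "(tm_step M ^^ n) (initial M x) c"
  shows "length (snd c) = num_tapes M" "j < num_tapes M \<Longrightarrow> fst (snd c ! j) z < g"
proof -
  have "length (snd c) = num_tapes M \<and> (\<forall>j<num_tapes M. \<forall>z. fst (snd c ! j) z < g)"
    using assms
  proof (induction n arbitrary: c)
    case 0
    then show ?case using g by (auto simp: initial_tapes tape_of_def)
  next
    case (Suc n)
    then obtain b where b: "(tm_step M ^^ n) (initial M x) b" "tm_step M b c" by auto
    then obtain e where "e \<in> delta M" "applies e b c" unfolding tm_step_applies by blast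
    then obtain q r q' w m where d: "(q, r, q', w, m) \<in> delta M" "applies (q, r, q', w, m) b c"
      by (cases e) blast
    have len: "length r = num_tapes M" "length w = num_tapes M" "length m = num_tapes M"
      using wf d(1) unfolding wf_tm_def by auto
    have w: "w ! j < g" if "j < num_tapes M" for j
      using symbols[OF d(1)] len that by (metis Un_subset_iff lessThan_iff nth_mem subsetD)
    have b': "length (snd b) = num_tapes M" "\<And>j z. j < num_tapes M \<Longrightarrow> fst (snd b ! j) z < g"
      using Suc.IH[OF b(1)] by auto
    have c: "snd c = map2 act (zip w m) (snd b)" using d(2) by simp
    have "length (snd c) = num_tapes M" unfolding c using b' len by simp
    moreover have "fst (snd c ! j) z < g" if "j < num_tapes M" for j z
      unfolding c using b' len w[OF that] that by (simp add: act_eq del: act.simps)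
    ultimately show ?case by blast
  qed
  then show "length (snd c) = num_tapes M" "j < num_tapes M \<Longrightarrow> fst (snd c ! j) z < g" by auto
qed

text \<open>The run is prolonged by idling in its last configuration, one transition is picked for
  each step, and the assignment is read off.\<close>

lemma models_if_accepting_run:
  assumes run: "(tm_step M ^^ n) (initial M x) c" and "halting M c" "fst c = accept_state M" "n \<le> L"
  shows "\<exists>\<alpha>. models \<alpha> (formula x L)"
proof -
  obtain f where f: "f 0 = initial M x" "f n = c" "\<And>i. i < n \<Longrightarrow> tm_step M (f i) (f (Suc i))"
    using run unfolding relpowp_fun_conv by blast
  define cs where "cs t = f (min t n)" for t
  have runs: "(tm_step M ^^ min t n) (initial M x) (cs t)" for t
    unfolding relpowp_fun_conv cs_def using f by (intro exI[of _ f]) auto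
  note bounds = run_bounds[OF runs]
  have "\<exists>d<length ds. applies (ds ! d) (cs t) (cs (Suc t)) \<and> (n \<le> t \<longrightarrow> ds ! d \<in> idles M g)" for t
  proof (cases "t < n")
    case True
    then have "tm_step M (cs t) (cs (Suc t))" using f(3)[of t] by (simp add: cs_def min_def)
    then obtain d where "d \<in> delta M" "applies d (cs t) (cs (Suc t))" unfolding tm_step_applies by blast
    with ds True show ?thesis by (metis UnCI in_set_conv_nth not_le)
  next
    case False
    then have c: "cs t = c" "cs (Suc t) = c" using f by (auto simp: cs_def)
    let ?r = "map read_tape (snd c)"
    let ?d = "(accept_state M, ?r, accept_state M, ?r, replicate (num_tapes M) Stay)"
    have len: "length (snd c) = num_tapes M" and lt: "\<And>j. j < num_tapes M \<Longrightarrow> read_tape (snd c ! j) < g"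
      using bounds(1)[of t] bounds(2)[of _ t] by (auto simp: c read_tape_eq)
    have "a \<notin> {a. (accept_state M, ?r, a) \<in> delta M}" for a
    proof
      assume "a \<in> {a. (accept_state M, ?r, a) \<in> delta M}"
      moreover obtain q' w m where "a = (q', w, m)" by (metis surj_pair)
      ultimately have "applies (accept_state M, ?r, a) c (q', map2 act (zip w m) (snd c))"
        using assms(3) by auto
      with \<open>a \<in> _\<close> have "tm_step M c (q', map2 act (zip w m) (snd c))" unfolding tm_step_applies by blast
      with assms(2) show False by (auto simp: halting_def)
    qed
    moreover have "set ?r \<subseteq> {..<g}"
    proof
      fix a assume "a \<in> set ?r"
      then obtain j where "j < length (snd c)" "a = read_tape (snd c ! j)"
        by (metis in_set_conv_nth length_map nth_map)
      with len lt show "a \<in> {..<g}" by simp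
    qed
    ultimately have "?d \<in> idles M g" unfolding idles_def using len by auto
    moreover have "map2 act (zip ?r (replicate (num_tapes M) Stay)) (snd c) = snd c"
      using len by (intro nth_equalityI) (auto simp del: act.simps)
    then have "applies ?d c c" using assms(3) by (cases c) auto
    ultimately show ?thesis using ds unfolding c by (metis UnCI in_set_conv_nth)
  qed
  then obtain dn where dn: "\<And>t. dn t < length ds" "\<And>t. applies (ds ! dn t) (cs t) (cs (Suc t))"
    "\<And>t. n \<le> t \<Longrightarrow> ds ! dn t \<in> idles M g" by metis
  have app: "fst (cs t) = src (dn t)" "map read_tape (snd (cs t)) = reads (dn t)"
    "cs (Suc t) = (tgt (dn t), map2 act (zip (writes (dn t)) (moves (dn t))) (snd (cs t)))" for t
    using dn(2)[of t] unfolding ds_cases(1)[OF dn(1)] by auto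
  have tape: "snd (cs (Suc t)) ! j = act (writes (dn t) ! j, moves (dn t) ! j) (snd (cs t) ! j)" if "j < num_tapes M" for t j
    using bounds(1)[of t] ds_cases[OF dn(1)[of t]] that unfolding app(3) by simp
  have read: "fst (snd (cs t) ! j) (snd (snd (cs t) ! j)) = reads (dn t) ! j" if "j < num_tapes M" for t j
    using bounds(1)[of t] that unfolding app(2)[symmetric] by (simp add: read_tape_eq)
  define \<alpha> :: "tvar \<Rightarrow> bool" where "\<alpha> y = (case y of (k, j, t, i) \<Rightarrow>
     if k = 0 then j = dn t
     else if k = 1 then int i - int (Suc L) = snd (snd (cs t) ! j)
     else fst (snd (cs t) ! j) (int i - int (Suc L)) = k - 2)" for y
  have \<alpha>: "\<alpha> (trans_var d t) \<longleftrightarrow> d = dn t" "\<alpha> (head_var j t i) \<longleftrightarrow> int i - int (Suc L) = snd (snd (cs t) ! j)"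
    "\<alpha> (cell_var j a t i) \<longleftrightarrow> fst (snd (cs t) ! j) (int i - int (Suc L)) = a" for d j t i a
    by (simp_all add: \<alpha>_def trans_var_def head_var_def cell_var_def)
  have init: "cs 0 = initial M x" using f by (simp add: cs_def)
  have head: "\<exists>l\<in>set (head_clause d j t i). \<alpha> (fst l) = snd l" if "j < num_tapes M" for d j t i
    using tape[OF that, of t] by (auto simp: head_clause_def \<alpha> act_eq simp del: act.simps split: move.split)
  have "models \<alpha> (control L)"
    unfolding models_control \<alpha> using dn(1,3) assms(4) app(1)[of 0] app(1)[of "Suc _"] unfolding app(3)
    by (auto simp: init initial_def)
  moreover have "models \<alpha> (effects L)"
    unfolding models_effects \<alpha> using head read tape by (auto simp: act_eq simp del: act.simps)
  moreover have "models \<alpha> (frame L)"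
    unfolding models_frame \<alpha> using tape by (auto simp: act_eq simp del: act.simps)
  moreover have "models \<alpha> (start x L)"
    using wf unfolding models_start \<alpha> init by (auto simp: initial_tapes tape_of_def wf_tm_def)
  ultimately show ?thesis by (auto simp: formula_def)
qed

text \<open>\<open>L\<close> bounds every run, so an accepting run has ended by time
  \<open>L\<close> and the prolongation by idle steps applies.\<close>

lemma satisfiable_formula:
  assumes "\<And>n c. (tm_step M ^^ n) (initial M x) c \<Longrightarrow> n \<le> L"
  shows "satisfiable (formula x L) \<longleftrightarrow> accepts M x"
proof -
  have "accepts M x \<longleftrightarrow> (\<exists>n c. (tm_step M ^^ n) (initial M x) c \<and> halting M c \<and> fst c = accept_state M)"
    unfolding accepts_def by (auto simp: rtranclp_power)
  then show ?thesis
    using accepts_if_models models_if_accepting_run assms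
    unfolding satisfiable_def models_def[symmetric] by blast
qed

end


section \<open>NP-hardness\<close>

instantiation sym :: enc
begin
definition "enc s = enc (sym_bits s)"
instance
proof
  fix s t :: sym
  show "enc s = enc t \<longleftrightarrow> s = t" by (cases s; cases t) (auto simp: enc_sym_def)
qed
end

section \<open>Computability of the encodings and of the reduction\<close>

lemma ptc_Bit [ptc_intros]: "ptc f \<Longrightarrow> ptc (\<lambda>z. Bit (f z))"
  by (rule ptc_recode[of "\<lambda>z. [False, f z]"]) (auto simp: enc_sym_def intro!: ptc_intros)

lemma ptc_sym_bits [ptc_intros]: "ptc f \<Longrightarrow> ptc (\<lambda>z. sym_bits (f z))"
  by (rule ptc_recode[of f]) (simp_all add: enc_sym_def)

lemma ptc_to_bits [ptc_intros]: "ptc f \<Longrightarrow> ptc (\<lambda>z. to_bits (f z))"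
  unfolding to_bits_def by (intro ptc_intros)

lemma ptc_enc_bools [ptc_intros]: "ptc f \<Longrightarrow> ptc (\<lambda>z. enc_bools (f z))"
  unfolding enc_bools_def by (intro ptc_intros)

lemma ptc_enc_nat [ptc_intros]: "ptc f \<Longrightarrow> ptc (\<lambda>z. enc_nat (f z))"
  unfolding Defs.enc_nat_def by (intro ptc_intros)

lemma ptc_enc_ratio [ptc_intros]: "ptc f \<Longrightarrow> ptc (\<lambda>z. enc_ratio (f z))"
proof -
  assume "ptc f"
  then have "ptc (\<lambda>z. enc_nat (fst (f z)) @ enc_nat (snd (f z)))" by (intro ptc_intros)
  moreover have "enc_nat (fst r) @ enc_nat (snd r) = enc_ratio r" for r by (cases r) simp
  ultimately show ?thesis by simp
qed

lemma ptc_enc_list: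
  assumes "ptc (\<lambda>x. e x)" "ptc f"
  shows "ptc (\<lambda>z. enc_list e (f z))"
proof -
  have "ptc (\<lambda>q. e (snd q))" by (rule ptc_comp[OF ptc_snd[OF ptc_id] assms(1)])
  then show ?thesis unfolding Defs.enc_list_def by (intro ptc_intros assms)
qed

lemma ptc_enc_lists [ptc_intros]:
  "ptc f \<Longrightarrow> ptc (\<lambda>z. enc_list enc_ratio (f z))"
  "ptc g \<Longrightarrow> ptc (\<lambda>z. enc_list enc_bools (g z))"
  "ptc h \<Longrightarrow> ptc (\<lambda>z. enc_list enc_nat (h z))"
  by (intro ptc_enc_list ptc_intros; assumption)+

lemma ptc_upt_Suc [ptc_intros]: "ptc f \<Longrightarrow> ptc (\<lambda>z. [0..<Suc (length (f z))])"
proof -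
  assume "ptc f"
  then have "ptc (\<lambda>z. [0..<length (undefined # f z)])" by (intro ptc_intros)
  then show ?thesis by simp
qed

lemma ptc_vars [ptc_intros]: "ptc F \<Longrightarrow> ptc (\<lambda>z. vars (F z))"
  unfolding vars_def by (intro ptc_intros)

lemma ptc_gadget_targets [ptc_intros]: "ptc F \<Longrightarrow> ptc (\<lambda>z. gadget_targets (F z))"
  unfolding gadget_targets_def by (intro ptc_intros)

text \<open>The columns are produced separately for the three kinds of sensors, so that sensors
  themselves need no codes, only literals, row indices and targets.\<close>

lemma ptc_gadget_inst: "ptc (\<lambda>F :: 'v::enc cnf. enc_inst (gadget_inst F))"
proof -
  have lit: "gadget_can (Lit l) t \<longleftrightarrow> snd (snd t) = [fst l] \<and> (fst (snd t) = 0 \<or> fst (snd t) = Suc (fst (fst t))) \<or>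
     snd (snd t) = [] \<and> fst (snd t) = Suc (fst (fst t)) \<and> (\<exists>l'\<in>set (snd (fst t)). l = l')" for l and t :: "'v target"
    by auto
  have "ptc (\<lambda>F :: 'v cnf. map (\<lambda>l. map (gadget_can (Lit l)) (gadget_targets F)) (List.product (vars F) [False, True]))"
    unfolding lit by (intro ptc_intros)
  moreover have "ptc (\<lambda>F :: 'v cnf. map (\<lambda>r. map (gadget_can (Slack r)) (gadget_targets F)) [0..<length F])"
    unfolding gadget_can.simps by (intro ptc_intros)
  moreover have "ptc (\<lambda>F :: 'v cnf. map (\<lambda>t. map (gadget_can (Filler t)) (gadget_targets F)) (gadget_targets F))"
    unfolding gadget_can.simps by (intro ptc_intros)
  ultimately have "ptc (\<lambda>F :: 'v cnf. map (\<lambda>l. map (gadget_can (Lit l)) (gadget_targets F)) (List.product (vars F) [False, True]) @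
      map (\<lambda>r. map (gadget_can (Slack r)) (gadget_targets F)) [0..<length F] @
      map (\<lambda>t. map (gadget_can (Filler t)) (gadget_targets F)) (gadget_targets F))" (is "ptc ?cols")
    by (intro ptc_append)
  note cols = ptc_enc_lists(2)[OF this]
  have "ptc (\<lambda>F :: 'v cnf. enc_list enc_ratio (map (\<lambda>_. (1, 1)) (gadget_targets F)))"
    "ptc (\<lambda>F :: 'v cnf. enc_nat (length F * Suc (length (vars F)) + length (vars F)) @ [Semi])"
    "ptc (\<lambda>F :: 'v cnf. enc_list enc_nat (map Suc [0..<length (gadget_targets F)]))"
    by (intro ptc_intros)+
  note ptc_append[OF this(1) ptc_append[OF this(2) ptc_append[OF cols this(3)]]]
  then show ?thesis
    by (simp add: enc_inst_def gadget_inst_def colour_inst_def gadget_sensors_def enc_enat_def comp_def)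
qed

text \<open>Transitions and tapes of a fixed machine form a constant list, so the concatenation
  unrolls into finitely many pieces. Each piece has to be computable in \<open>x\<close>; its
  dependence on \<open>d\<close> can be arbitrary.\<close>

lemma ptc_concat_constant:
  assumes "\<And>d. d \<in> set ds \<Longrightarrow> ptc (f d)"
  shows "ptc (\<lambda>x. concat (map (\<lambda>d. f d x) ds))"
  using assms by (induction ds) (auto intro!: ptc_intros)

text \<open>The tableau is laid out by loops along lists, so the time bound is needed in unary.
  Horner's scheme produces a list of that length.\<close>

lemma ptc_polynomial_list:
  "\<exists>u :: bool list \<Rightarrow> bool list. ptc u \<and> (\<forall>x. length (u x) = poly p (length x))"
proof (induction p)
  case 0
  show ?case by (intro exI[of _ "\<lambda>_. []"]) (auto intro: ptc_intros)
next
  case (pCons a p)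
  then obtain u :: "bool list \<Rightarrow> bool list" where u: "ptc u" "\<And>x. length (u x) = poly p (length x)" by auto
  have "ptc (\<lambda>x :: bool list. replicate a True @ concat (map (\<lambda>_. u x) x))"
    by (intro ptc_intros ptc_comp[OF _ u(1)])
  moreover have "length (concat (map (\<lambda>_. ys) xs)) = length xs * length ys" for xs ys :: "bool list"
    by (induction xs) auto
  ultimately show ?case using u(2) by (intro exI[of _ "\<lambda>x. replicate a True @ concat (map (\<lambda>_. u x) x)"]) auto
qed

context tableau
begin

lemma ptc_cells [ptc_intros]:
  fixes f :: "'b::enc \<Rightarrow> 'c::enc list"
  assumes "ptc f"
  shows "ptc (\<lambda>z. [0..<2 * length (f z) + 3])"
proof -
  have "ptc (\<lambda>z. [0..<length (f z @ f z @ [undefined, undefined, undefined])])" by (intro ptc_intros assms)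
  moreover have "length (f z @ f z @ [undefined, undefined, undefined]) = 2 * length (f z) + 3" for z by simp
  ultimately show ?thesis by (simp only:)
qed

lemma ptc_control: "ptc (\<lambda>p :: bool list \<times> bool list. control (length (snd p)))"
proof -
  \<comment> \<open>Which transitions are not idle depends on the machine alone, so the filtered
    list is a constant.\<close>
  have "ptc (\<lambda>p :: bool list \<times> bool list. map (\<lambda>d. [(trans_var d (length (snd p)), False)]) (filter (\<lambda>d. ds ! d \<notin> idles M g) [0..<length ds]))"
    unfolding trans_var_def by (intro ptc_map ptc_const[where k = "filter _ _"]) (intro ptc_intros)
  moreover have "ptc (\<lambda>p :: bool list \<times> bool list. map (\<lambda>t. map (\<lambda>d. (trans_var d t, True)) [0..<length ds]) [0..<Suc (length (snd p))])"
    unfolding trans_var_def by (intro ptc_map ptc_const[where k = "[0..<length ds]"]) (intro ptc_intros)+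
  moreover have "ptc (\<lambda>p :: bool list \<times> bool list. concat (map (\<lambda>q. map (\<lambda>t. [(trans_var (fst q) t, False), (trans_var (snd q) (Suc t), False)])
       [0..<Suc (length (snd p))])
       (filter (\<lambda>q. tgt (fst q) \<noteq> src (snd q)) (List.product [0..<length ds] [0..<length ds]))))"
    unfolding trans_var_def by (intro ptc_concat_constant) (intro ptc_intros)
  ultimately show ?thesis unfolding control_def by (intro ptc_append ptc_const)
qed

lemma ptc_effects: "ptc (\<lambda>p :: bool list \<times> bool list. effects (length (snd p)))"
proof -
  have "ptc (\<lambda>q. head_clause d j (t q) (i q))" if "ptc t" "ptc i" for d j and t i :: "'b::enc \<Rightarrow> nat"
    unfolding head_clause_def trans_var_def head_var_def using that
    by (cases "moves d ! j") (auto intro!: ptc_intros)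
  note head = this
  show ?thesis
    unfolding effects_def trans_var_def head_var_def cell_var_def
    by (intro ptc_concat_constant) (intro head ptc_intros)
qed

lemma ptc_frame: "ptc (\<lambda>p :: bool list \<times> bool list. frame (length (snd p)))"
  unfolding frame_def head_var_def cell_var_def
  by (intro ptc_concat_constant) (intro ptc_intros)

lemma ptc_start: "ptc (\<lambda>p :: bool list \<times> bool list. start (fst p) (length (snd p)))"
  unfolding start_def head_var_def cell_var_def
  by (intro ptc_append ptc_concat_constant) (intro ptc_intros)+

lemma ptc_formula: "ptc (\<lambda>p :: bool list \<times> bool list. formula (fst p) (length (snd p)))"
  unfolding formula_def by (intro ptc_append ptc_control ptc_effects ptc_frame ptc_start)

end

text \<open>The bound \<open>g\<close> on the symbols, at least 3 for the blank and the bits, and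
  the list of transitions exist because the machine is finite. They are constants of the reduction;
  only the input and the clock \<open>u x\<close> vary.\<close>

lemma NP_reduction:
  assumes "A \<in> NP"
  shows "\<exists>f :: bool list \<Rightarrow> tvar cnf. ptc f \<and> (\<forall>x. x \<in> A \<longleftrightarrow> satisfiable (f x))"
proof -
  obtain M p where M: "wf_tm M" "\<And>x n c. (tm_step M ^^ n) (initial M x) c \<Longrightarrow> n \<le> poly p (length x)"
    "\<And>x. x \<in> A \<longleftrightarrow> accepts M x"
    using assms unfolding NP_def by blast
  define S where "S = (\<Union>(q, r, q', w, m)\<in>delta M. set r \<union> set w)"
  have "finite S" unfolding S_def using M(1) by (auto simp: wf_tm_def)
  then obtain g0 where g0: "\<And>s. s \<in> S \<Longrightarrow> s < g0" using finite_nat_set_iff_bounded by auto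
  define g where "g = max g0 3"
  have fin: "finite {r. set r \<subseteq> {..<g} \<and> length r = num_tapes M}" by (rule finite_lists_length_eq) simp
  have "idles M g \<subseteq> (\<lambda>r. (accept_state M, r, accept_state M, r, replicate (num_tapes M) Stay)) `
      {r. set r \<subseteq> {..<g} \<and> length r = num_tapes M}"
    unfolding idles_def by blast
  then have "finite (idles M g)" by (rule finite_subset[OF _ finite_imageI[OF fin]])
  then have "finite (delta M \<union> idles M g)" using M(1) by (simp add: wf_tm_def)
  from finite_list[OF this] obtain ds where ds: "set ds = delta M \<union> idles M g" ..
  interpret tableau M g ds
  proof
    fix q r q' w m assume d: "(q, r, q', w, m) \<in> delta M"
    show "set r \<union> set w \<subseteq> {..<g}"
    proof
      fix s assume "s \<in> set r \<union> set w"
      then have "s \<in> S" using d unfolding S_def by force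
      then show "s \<in> {..<g}" using g0[of s] by (simp add: g_def less_max_iff_disj)
    qed
  qed (use M(1) ds in \<open>auto simp: g_def\<close>)
  obtain u :: "bool list \<Rightarrow> bool list" where u: "ptc u" "\<And>x. length (u x) = poly p (length x)"
    using ptc_polynomial_list by blast
  have "ptc (\<lambda>x. formula (fst (x, u x)) (length (snd (x, u x))))"
    by (rule ptc_comp[OF _ ptc_formula]) (intro ptc_intros u(1))
  moreover have "satisfiable (formula x (length (u x))) \<longleftrightarrow> x \<in> A" for x
    using satisfiable_formula[of x "poly p (length x)"] M(2,3) by (simp add: u(2))
  ultimately show ?thesis by (intro exI[of _ "\<lambda>x. formula x (length (u x))"]) auto
qed

text \<open>\<open>rest\<close> is what follows the instance: nothing if all targets must be sensed,
  the threshold \<open>(0, 1)\<close> in the general problem.\<close>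

lemma NP_hardI:
  assumes "\<And>F :: tvar cnf. to_bits (enc_inst (gadget_inst F) @ rest) \<in> L \<longleftrightarrow> sensable (gadget_inst F)"
  shows "NP_hard L"
  unfolding NP_hard_def polytime_reducible_def
proof
  fix A assume "A \<in> NP"
  then obtain f :: "bool list \<Rightarrow> tvar cnf" where f: "ptc f" "\<And>x. x \<in> A \<longleftrightarrow> satisfiable (f x)"
    using NP_reduction by blast
  have "ptc (\<lambda>x. to_bits (enc_inst (gadget_inst (f x)) @ rest))"
    by (intro ptc_to_bits ptc_append ptc_const ptc_comp[OF f(1) ptc_gadget_inst])
  then have "polytime_computable (\<lambda>x. to_bits (enc_inst (gadget_inst (f x)) @ rest))"
    by (rule polytime_computable_ptc)
  moreover have "x \<in> A \<longleftrightarrow> to_bits (enc_inst (gadget_inst (f x)) @ rest) \<in> L" for x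
    by (simp add: assms f(2) sensable_gadget)
  ultimately show "\<exists>f. polytime_computable f \<and> (\<forall>x. (x \<in> A) = (f x \<in> L))" by blast
qed

lemma NP_hard_sense_all_targets: "NP_hard sense_all_targets"
proof (rule NP_hardI[of "[]"])
  fix F :: "tvar cnf"
  show "to_bits (enc_inst (gadget_inst F) @ []) \<in> sense_all_targets \<longleftrightarrow> sensable (gadget_inst F)"
    using wf_colour_inst unfolding gadget_inst_def
    by (auto simp: sense_all_targets_def encoding_inject sensable_def)
qed

lemma NP_hard_best_red_response: "NP_hard best_red_response"
proof (rule NP_hardI[of "enc_ratio (0, 1)"])
  fix F :: "tvar cnf"
  show "to_bits (enc_inst (gadget_inst F) @ enc_ratio (0, 1)) \<in> best_red_response \<longleftrightarrow> sensable (gadget_inst F)"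
    unfolding best_red_response_def mem_Collect_eq encoding_inject(2)
    using wf_colour_inst colour_inst_threshold unfolding gadget_inst_def by fastforce
qed


section \<open>Membership in NP\<close>

subsection \<open>Decoding instances\<close>

text \<open>The first component holds the first bit of a symbol that has been read only
  half.\<close>

definition unbit_step :: "bool \<Rightarrow> bool list \<times> sym list \<Rightarrow> bool list \<times> sym list" where
  "unbit_step b s = (if fst s = [] then ([b], snd s)
     else ([], snd s @ [if hd (fst s) then if b then Semi else Comma else Bit b]))"

definition unbits :: "bool list \<Rightarrow> sym list" where
  "unbits x = snd (fold unbit_step x ([], []))"

lemma unbits_to_bits: "unbits (to_bits w) = w"
proof -
  have "fold unbit_step (sym_bits s) ([], acc) = ([], acc @ [s])" for s acc
    by (cases s) (auto simp: unbit_step_def)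
  then have "fold unbit_step (to_bits w) ([], acc) = ([], acc @ w)" for acc
    unfolding to_bits_def by (induction w arbitrary: acc) auto
  then show ?thesis by (simp add: unbits_def)
qed

lemma sz_sym: "sz (s :: sym) \<le> 9"
  using sz_bools[of "sym_bits s"] by (cases s) (auto simp: sz_def enc_sym_def)

lemma ptc_unbits [ptc_intros]:
  assumes "ptc f"
  shows "ptc (\<lambda>z. unbits (f z))"
proof -
  have *: "length (fst (fold unbit_step xs s)) \<le> 1 \<and> sz (snd (fold unbit_step xs s)) \<le> sz (snd s) + 10 * length xs"
    if "length (fst s) \<le> 1" for xs s
    using that
  proof (induction xs arbitrary: s)
    case (Cons b xs)
    have "length (fst (unbit_step b s)) \<le> 1" by (simp add: unbit_step_def)
    moreover have "sz (snd (unbit_step b s)) \<le> sz (snd s) + 10"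
    proof (cases "fst s = []")
      case False
      define a where "a = (if hd (fst s) then if b then Semi else Comma else Bit b)"
      have "snd (unbit_step b s) = snd s @ [a]" using False by (simp add: unbit_step_def a_def)
      then show ?thesis using sz_append[of "snd s" "[a]"] sz_sym[of a] by simp
    qed (simp add: unbit_step_def)
    ultimately show ?case using Cons.IH[of "unbit_step b s"] by simp
  qed simp
  have "sz (fold unbit_step (take k (f z)) ([], [])) \<le> 10 * sz (f z) + 10" for z k
  proof -
    let ?s = "fold unbit_step (take k (f z)) ([], [])"
    have "sz ?s = sz (fst ?s) + sz (snd ?s) + 1" by (metis prod.collapse sz_Pair)
    moreover have "length (take k (f z)) \<le> sz (f z)" using length_le_sz[of "f z"] by simp
    ultimately show ?thesis using *[of "([], [])" "take k (f z)"] sz_bools[of "fst ?s"] by simp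
  qed
  then have "ptc (\<lambda>z. fold unbit_step (f z) ([], []))"
    by (intro ptc_fold[where b = "\<lambda>z. 10 * sz (f z) + 10"] ptc_intros pb_intros assms)
      (unfold unbit_step_def, intro ptc_intros)
  then show ?thesis unfolding unbits_def by (intro ptc_intros)
qed

text \<open>A word is split into segments, ended by \<open>Semi\<close>, of tokens, ended by \<open>Comma\<close>.\<close>

definition parse_step :: "sym \<Rightarrow> bool list list list \<Rightarrow> bool list list list" where
  "parse_step s P = (if s = Semi then [] # P
     else if s = Comma then ([] # hd P) # tl P
     else (((s = Bit True) # hd (hd P)) # tl (hd P)) # tl P)"

text \<open>Working from the right end, bits, tokens and segments can all be added at the front of
  their lists.\<close>

definition parse :: "sym list \<Rightarrow> bool list list list" where
  "parse w = fold parse_step (rev w) [[]]"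

lemma parse_Cons: "parse (s # w) = parse_step s (parse w)"
  by (simp add: parse_def)

lemma parse_enc_bools: "parse w = T # R \<Longrightarrow> parse (enc_bools bs @ w) = (bs # T) # R"
  by (induction bs) (auto simp: enc_bools_def parse_Cons parse_step_def)

lemma parse_tokens: "parse w = T # R \<Longrightarrow> parse (concat (map enc_bools bss) @ w) = (bss @ T) # R"
proof (induction bss)
  case (Cons bs bss)
  then show ?case using parse_enc_bools[of "concat (map enc_bools bss) @ w"] by simp
qed simp

lemma parse_segment: "parse w = T # R \<Longrightarrow> parse (concat (map enc_bools bss) @ Semi # w) = bss # T # R"
  using parse_tokens[of "Semi # w" "[]" "T # R" bss] by (simp add: parse_Cons parse_step_def)

lemma parse_last: "parse (concat (map enc_bools bss)) = [bss]"
  using parse_tokens[of "[]" "[]" "[]" bss] by (simp add: parse_def)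

text \<open>On malformed words the parser takes heads of empty lists. These are unspecified but
  fixed values, so their sizes enter the bound as constants.\<close>

lemma sz_hd_tl: "sz (hd xs) + sz (tl xs) \<le> sz xs + sz (hd ([] :: 'a::enc list))" for xs :: "'a::enc list"
  by (cases xs) auto

lemma sz_parse_step:
  "sz (parse_step s P) \<le> sz P + (sz (hd ([] :: bool list list)) + sz (hd ([] :: bool list list list)) + 10)"
  using sz_hd_tl[of P] sz_hd_tl[of "hd P"] by (auto simp: parse_step_def sz_bool)

lemma ptc_parse [ptc_intros]:
  assumes "ptc f"
  shows "ptc (\<lambda>z. parse (f z))"
proof -
  define C where "C = sz (hd ([] :: bool list list)) + sz (hd ([] :: bool list list list)) + 10"
  have *: "sz (fold parse_step w P) \<le> sz P + C * length w" for w P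
  proof (induction w arbitrary: P)
    case (Cons s w)
    from Cons[of "parse_step s P"] sz_parse_step[of s P] show ?case by (simp add: C_def)
  qed simp
  have "sz (fold parse_step (take k (rev (f z))) [[]]) \<le> 3 + C * sz (f z)" for z k
  proof -
    have "length (take k (rev (f z))) \<le> sz (f z)" using length_le_sz[of "f z"] by simp
    then have "C * length (take k (rev (f z))) \<le> C * sz (f z)" by simp
    moreover have "sz [[] :: bool list list] = 3" by simp
    ultimately show ?thesis using *[of "take k (rev (f z))" "[[]]"] by linarith
  qed
  then have "ptc (\<lambda>z. fold parse_step (rev (f z)) [[]])"
    by (intro ptc_fold[where b = "\<lambda>z. 3 + C * sz (f z)"] ptc_intros pb_intros assms)
      (unfold parse_step_def, intro ptc_intros)
  then show ?thesis unfolding parse_def .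
qed

definition unbin :: "bool list \<Rightarrow> nat" where
  "unbin bs = fold (\<lambda>b n. 2 * n + of_bool b) (rev bs) 0"

lemma unbin_binary: "unbin (binary n) = n"
  by (simp add: unbin_def fold_shift_binary)

lemma ptc_unbin [ptc_intros]: "ptc f \<Longrightarrow> ptc (\<lambda>z. unbin (f z))"
  unfolding unbin_def by (intro ptc_fold_shift ptc_intros)

definition pairs :: "nat list \<Rightarrow> (nat \<times> nat) list" where
  "pairs xs = map (\<lambda>i. (nth_or 0 xs i, nth_or 0 xs (Suc i))) (filter (\<lambda>i. \<not> odd i) [0..<length xs])"

lemma ptc_pairs [ptc_intros]: "ptc f \<Longrightarrow> ptc (\<lambda>z. pairs (f z))"
proof -
  have "ptc pairs" unfolding pairs_def by (intro ptc_intros)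
  then show "ptc f \<Longrightarrow> ptc (\<lambda>z. pairs (f z))" by (rule ptc_comp[rotated])
qed

lemma pairs_concat: "pairs (concat (map (\<lambda>p. [fst p, snd p]) ps)) = ps"
proof -
  let ?xs = "\<lambda>ps. concat (map (\<lambda>p. [fst p, snd p]) ps)"
  have "filter (\<lambda>i. \<not> odd i) [0..<2 * n] = map ((*) 2) [0..<n]" for n
    by (induction n) auto
  moreover have len: "length (?xs ps) = 2 * length ps" for ps :: "(nat \<times> nat) list" by (induction ps) auto
  moreover have "?xs ps ! (2 * i) = fst (ps ! i) \<and> ?xs ps ! Suc (2 * i) = snd (ps ! i)" if "i < length ps" for i
    using that
  proof (induction ps arbitrary: i)
    case (Cons p ps)
    then show ?case by (cases i) auto
  qed simp
  ultimately show ?thesis by (intro nth_equalityI) (auto simp: pairs_def nth_or_def)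
qed


subsection \<open>Instances as tuples\<close>

text \<open>A finite recharging time is a list of one number and the infinite one the empty list,
  just as in the written form.\<close>

definition tuple_inst :: "(nat \<times> nat) list \<Rightarrow> nat list \<Rightarrow> bool list list \<Rightarrow> nat list \<Rightarrow> esg_inst" where
  "tuple_inst vs \<tau> cs os = \<lparr>inst_values = vs, inst_recharge = (if \<tau> = [] then \<infinity> else enat (hd \<tau>)),
     inst_columns = cs, inst_order = os\<rparr>"

definition recharge_list :: "enat \<Rightarrow> nat list" where
  "recharge_list \<tau> = (case \<tau> of enat n \<Rightarrow> [n] | \<infinity> \<Rightarrow> [])"

lemma tuple_inst_fields:
  "tuple_inst (inst_values I) (recharge_list (inst_recharge I)) (inst_columns I) (inst_order I) = I"
  by (cases I) (auto simp: tuple_inst_def recharge_list_def split: enat.splits)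

type_synonym inst_tuple = "(nat \<times> nat) list \<times> nat list \<times> bool list list \<times> nat list"

definition of_tuple :: "inst_tuple \<Rightarrow> esg_inst" where
  "of_tuple p = tuple_inst (fst p) (fst (snd p)) (fst (snd (snd p))) (snd (snd (snd p)))"

text \<open>Defined on all words, with defaults for missing segments and no error value; whether the
  word was an encoding is decided later by encoding the result again.\<close>

definition decode :: "bool list \<Rightarrow> inst_tuple" where
  "decode x = (pairs (map unbin (nth_or [] (parse (unbits x)) 0)), map unbin (nth_or [] (parse (unbits x)) 1),
     nth_or [] (parse (unbits x)) 2, map unbin (nth_or [] (parse (unbits x)) 3))"

definition decode_threshold :: "bool list \<Rightarrow> nat \<times> nat" where
  "decode_threshold x = (nth_or 0 (map unbin (nth_or [] (parse (unbits x)) 4)) 0,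
     nth_or 0 (map unbin (nth_or [] (parse (unbits x)) 4)) 1)"

lemma ptc_decode: "ptc decode" "ptc decode_threshold"
  unfolding decode_def decode_threshold_def by (intro ptc_intros)+

lemma enc_nat_bools: "enc_nat n = enc_bools (binary n)"
  by (rule Defs.enc_nat_def)

lemma parse_enc_inst:
  "parse (enc_inst I @ concat (map enc_bools bss)) =
     [concat (map (\<lambda>r. [binary (fst r), binary (snd r)]) (inst_values I)), map binary (recharge_list (inst_recharge I)),
      inst_columns I, map binary (inst_order I), bss]"
proof -
  have 1: "enc_list enc_nat ns @ w = concat (map enc_bools (map binary ns)) @ Semi # w" for ns w
    by (simp add: Defs.enc_list_def enc_nat_bools[abs_def] comp_def)
  have 2: "enc_list enc_bools cs @ w = concat (map enc_bools cs) @ Semi # w" for cs w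
    by (simp add: Defs.enc_list_def)
  have 3: "enc_enat t @ w = concat (map enc_bools (map binary (recharge_list t))) @ Semi # w" for t w
    by (simp add: enc_enat_def enc_nat_bools recharge_list_def split: enat.splits)
  have "concat (map enc_ratio rs) = concat (map enc_bools (concat (map (\<lambda>r. [binary (fst r), binary (snd r)]) rs)))" for rs
    by (induction rs) (auto simp: enc_nat_bools)
  then have 4: "enc_list enc_ratio rs @ w = concat (map enc_bools (concat (map (\<lambda>r. [binary (fst r), binary (snd r)]) rs))) @ Semi # w" for rs w
    by (simp add: Defs.enc_list_def)
  show ?thesis unfolding enc_inst_def append_assoc
    unfolding 1 2 3 4 by (intro parse_segment parse_last)
qed

lemma decode_enc_inst: "of_tuple (decode (to_bits (enc_inst I @ concat (map enc_bools bss)))) = I"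
proof -
  have "map unbin (concat (map (\<lambda>r. [binary (fst r), binary (snd r)]) rs)) = concat (map (\<lambda>p. [fst p, snd p]) rs)" for rs
    by (induction rs) (auto simp: unbin_binary)
  then show ?thesis
    by (simp add: decode_def of_tuple_def unbits_to_bits parse_enc_inst nth_or_def comp_def unbin_binary pairs_concat tuple_inst_fields)
qed

lemma decode_threshold_enc: "decode_threshold (to_bits (enc_inst I @ enc_ratio q)) = q"
proof -
  have "enc_ratio q = concat (map enc_bools [binary (fst q), binary (snd q)])"
    by (cases q) (simp add: enc_nat_bools)
  then show ?thesis
    unfolding decode_threshold_def unbits_to_bits by (simp only: parse_enc_inst) (simp add: nth_or_def unbin_binary)
qed

lemma enc_inst_of_tuple:
  "enc_inst (of_tuple p) = enc_list enc_ratio (fst p) @ ((if fst (snd p) = [] then [] else enc_nat (hd (fst (snd p)))) @ [Semi]) @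
     enc_list enc_bools (fst (snd (snd p))) @ enc_list enc_nat (snd (snd (snd p)))"
  by (simp add: of_tuple_def tuple_inst_def enc_inst_def enc_enat_def)

lemma ptc_enc_inst_of_tuple: "ptc (\<lambda>p. enc_inst (of_tuple p))"
  unfolding enc_inst_of_tuple by (intro ptc_intros)


subsection \<open>Checking a sensing plan\<close>

text \<open>The guess is read as a matrix with a row of \<open>n\<close> bits per sensor, like the
  sensing matrix of the instance.\<close>

definition plan_of :: "nat \<Rightarrow> bool list \<Rightarrow> nat \<Rightarrow> nat set" where
  "plan_of n y s = {t. t < n \<and> nth_or False y (s * n + t)}"

definition check_inst :: "inst_tuple \<Rightarrow> bool" where
  "check_inst p \<longleftrightarrow> (\<forall>r\<in>set (fst p). 0 < snd r \<and> 0 < fst r) \<and>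
     (\<forall>c\<in>set (fst (snd (snd p))). length c = length (fst p)) \<and>
     length (snd (snd (snd p))) = length (fst p) \<and>
     (\<forall>i\<in>set [0..<length (fst p)]. Suc i \<in> set (snd (snd (snd p))))"

definition check_plan :: "inst_tuple \<times> bool list \<Rightarrow> bool" where
  "check_plan z \<longleftrightarrow>
     (\<forall>s\<in>set [0..<length (fst (snd (snd (fst z))))]. \<forall>s'\<in>set [0..<length (fst (snd (snd (fst z))))]. \<forall>t\<in>set [0..<length (fst (fst z))].
        nth_or False (snd z) (s * length (fst (fst z)) + t) \<longrightarrow> nth_or False (snd z) (s' * length (fst (fst z)) + t) \<longrightarrow> s = s') \<and>
     (\<forall>s\<in>set [0..<length (fst (snd (snd (fst z))))]. \<forall>t\<in>set [0..<length (fst (fst z))].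
        nth_or False (snd z) (s * length (fst (fst z)) + t) \<longrightarrow> nth_or False (nth_or [] (fst (snd (snd (fst z)))) s) t) \<and>
     (\<forall>s\<in>set [0..<length (fst (snd (snd (fst z))))]. \<forall>t\<in>set [0..<length (fst (fst z))]. \<forall>t'\<in>set [0..<length (fst (fst z))].
        nth_or False (snd z) (s * length (fst (fst z)) + t) \<longrightarrow> nth_or False (snd z) (s * length (fst (fst z)) + t') \<longrightarrow> t \<noteq> t' \<longrightarrow>
        fst (snd (fst z)) \<noteq> [] \<and>
        (nth_or 0 (snd (snd (snd (fst z)))) t + hd (fst (snd (fst z))) < nth_or 0 (snd (snd (snd (fst z)))) t' \<or>
         nth_or 0 (snd (snd (snd (fst z)))) t' + hd (fst (snd (fst z))) < nth_or 0 (snd (snd (snd (fst z)))) t))"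

definition senses :: "inst_tuple \<times> bool list \<Rightarrow> nat \<Rightarrow> bool" where
  "senses z t \<longleftrightarrow> (\<exists>s\<in>set [0..<length (fst (snd (snd (fst z))))]. nth_or False (snd z) (s * length (fst (fst z)) + t))"

lemma ptc_check_inst: "ptc check_inst"
  unfolding check_inst_def by (intro ptc_intros)

lemma ptc_check_plan: "ptc check_plan"
  unfolding check_plan_def by (intro ptc_intros)

lemma ptc_senses: "ptc (\<lambda>q. senses (fst q) (snd q))"
  unfolding senses_def by (intro ptc_intros)

text \<open>A list of \<open>n\<close> numbers that contains each of 1 to \<open>n\<close> is a
  permutation of them, so bijectivity of the ordering can be tested by memberships.\<close>

lemma wf_inst_of_tuple: "wf_inst (of_tuple p) \<longleftrightarrow> check_inst p"
proof -
  obtain vs \<tau> cs os where p: "p = (vs, \<tau>, cs, os)" by (metis surj_pair)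
  have val: "(\<forall>r\<in>set vs. snd r > 0) \<and> (\<forall>t<length vs. ratio_val (vs ! t) > 0) \<longleftrightarrow> (\<forall>r\<in>set vs. 0 < snd r \<and> 0 < fst r)"
  proof -
    have "ratio_val r > 0 \<longleftrightarrow> fst r > 0" if "snd r > 0" for r
      using that by (cases r) (simp add: zero_less_divide_iff)
    moreover have "(\<forall>t<length vs. ratio_val (vs ! t) > 0) \<longleftrightarrow> (\<forall>r\<in>set vs. ratio_val r > 0)"
      by (simp add: all_set_conv_all_nth)
    ultimately show ?thesis by blast
  qed
  have ord: "bij_betw ((!) os) {..<length vs} {1..length vs} \<longleftrightarrow> (\<forall>i<length vs. Suc i \<in> set os)" if len: "length os = length vs"
  proof
    have set: "set os = (!) os ` {..<length vs}" using len by (auto simp: set_conv_nth)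
    { assume "bij_betw ((!) os) {..<length vs} {1..length vs}"
      then show "\<forall>i<length vs. Suc i \<in> set os" unfolding set by (auto simp: bij_betw_def) }
    assume *: "\<forall>i<length vs. Suc i \<in> set os"
    have sub: "{1..length vs} \<subseteq> set os"
    proof
      fix i assume "i \<in> {1..length vs}"
      then obtain j where "i = Suc j" "j < length vs" by (cases i) auto
      then show "i \<in> set os" using * by simp
    qed
    have "card (set os) \<le> card {1..length vs}" using card_length[of os] len by simp
    then have eq: "{1..length vs} = set os" using sub by (intro card_seteq) auto
    then have "card ((!) os ` {..<length vs}) = card {..<length vs}" using set by (metis card_atLeastAtMost card_lessThan diff_Suc_1)
    then have "inj_on ((!) os) {..<length vs}" by (intro eq_card_imp_inj_on) auto
    then show "bij_betw ((!) os) {..<length vs} {1..length vs}" using set eq by (simp add: bij_betw_def)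
  qed
  show ?thesis
    unfolding wf_inst_def check_inst_def p of_tuple_def
    using val ord by (auto simp: tuple_inst_def wf_esg_def game_of_def target_ordering_def order_of_def[abs_def])
qed

lemma check_plan_iff:
  fixes y :: "bool list"
  assumes "check_inst p"
  defines "G \<equiv> game_of (of_tuple p)" and "\<psi> \<equiv> plan_of (length (fst p)) y"
  shows "check_plan (p, y) \<longleftrightarrow> sensing_plan G \<psi> \<and> valid_plan G (order_of (of_tuple p)) \<psi>"
    and "sensed G \<psi> = {t. t < length (fst p) \<and> senses (p, y) t}"
proof -
  obtain vs \<tau> cs os where p: "p = (vs, \<tau>, cs, os)" by (metis surj_pair)
  let ?n = "length vs" and ?k = "length cs"
  have G: "targets G = {..<?n}" "sensors G = {..<?k}" "recharge G = (if \<tau> = [] then \<infinity> else enat (hd \<tau>))"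
    "can_sense G s t = cs ! s ! t" "order_of (of_tuple p) t = os ! t" for s t
    by (simp_all add: G_def p of_tuple_def tuple_inst_def game_of_def order_of_def)
  have \<psi>: "t \<in> \<psi> s \<longleftrightarrow> t < ?n \<and> nth_or False y (s * ?n + t)" for s t
    by (simp add: \<psi>_def plan_of_def p)
  have len: "length os = ?n" "s < ?k \<Longrightarrow> length (cs ! s) = ?n" for s
    using assms(1) by (auto simp: check_inst_def p)
  have 1: "(\<forall>s<?k. \<forall>s'<?k. \<forall>t<?n. nth_or False y (s * ?n + t) \<longrightarrow> nth_or False y (s' * ?n + t) \<longrightarrow> s = s') \<longleftrightarrow>
    sensing_plan G \<psi>"
    unfolding sensing_plan_def G disjoint_iff subset_iff \<psi> by (auto simp: Ball_def)
  have 2: "(\<forall>s<?k. \<forall>t<?n. nth_or False y (s * ?n + t) \<longrightarrow> nth_or False (nth_or [] cs s) t) \<longleftrightarrow>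
    (\<forall>s\<in>sensors G. \<forall>t\<in>\<psi> s. can_sense G s t)"
    unfolding G Ball_def \<psi> using len(2) by (auto simp: nth_or_def)
  \<comment> \<open>Distances are compared by additions in both directions; an infinite recharging
    time tolerates no second target.\<close>
  have far: "(\<tau> \<noteq> [] \<and> (a + hd \<tau> < b \<or> b + hd \<tau> < a)) \<longleftrightarrow> recharge G < enat (nat \<bar>int a - int b\<bar>)" for a b
    unfolding G by auto
  have 3: "(\<forall>s<?k. \<forall>t<?n. \<forall>t'<?n. nth_or False y (s * ?n + t) \<longrightarrow> nth_or False y (s * ?n + t') \<longrightarrow> t \<noteq> t' \<longrightarrow>
      \<tau> \<noteq> [] \<and> (nth_or 0 os t + hd \<tau> < nth_or 0 os t' \<or> nth_or 0 os t' + hd \<tau> < nth_or 0 os t)) \<longleftrightarrow>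
    (\<forall>s\<in>sensors G. \<forall>t\<in>\<psi> s. \<forall>t'\<in>\<psi> s. t \<noteq> t' \<longrightarrow> recharge G < enat (nat \<bar>int (order_of (of_tuple p) t) - int (order_of (of_tuple p) t')\<bar>))"
    unfolding far G(2,5) Ball_def \<psi> using len(1) by (auto simp: nth_or_def)
  show "check_plan (p, y) \<longleftrightarrow> sensing_plan G \<psi> \<and> valid_plan G (order_of (of_tuple p)) \<psi>"
    unfolding check_plan_def valid_plan_def p fst_conv snd_conv ball_upt 1 2 3[unfolded p] by (simp add: p)
  show "sensed G \<psi> = {t. t < length (fst p) \<and> senses (p, y) t}"
    unfolding sensed_def G senses_def by (auto simp: \<psi> p)
qed

lemma sensed_cong: "(\<And>s. s \<in> sensors G \<Longrightarrow> \<psi> s = \<psi>' s) \<Longrightarrow> sensed G \<psi> = sensed G \<psi>'"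
  by (auto simp: sensed_def)

text \<open>The bits of the plan are listed row by row and continued to the length \<open>m\<close>,
  which will be that of the input.\<close>

lemma plan_certificate:
  assumes "check_inst p" and len: "length (fst p) * length (fst (snd (snd p))) \<le> m"
  defines "G \<equiv> game_of (of_tuple p)"
  assumes \<psi>: "sensing_plan G \<psi>" "valid_plan G (order_of (of_tuple p)) \<psi>"
  obtains y where "length y = m" "check_plan (p, y)" "sensed G \<psi> = {t. t < length (fst p) \<and> senses (p, y) t}"
proof -
  let ?n = "length (fst p)" and ?k = "length (fst (snd (snd p)))"
  define y where "y = map (\<lambda>i. i mod ?n \<in> \<psi> (i div ?n)) [0..<m]"
  have G: "targets G = {..<?n}" "sensors G = {..<?k}"
    by (simp_all add: G_def of_tuple_def tuple_inst_def game_of_def)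
  have eq: "\<psi> s = plan_of ?n y s" if "s \<in> sensors G" for s
  proof -
    have "nth_or False y (s * ?n + t) \<longleftrightarrow> t \<in> \<psi> s" if "t < ?n" for t
    proof -
      have "s * ?n + t < Suc s * ?n" using that by simp
      also have "\<dots> \<le> ?k * ?n" using \<open>s \<in> sensors G\<close> G by (intro mult_le_mono) auto
      finally have "s * ?n + t < m" using len by (simp add: mult.commute)
      moreover have "(s * n + t) div n = s" "(s * n + t) mod n = t" if "t < n" for n :: nat
        using that by (cases "n = 0"; simp)+
      from this[OF that] have "(s * ?n + t) div ?n = s" "(s * ?n + t) mod ?n = t" .
      ultimately show ?thesis by (simp add: nth_or_def y_def)
    qed
    moreover have "\<psi> s \<subseteq> {..<?n}" using \<psi>(1) that G by (auto simp: sensing_plan_def)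
    ultimately show ?thesis by (auto simp: plan_of_def)
  qed
  have "sensing_plan G (plan_of ?n y)" using \<psi>(1) eq unfolding sensing_plan_def by simp
  moreover have "valid_plan G (order_of (of_tuple p)) (plan_of ?n y)" using \<psi>(2) eq unfolding valid_plan_def by simp
  ultimately have "check_plan (p, y)" using check_plan_iff(1)[OF assms(1)] unfolding G_def by blast
  moreover have "sensed G \<psi> = {t. t < ?n \<and> senses (p, y) t}"
    using sensed_cong[of G \<psi>, OF eq] check_plan_iff(2)[OF assms(1), of y] unfolding G_def by simp
  moreover have "length y = m" by (simp add: y_def)
  ultimately show thesis using that by blast
qed

lemma length_enc_inst:
  assumes "check_inst p"
  shows "length (fst p) * length (fst (snd (snd p))) \<le> length (to_bits (enc_inst (of_tuple p) @ w))"
proof -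
  have "length w \<le> length (to_bits w)" for w
  proof (induction w)
    case (Cons s w)
    then show ?case by (cases s) (auto simp: to_bits_def)
  qed simp
  moreover have "n * length cs \<le> length (enc_list enc_bools cs)" if "\<forall>c\<in>set cs. length c = n" for n cs
    using that by (induction cs) (auto simp: Defs.enc_list_def enc_bools_def)
  then have "length (fst p) * length (fst (snd (snd p))) \<le> length (enc_list enc_bools (fst (snd (snd p))))"
    using assms by (auto simp: check_inst_def)
  then have "length (fst p) * length (fst (snd (snd p))) \<le> length (enc_inst (of_tuple p) @ w)"
    by (simp add: enc_inst_of_tuple)
  ultimately show ?thesis using le_trans by blast
qed


subsection \<open>Comparing the unsensed value with the threshold\<close>

text \<open>
  The unsensed values are added as fractions without reducing them; as numerators and denominators
  of length at most the sum of all lengths suffice, this is polynomial.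
\<close>

definition value_step :: "inst_tuple \<times> bool list \<Rightarrow> nat \<times> nat \<times> nat \<Rightarrow> nat \<times> nat \<Rightarrow> nat \<times> nat" where
  "value_step z p s = (if senses z (fst p) then s
     else (fst s * snd (snd p) + fst (snd p) * snd s, snd s * snd (snd p)))"

definition total_value :: "inst_tuple \<times> bool list \<Rightarrow> nat \<times> nat" where
  "total_value z = fold (value_step z) (List.enumerate 0 (fst (fst z))) (0, 1)"

text \<open>Adding \<open>a / b\<close> to a fraction with both parts below \<open>2 ^ S\<close>
  raises the exponent by at most \<open>sz a + sz b\<close>, so in total it grows only by the size
  of the list.\<close>

lemma fold_value_step_less:
  assumes "fst s < 2 ^ S" "snd s < 2 ^ S"
  shows "fst (fold (value_step z) ps s) < 2 ^ (S + sz ps) \<and> snd (fold (value_step z) ps s) < 2 ^ (S + sz ps)"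
  using assms
proof (induction ps arbitrary: s S)
  case Nil
  have "(2::nat) ^ S \<le> 2 ^ (S + sz [])" by (intro power_increasing) auto
  then show ?case using Nil by (auto intro: less_le_trans)
next
  case (Cons p ps)
  obtain t a b where p: "p = (t, a, b)" by (metis surj_pair)
  have ab: "a < 2 ^ sz a" "b < 2 ^ sz b" by (rule less_power_sz)+
  let ?S = "S + sz a + sz b"
  have "(2::nat) ^ S \<le> 2 ^ ?S" by (intro power_increasing) auto
  moreover have "snd s * b < 2 ^ ?S"
  proof -
    have "snd s * b < 2 ^ S * 2 ^ sz b"
      using Cons.prems(2) ab(2) by (intro mult_strict_mono) auto
    also have "\<dots> = 2 ^ (S + sz b)" by (simp add: power_add)
    also have "\<dots> \<le> 2 ^ ?S" by (intro power_increasing) auto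
    finally show ?thesis .
  qed
  moreover have "fst s * b + a * snd s < 2 ^ ?S"
  proof -
    \<comment> \<open>The new numerator is less than \<open>2 ^ S * (a + b + 1)\<close>, and
      \<open>a + b + 1 \<le> (a + 1) * (b + 1)\<close>.\<close>
    have "a + 1 \<le> 2 ^ sz a" "b + 1 \<le> 2 ^ sz b" using ab by auto
    then have "(a + 1) * (b + 1) \<le> 2 ^ sz a * 2 ^ sz b" by (intro mult_le_mono)
    then have "a + b + 1 \<le> 2 ^ sz a * 2 ^ sz b" by simp
    then have "2 ^ S * (a + b + 1) \<le> 2 ^ S * (2 ^ sz a * 2 ^ sz b)" by (rule mult_le_mono2)
    moreover have "fst s * b + a * snd s \<le> 2 ^ S * b + a * 2 ^ S"
      using Cons.prems by (intro add_mono mult_le_mono) auto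
    moreover have "2 ^ S * b + a * 2 ^ S < 2 ^ S * (a + b + 1)" by (simp add: algebra_simps)
    moreover have "2 ^ S * (2 ^ sz a * 2 ^ sz b) = (2::nat) ^ ?S" by (simp add: power_add)
    ultimately show ?thesis by linarith
  qed
  ultimately have "fst (value_step z p s) < 2 ^ ?S" "snd (value_step z p s) < 2 ^ ?S"
    using Cons.prems by (auto simp: value_step_def p intro: less_le_trans)
  from Cons.IH[OF this] have "fst (fold (value_step z) (p # ps) s) < 2 ^ (?S + sz ps)"
    "snd (fold (value_step z) (p # ps) s) < 2 ^ (?S + sz ps)" by auto
  moreover have "(2::nat) ^ (?S + sz ps) \<le> 2 ^ (S + sz (p # ps))" by (intro power_increasing) (auto simp: p)
  ultimately show ?case by (meson less_le_trans)
qed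

lemma ptc_total_value: "ptc total_value"
proof -
  have senses: "ptc (\<lambda>q. senses (fst q) (fst (fst (snd q))))"
    by (rule ptc_comp2[OF ptc_senses]) (intro ptc_intros)+
  have step: "ptc (\<lambda>q. value_step (fst q) (fst (snd q)) (snd (snd q)))"
    unfolding value_step_def by (intro ptc_If senses) (intro ptc_intros)+
  let ?ps = "\<lambda>z :: inst_tuple \<times> bool list. List.enumerate 0 (fst (fst z))"
  have "sz (fold (value_step z) (take k (?ps z)) (0, 1)) \<le> 8 * (1 + sz (?ps z)) + 3" for z k
  proof -
    let ?s = "fold (value_step z) (take k (?ps z)) (0, 1)"
    have less: "fst ?s < 2 ^ (1 + sz (take k (?ps z)))" "snd ?s < 2 ^ (1 + sz (take k (?ps z)))"
      using fold_value_step_less[of "(0, 1)" 1 z "take k (?ps z)"] by auto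
    have "sz ?s = sz (fst ?s) + sz (snd ?s) + 1" by (metis prod.collapse sz_Pair)
    moreover have "sz (fst ?s) \<le> 4 * (1 + sz (?ps z)) + 1" "sz (snd ?s) \<le> 4 * (1 + sz (?ps z)) + 1"
      using sz_nat_le[OF less(1)] sz_nat_le[OF less(2)] sz_take[of k "?ps z"] by auto
    ultimately show ?thesis by simp
  qed
  then show ?thesis unfolding total_value_def
    by (intro ptc_fold[where b = "\<lambda>z. 8 * (1 + sz (?ps z)) + 3"] step ptc_intros pb_intros)
qed

lemma fold_value_step:
  assumes "\<forall>p\<in>set ps. 0 < snd (snd p)" "0 < snd s"
  shows "0 < snd (fold (value_step z) ps s) \<and>
    ratio_val (fold (value_step z) ps s) = ratio_val s + (\<Sum>p\<leftarrow>ps. if senses z (fst p) then 0 else ratio_val (snd p))"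
  using assms
proof (induction ps arbitrary: s)
  case (Cons p ps)
  obtain t a b where p: "p = (t, a, b)" by (metis surj_pair)
  obtain N D where s: "s = (N, D)" by (cases s)
  have pos: "0 < b" "0 < D" using Cons.prems by (auto simp: p s)
  then have "ratio_val (value_step z p s) = ratio_val s + (if senses z t then 0 else ratio_val (a, b))"
    "0 < snd (value_step z p s)"
    by (auto simp: value_step_def p s field_simps)
  with Cons.IH[of "value_step z p s"] Cons.prems(1) show ?case by (simp add: p)
qed simp

lemma total_value:
  assumes "check_inst p"
  defines "G \<equiv> game_of (of_tuple p)"
  assumes "sensed G \<psi> = {t. t < length (fst p) \<and> senses (p, y) t}"
  shows "0 < snd (total_value (p, y))" "unsensed_value G \<psi> = ratio_val (total_value (p, y))"
proof -
  let ?vs = "fst p"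
  have pos: "\<forall>q\<in>set (List.enumerate 0 ?vs). 0 < snd (snd q)"
    unfolding ball_enumerate using assms(1) nth_mem[of _ ?vs] by (auto simp: check_inst_def)
  have "(\<Sum>q\<leftarrow>List.enumerate 0 ?vs. if senses (p, y) (fst q) then 0 else ratio_val (snd q)) =
    (\<Sum>t<length ?vs. if senses (p, y) t then 0 else ratio_val (?vs ! t))"
    unfolding sum_list_sum_nth by (auto intro!: sum.cong simp: nth_enumerate_eq atLeast0LessThan)
  also have "\<dots> = (\<Sum>t\<in>{..<length ?vs} - {t. t < length ?vs \<and> senses (p, y) t}. ratio_val (?vs ! t))"
    by (rule sum.mono_neutral_cong_right) auto
  also have "\<dots> = unsensed_value G \<psi>"
    unfolding unsensed_value_def assms(3) by (simp add: G_def of_tuple_def tuple_inst_def game_of_def)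
  finally show "0 < snd (total_value (p, y))" "unsensed_value G \<psi> = ratio_val (total_value (p, y))"
    using fold_value_step[OF pos, of "(0, 1)" "(p, y)"] by (auto simp: total_value_def)
qed

lemma ratio_val_le:
  assumes "0 < snd r" "0 < snd q"
  shows "ratio_val r \<le> ratio_val q \<longleftrightarrow> fst r * snd q \<le> fst q * snd r"
proof -
  obtain a b c d where "r = (a, b)" "q = (c, d)" by (metis surj_pair)
  moreover have "real a / real b \<le> real c / real d \<longleftrightarrow> real (a * d) \<le> real (c * b)" if "0 < b" "0 < d"
    using that by (simp add: divide_simps mult.commute)
  ultimately show ?thesis using assms by (simp only: ratio_val.simps fst_conv snd_conv of_nat_le_iff)
qed


subsection \<open>The certificates\<close>

lemma zip_certificate:
  assumes "length y = length x"
  shows "map fst (zip x y) = x" "map snd (zip x y) = y"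
  using assms by simp_all

lemma in_NP_best_red_response: "best_red_response \<in> NP"
proof -
  \<comment> \<open>The first conjunct rejects all words that are no encodings; the last one
    compares the fractions by cross-multiplication.\<close>
  define R where "R w \<longleftrightarrow> (let x = map fst w; p = decode x; q = decode_threshold x; z = (p, map snd w) in
    to_bits (enc_inst (of_tuple p) @ enc_ratio q) = x \<and> check_inst p \<and> check_plan z \<and>
    0 < snd q \<and> fst (total_value z) * snd q \<le> fst q * snd (total_value z))" for w
  have fst: "ptc (\<lambda>w :: (bool \<times> bool) list. map fst w)" and snd: "ptc (\<lambda>w :: (bool \<times> bool) list. map snd w)"
    by (intro ptc_intros)+
  have p: "ptc (\<lambda>w :: (bool \<times> bool) list. decode (map fst w))" "ptc (\<lambda>w :: (bool \<times> bool) list. decode_threshold (map fst w))"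
    by (rule ptc_comp[OF fst ptc_decode(1)], rule ptc_comp[OF fst ptc_decode(2)])
  have z: "ptc (\<lambda>w :: (bool \<times> bool) list. (decode (map fst w), map snd w))"
    by (intro ptc_Pair p snd)
  have "ptc R" unfolding R_def Let_def
    by (intro ptc_intros p fst ptc_comp[OF p(1) ptc_enc_inst_of_tuple] ptc_comp[OF p(1) ptc_check_inst]
        ptc_comp[OF z ptc_check_plan] ptc_comp[OF z ptc_total_value])
  then have "{x. \<exists>w. map fst w = x \<and> R w} \<in> NP" by (rule NP_certificate)
  moreover have "{x. \<exists>w. map fst w = x \<and> R w} = best_red_response"
  proof (intro set_eqI iffI)
    fix x assume "x \<in> {x. \<exists>w. map fst w = x \<and> R w}"
    then obtain w where w: "map fst w = x" "R w" by blast
    define p q y where "p = decode x" and "q = decode_threshold x" and "y = map snd w"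
    have R: "to_bits (enc_inst (of_tuple p) @ enc_ratio q) = x" "check_inst p" "check_plan (p, y)" "0 < snd q"
      "fst (total_value (p, y)) * snd q \<le> fst q * snd (total_value (p, y))"
      using w by (auto simp: R_def p_def q_def y_def Let_def)
    let ?\<psi> = "plan_of (length (fst p)) y"
    have "unsensed_value (game_of (of_tuple p)) ?\<psi> \<le> ratio_val q"
      using total_value[OF R(2) check_plan_iff(2)[OF R(2)], of y] ratio_val_le R(4,5) by simp
    then show "x \<in> best_red_response"
      using R(1,4) check_plan_iff(1)[OF R(2), of y] R(3) wf_inst_of_tuple[of p] R(2)
      unfolding best_red_response_def by blast
  next
    fix x assume "x \<in> best_red_response"
    then obtain I q \<psi> where x: "x = to_bits (enc_inst I @ enc_ratio q)" and I: "wf_inst I" "snd q > 0"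
      "sensing_plan (game_of I) \<psi>" "valid_plan (game_of I) (order_of I) \<psi>" "unsensed_value (game_of I) \<psi> \<le> ratio_val q"
      unfolding best_red_response_def by blast
    have "enc_ratio q = concat (map enc_bools [binary (fst q), binary (snd q)])"
      by (cases q) (simp add: enc_nat_bools)
    then have p: "of_tuple (decode x) = I" unfolding x by (simp only: decode_enc_inst)
    have q: "decode_threshold x = q" unfolding x by (rule decode_threshold_enc)
    have c: "check_inst (decode x)" using I(1) wf_inst_of_tuple p by metis
    \<comment> \<open>The guess has exactly the length of the input, so the bits of the plan must
      fit into it.\<close>
    have "length (fst (decode x)) * length (fst (snd (snd (decode x)))) \<le> length x"
      using length_enc_inst[OF c, of "enc_ratio q"] unfolding p x[symmetric] .
    from plan_certificate[OF c this, unfolded p, OF I(3,4)] obtain y where y: "length y = length x"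
      "check_plan (decode x, y)" "sensed (game_of I) \<psi> = {t. t < length (fst (decode x)) \<and> senses (decode x, y) t}" by blast
    note tv = total_value[OF c, unfolded p, OF y(3)]
    have "R (zip x y)"
      unfolding R_def zip_certificate[OF y(1)] Let_def q p
      using c y(2) I(2,5) ratio_val_le[OF tv(1) I(2)] x tv(2) by simp
    then show "x \<in> {x. \<exists>w. map fst w = x \<and> R w}" using zip_certificate(1)[OF y(1)] by blast
  qed
  ultimately show ?thesis by simp
qed

lemma in_NP_sense_all_targets: "sense_all_targets \<in> NP"
proof -
  define R where "R w \<longleftrightarrow> (let x = map fst w; p = decode x; z = (p, map snd w) in
    to_bits (enc_inst (of_tuple p)) = x \<and> check_inst p \<and> check_plan z \<and>
    (\<forall>t\<in>set [0..<length (fst p)]. senses z t))" for w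
  have fst: "ptc (\<lambda>w :: (bool \<times> bool) list. map fst w)" and snd: "ptc (\<lambda>w :: (bool \<times> bool) list. map snd w)"
    by (intro ptc_intros)+
  have p: "ptc (\<lambda>w :: (bool \<times> bool) list. decode (map fst w))" by (rule ptc_comp[OF fst ptc_decode(1)])
  have z: "ptc (\<lambda>w :: (bool \<times> bool) list. (decode (map fst w), map snd w))"
    by (intro ptc_Pair p snd)
  have "ptc (\<lambda>q. senses (decode (map fst (fst q)), map snd (fst q)) (snd q))"
    by (rule ptc_comp2[OF ptc_senses]) (intro ptc_comp[OF ptc_fst[OF ptc_id] z] ptc_intros)+
  then have "ptc R" unfolding R_def Let_def
    by (intro ptc_bool ptc_Ball ptc_upt ptc_fst ptc_eq ptc_to_bits p fst ptc_comp[OF p ptc_enc_inst_of_tuple] ptc_comp[OF p ptc_check_inst]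
        ptc_comp[OF z ptc_check_plan])
  then have "{x. \<exists>w. map fst w = x \<and> R w} \<in> NP" by (rule NP_certificate)
  moreover have "{x. \<exists>w. map fst w = x \<and> R w} = sense_all_targets"
  proof (intro set_eqI iffI)
    fix x assume "x \<in> {x. \<exists>w. map fst w = x \<and> R w}"
    then obtain w where w: "map fst w = x" "R w" by blast
    define p y where "p = decode x" and "y = map snd w"
    have R: "to_bits (enc_inst (of_tuple p)) = x" "check_inst p" "check_plan (p, y)"
      "\<forall>t<length (fst p). senses (p, y) t"
      using w by (auto simp: R_def p_def y_def Let_def)
    let ?\<psi> = "plan_of (length (fst p)) y"
    have "sensed (game_of (of_tuple p)) ?\<psi> = targets (game_of (of_tuple p))"
      unfolding check_plan_iff(2)[OF R(2)] using R(4) by (auto simp: of_tuple_def tuple_inst_def game_of_def)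
    then show "x \<in> sense_all_targets"
      using R(1) check_plan_iff(1)[OF R(2), of y] R(3) wf_inst_of_tuple[of p] R(2)
      unfolding sense_all_targets_def by blast
  next
    fix x assume "x \<in> sense_all_targets"
    then obtain I \<psi> where x: "x = to_bits (enc_inst I)" and I: "wf_inst I"
      "sensing_plan (game_of I) \<psi>" "valid_plan (game_of I) (order_of I) \<psi>" "sensed (game_of I) \<psi> = targets (game_of I)"
      unfolding sense_all_targets_def by blast
    have p: "of_tuple (decode x) = I" using decode_enc_inst[of I "[]"] by (simp add: x)
    have c: "check_inst (decode x)" using I(1) wf_inst_of_tuple p by metis
    have "length (fst (decode x)) * length (fst (snd (snd (decode x)))) \<le> length x"
      using length_enc_inst[OF c, of "[]"] unfolding p append_Nil2 x[symmetric] .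
    from plan_certificate[OF c this, unfolded p, OF I(2,3)] obtain y where y: "length y = length x"
      "check_plan (decode x, y)" "sensed (game_of I) \<psi> = {t. t < length (fst (decode x)) \<and> senses (decode x, y) t}" by blast
    have "targets (game_of I) = {..<length (fst (decode x))}"
      unfolding p[symmetric] by (simp add: of_tuple_def tuple_inst_def game_of_def)
    then have "\<forall>t<length (fst (decode x)). senses (decode x, y) t" using y(3) I(4) by auto
    then have "R (zip x y)"
      unfolding R_def zip_certificate[OF y(1)] Let_def p using c y(2) x by simp
    then show "x \<in> {x. \<exists>w. map fst w = x \<and> R w}" using zip_certificate(1)[OF y(1)] by blast
  qed
  ultimately show ?thesis by simp
qed

theorem theorem1:
  "NP_complete best_red_response \<and> NP_complete sense_all_targets"
  unfolding NP_complete_def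
  using in_NP_best_red_response in_NP_sense_all_targets NP_hard_best_red_response NP_hard_sense_all_targets by blast


end
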